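(* Let $L$ be the minimal Sturm–Liouville operator on the metric graph $\mathcal G$ described in the context, let $D(L^* )=D(L)\oplus U$ with symplectic form $\rho$ on $U$ and projection $p:D(L^* )\to U$ along $D(L)$, let $\Lambda$ be a Lagrangian subspace of $(U,\rho)$ and let $\Lambda_D\subset U$ be the Dirichlet Lagrangian subspace. Assume that the quadratic forms of $L$ and of $L_\Lambda$ are bounded below and that $\mathrm n_-(L_{\Lambda_D})<\infty$. Then $$\mathrm n_-(L_\Lambda)-\mathrm n_-(L_{\Lambda_D})=\iota\big(p(\ker L^* ),\Lambda,\Lambda_D\big),$$ where $\mathrm n_-$ denotes the Morse index and $\iota$ the triple index.
   Context: **Graph.** $\mathcal G$ is a finite connected directed metric graph (loops and multiple edges allowed) with edges $j=1,\dots,m$; edge $j$ is identified with an interval $I_j$ with left end $a_j$ and right end $b_j$, of the form $[a_j,b_j]$, $[a_j,+\infty)$ or $(-\infty,b_j]$ (vertices at infinity have degree one). Fix $d\ge1$. Let $m_a$ (resp. $m_b$) be the number of finite left (resp. right) endpoints, $N_a=m_ad$, $N_b=m_bd$. $L^2(\mathcal G)=\bigoplus_j L^2(I_j;\mathbb R^d)$ (real Hilbert space); a function $f$ on $\mathcal G$ is a family $(f_j)_j$. **Operator.** On each edge let $\ell f=-(Pf'+Qf)'+Q^{\top}f'+Rf$, with $P_j(t)$ symmetric positive definite, $P_j^{-1}$ of class $C^1$ with symmetric values, $Q_j$ of class $C^1$ with values in $d\times d$ matrices, $R_j$ continuous with symmetric values. The minimal operator $L$ has domain $D(L)=\bigoplus_jW^{2,2}_0(I_j;\mathbb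 R^d)$ (functions vanishing with their first derivative at every finite endpoint); the maximal operator $L^*$ is its adjoint, with domain $D(L^* )=\bigoplus_jW^{2,2}(I_j;\mathbb R^d)$ (standing convention). $L$ is assumed to be a closed, densely defined, symmetric Fredholm operator. **Symplectic space.** $\omega(f,g)=\langle f,L^*g\rangle-\langle L^*f,g\rangle$ on $D(L^* )$. $U$ is a $2(N_a+N_b)$-dimensional subspace with $D(L^* )=D(L)\oplus U$; $\rho=\omega|_U$ is a symplectic form. For a Lagrangian $\Lambda\subset U$, $L_\Lambda:=L^*|_{D(L)\oplus\Lambda}$ is the corresponding self-adjoint extension. $\Lambda_D=U\cap\{f\in D(L^* ): f=0\text{ at every finite endpoint of every edge}\}$, so that $L_{\Lambda_D}$ is $L^*$ with Dirichlet conditions at all finite endpoints. **Forms and Morse index.** For symmetric $A$, $q_A[x]=\langle Ax,x\rangle$ on $D(A)$; it is bounded below if $q_A[x]\ge C\|x\|^2$ for some real constant $C$. The Morse index $\mathrm n_-(A)$ of a self-adjoint operator $A$ is the dimension of its negative spectral subspace (equivalently, the maximal dimension of a subspace on which its quadratic form is negative definite). **Triple index.** For Lagrangian subspaces $\alpha,\beta,\gamma$ of a finite-dimensional symplectic space $(V,\omega)$, $Q(\alpha,\beta;\gamma)$ is the quadratic form on $\alpha\cap(\beta+\gamma)$ given by $Q(\alpha,\beta;\gamma)[u]=\omega(u,v)$ where $v\in\beta$ is any vector with $u+v\in\gamma$. Then $\iota(\alpha,\beta,\gamma)=\mathrm n_+Q(\alpha,\beta;\gamma)+\dim(\alpha\cap\gamma)-\dim(\alpha\cap\beta\cap\gamma)$,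 where $\mathrm n_+$ is the number of positive squares. *)

theory Defs
  imports
    "HOL-Analysis.Analysis"
    "HOL-Library.Function_Algebras"
    "HOL-Library.Extended_Nat"
    "Graph_Theory.Digraph_Component"
begin

section \<open>Function spaces as real vector spaces\<close>

instantiation "fun" :: (type, real_vector) real_vector
begin

definition scaleR_fun :: "real \<Rightarrow> ('a \<Rightarrow> 'b) \<Rightarrow> 'a \<Rightarrow> 'b" where
  "scaleR_fun c f = (\<lambda>x. c *\<^sub>R f x)"

instance
  by standard (auto simp: scaleR_fun_def fun_eq_iff algebra_simps)

end

section \<open>Indices of quadratic forms, Lagrangian subspaces, triple index\<close>

definition subspace_sum :: "'a::real_vector set \<Rightarrow> 'a set \<Rightarrow> 'a set" where
  "subspace_sum A B = {a + b | a b. a \<in> A \<and> b \<in> B}"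

text \<open>
  Maximal dimension of a subspace of \<open>V\<close> on which \<open>q\<close> is positive definite (\<open>\<infinity>\<close> if these
  dimensions are unbounded).  The finite linearly independent sets \<open>B\<close> range over the bases of the
  finite-dimensional subspaces.
\<close>
definition pos_index :: "'a::real_vector set \<Rightarrow> ('a \<Rightarrow> real) \<Rightarrow> enat" where
  "pos_index V q =
     (SUP B \<in> {B. finite B \<and> independent B \<and> span B \<subseteq> V \<and> (\<forall>x\<in>span B. x \<noteq> 0 \<longrightarrow> 0 < q x)}.
        enat (card B))"

definition neg_index :: "'a::real_vector set \<Rightarrow> ('a \<Rightarrow> real) \<Rightarrow> enat" where
  "neg_index V q = pos_index V (\<lambda>x. - q x)"

definition lagrangian :: "('a::real_vector \<Rightarrow> 'a \<Rightarrow> real) \<Rightarrow> 'a set \<Rightarrow> 'a set \<Rightarrow> bool" where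
  "lagrangian \<omega> V \<Lambda> \<longleftrightarrow> subspace \<Lambda> \<and> \<Lambda> \<subseteq> V \<and> \<Lambda> = {u \<in> V. \<forall>v\<in>\<Lambda>. \<omega> u v = 0}"

text \<open>
  The form \<open>Q(\<alpha>, \<beta>; \<gamma>)\<close>, to be evaluated on \<open>\<alpha> \<inter> (\<beta> + \<gamma>)\<close>.  For Lagrangian \<open>\<alpha>, \<beta>, \<gamma>\<close> the
  value does not depend on the choice of \<open>v\<close>.
\<close>
definition triple_form ::
  "('a::real_vector \<Rightarrow> 'a \<Rightarrow> real) \<Rightarrow> 'a set \<Rightarrow> 'a set \<Rightarrow> 'a \<Rightarrow> real" where
  "triple_form \<omega> \<beta> \<gamma> u = \<omega> u (SOME v. v \<in> \<beta> \<and> u + v \<in> \<gamma>)"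

definition triple_index ::
  "('a::real_vector \<Rightarrow> 'a \<Rightarrow> real) \<Rightarrow> 'a set \<Rightarrow> 'a set \<Rightarrow> 'a set \<Rightarrow> int" where
  "triple_index \<omega> \<alpha> \<beta> \<gamma> =
     int (the_enat (pos_index (\<alpha> \<inter> subspace_sum \<beta> \<gamma>) (triple_form \<omega> \<beta> \<gamma>)))
     + int (dim (\<alpha> \<inter> \<gamma>)) - int (dim (\<alpha> \<inter> \<beta> \<inter> \<gamma>))"

definition proj_along :: "'a::real_vector set \<Rightarrow> 'a set \<Rightarrow> 'a \<Rightarrow> 'a" where
  "proj_along D U f = (THE u. u \<in> U \<and> f - u \<in> D)"

section \<open>Metric graphs\<close>

text \<open>
  The edge \<open>j\<close> runs from \<open>tail j\<close>, at the left end of its interval, to \<open>head j\<close>, at the right end.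
\<close>
record ('v, 'e) metric_graph =
  digraph_of :: "('v, 'e) pre_digraph"
  left_end :: "'e \<Rightarrow> ereal"
  right_end :: "'e \<Rightarrow> ereal"

definition edges :: "('v, 'e) metric_graph \<Rightarrow> 'e set" where
  "edges \<Gamma> = arcs (digraph_of \<Gamma>)"

definition edge_interval :: "('v, 'e) metric_graph \<Rightarrow> 'e \<Rightarrow> real set" where
  "edge_interval \<Gamma> j = {t. left_end \<Gamma> j \<le> ereal t \<and> ereal t \<le> right_end \<Gamma> j}"

definition vertex_degree :: "('v, 'e) metric_graph \<Rightarrow> 'v \<Rightarrow> nat" where
  "vertex_degree \<Gamma> v = in_degree (digraph_of \<Gamma>) v + out_degree (digraph_of \<Gamma>) v"

definition is_metric_graph :: "('v, 'e) metric_graph \<Rightarrow> bool" where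
  "is_metric_graph \<Gamma> \<longleftrightarrow>
     fin_digraph (digraph_of \<Gamma>) \<and> Digraph_Component.connected (digraph_of \<Gamma>) \<and> edges \<Gamma> \<noteq> {} \<and>
     (\<forall>j\<in>edges \<Gamma>.
        left_end \<Gamma> j < right_end \<Gamma> j \<and>
        \<not> (left_end \<Gamma> j = -\<infinity> \<and> right_end \<Gamma> j = \<infinity>) \<and>
        (left_end \<Gamma> j = -\<infinity> \<longrightarrow> vertex_degree \<Gamma> (tail (digraph_of \<Gamma>) j) = 1) \<and>
        (right_end \<Gamma> j = \<infinity> \<longrightarrow> vertex_degree \<Gamma> (head (digraph_of \<Gamma>) j) = 1))"

definition num_left_ends :: "('v, 'e) metric_graph \<Rightarrow> nat" where
  "num_left_ends \<Gamma> = card {j \<in> edges \<Gamma>. left_end \<Gamma> j \<noteq> -\<infinity>}"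

definition num_right_ends :: "('v, 'e) metric_graph \<Rightarrow> nat" where
  "num_right_ends \<Gamma> = card {j \<in> edges \<Gamma>. right_end \<Gamma> j \<noteq> \<infinity>}"

definition finite_ends :: "('v, 'e) metric_graph \<Rightarrow> 'e \<Rightarrow> real set" where
  "finite_ends \<Gamma> j = {t. ereal t = left_end \<Gamma> j \<or> ereal t = right_end \<Gamma> j}"

section \<open>The Hilbert space of square integrable functions on a metric graph\<close>

text \<open>
  Elements of the Hilbert space are given by representatives \<open>f :: 'e \<Rightarrow> real \<Rightarrow> real^'d\<close>, of which
  only the values \<open>f j t\<close> with \<open>t\<close> in the interval of the edge \<open>j\<close> matter; two representatives
  define the same element iff they are related by \<open>ae_equal\<close>.
\<close>

definition square_integrable_on :: "(real \<Rightarrow> real^'d) \<Rightarrow> real set \<Rightarrow> bool" where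
  "square_integrable_on f I \<longleftrightarrow>
     f \<in> borel_measurable (lebesgue_on I) \<and> integrable (lebesgue_on I) (\<lambda>t. (norm (f t))\<^sup>2)"

definition L2 :: "('v, 'e) metric_graph \<Rightarrow> ('e \<Rightarrow> real \<Rightarrow> real^'d) set" where
  "L2 \<Gamma> = {f. \<forall>j\<in>edges \<Gamma>. square_integrable_on (f j) (edge_interval \<Gamma> j)}"

definition ae_equal ::
  "('v, 'e) metric_graph \<Rightarrow> ('e \<Rightarrow> real \<Rightarrow> real^'d) \<Rightarrow> ('e \<Rightarrow> real \<Rightarrow> real^'d) \<Rightarrow> bool" where
  "ae_equal \<Gamma> f g \<longleftrightarrow> (\<forall>j\<in>edges \<Gamma>. AE t in lebesgue_on (edge_interval \<Gamma> j). f j t = g j t)"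

definition L2_inner ::
  "('v, 'e) metric_graph \<Rightarrow> ('e \<Rightarrow> real \<Rightarrow> real^'d) \<Rightarrow> ('e \<Rightarrow> real \<Rightarrow> real^'d) \<Rightarrow> real" where
  "L2_inner \<Gamma> f g =
     (\<Sum>j\<in>edges \<Gamma>. integral\<^sup>L (lebesgue_on (edge_interval \<Gamma> j)) (\<lambda>t. f j t \<bullet> g j t))"

definition L2_norm :: "('v, 'e) metric_graph \<Rightarrow> ('e \<Rightarrow> real \<Rightarrow> real^'d) \<Rightarrow> real" where
  "L2_norm \<Gamma> f = sqrt (L2_inner \<Gamma> f f)"

section \<open>Unbounded operators in this Hilbert space\<close>

text \<open>The values \<open>act T f\<close> are relevant for \<open>f \<in> dom T\<close> only, and only up to \<open>ae_equal\<close>.\<close>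
record 'f unbounded_op =
  dom :: "'f set"
  act :: "'f \<Rightarrow> 'f"

definition L2_operator ::
  "('v, 'e) metric_graph \<Rightarrow> ('e \<Rightarrow> real \<Rightarrow> real^'d) unbounded_op \<Rightarrow> bool" where
  "L2_operator \<Gamma> T \<longleftrightarrow> subspace (dom T) \<and> dom T \<subseteq> L2 \<Gamma> \<and> act T ` dom T \<subseteq> L2 \<Gamma>"

text \<open>The graph of an operator, as a relation closed under change of representatives.\<close>
definition op_graph ::
  "('v, 'e) metric_graph \<Rightarrow> ('e \<Rightarrow> real \<Rightarrow> real^'d) unbounded_op \<Rightarrow>
     (('e \<Rightarrow> real \<Rightarrow> real^'d) \<times> ('e \<Rightarrow> real \<Rightarrow> real^'d)) set" where
  "op_graph \<Gamma> T = {(g, h). \<exists>f\<in>dom T. ae_equal \<Gamma> g f \<and> ae_equal \<Gamma> h (act T f)}"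

definition adjoint_graph ::
  "('v, 'e) metric_graph \<Rightarrow> ('e \<Rightarrow> real \<Rightarrow> real^'d) unbounded_op \<Rightarrow>
     (('e \<Rightarrow> real \<Rightarrow> real^'d) \<times> ('e \<Rightarrow> real \<Rightarrow> real^'d)) set" where
  "adjoint_graph \<Gamma> T =
     {(g, h). g \<in> L2 \<Gamma> \<and> h \<in> L2 \<Gamma> \<and> (\<forall>f\<in>dom T. L2_inner \<Gamma> (act T f) g = L2_inner \<Gamma> f h)}"

definition is_adjoint ::
  "('v, 'e) metric_graph \<Rightarrow> ('e \<Rightarrow> real \<Rightarrow> real^'d) unbounded_op \<Rightarrow>
     ('e \<Rightarrow> real \<Rightarrow> real^'d) unbounded_op \<Rightarrow> bool" where
  "is_adjoint \<Gamma> S T \<longleftrightarrow> op_graph \<Gamma> S = adjoint_graph \<Gamma> T"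

definition densely_defined ::
  "('v, 'e) metric_graph \<Rightarrow> ('e \<Rightarrow> real \<Rightarrow> real^'d) unbounded_op \<Rightarrow> bool" where
  "densely_defined \<Gamma> T \<longleftrightarrow> (\<forall>g\<in>L2 \<Gamma>. \<forall>\<epsilon>>0. \<exists>f\<in>dom T. L2_norm \<Gamma> (g - f) < \<epsilon>)"

definition closed_op ::
  "('v, 'e) metric_graph \<Rightarrow> ('e \<Rightarrow> real \<Rightarrow> real^'d) unbounded_op \<Rightarrow> bool" where
  "closed_op \<Gamma> T \<longleftrightarrow>
     (\<forall>u. \<forall>g\<in>L2 \<Gamma>. \<forall>h\<in>L2 \<Gamma>.
        (\<forall>n::nat. u n \<in> dom T) \<and>
        (\<lambda>n. L2_norm \<Gamma> (u n - g)) \<longlonglongrightarrow> 0 \<and> (\<lambda>n. L2_norm \<Gamma> (act T (u n) - h)) \<longlonglongrightarrow> 0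
        \<longrightarrow> (g, h) \<in> op_graph \<Gamma> T)"

definition symmetric_op ::
  "('v, 'e) metric_graph \<Rightarrow> ('e \<Rightarrow> real \<Rightarrow> real^'d) unbounded_op \<Rightarrow> bool" where
  "symmetric_op \<Gamma> T \<longleftrightarrow>
     (\<forall>f\<in>dom T. \<forall>g\<in>dom T. L2_inner \<Gamma> (act T f) g = L2_inner \<Gamma> f (act T g))"

definition ker ::
  "('v, 'e) metric_graph \<Rightarrow> ('e \<Rightarrow> real \<Rightarrow> real^'d) unbounded_op \<Rightarrow>
     ('e \<Rightarrow> real \<Rightarrow> real^'d) set" where
  "ker \<Gamma> T = {f \<in> dom T. ae_equal \<Gamma> (act T f) 0}"

definition fredholm_op ::
  "('v, 'e) metric_graph \<Rightarrow> ('e \<Rightarrow> real \<Rightarrow> real^'d) unbounded_op \<Rightarrow> bool" where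
  "fredholm_op \<Gamma> T \<longleftrightarrow>
     (\<exists>B. finite B \<and> ker \<Gamma> T \<subseteq> span B) \<and>
     (\<forall>u. \<forall>h\<in>L2 \<Gamma>. (\<forall>n::nat. u n \<in> dom T) \<and> (\<lambda>n. L2_norm \<Gamma> (act T (u n) - h)) \<longlonglongrightarrow> 0
        \<longrightarrow> (\<exists>f\<in>dom T. ae_equal \<Gamma> h (act T f))) \<and>
     (\<exists>B. finite B \<and> B \<subseteq> L2 \<Gamma> \<and>
        (\<forall>h\<in>L2 \<Gamma>. \<exists>f\<in>dom T. \<exists>w\<in>span B. ae_equal \<Gamma> h (act T f + w)))"

definition op_form ::
  "('v, 'e) metric_graph \<Rightarrow> ('e \<Rightarrow> real \<Rightarrow> real^'d) unbounded_op \<Rightarrow>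
     ('e \<Rightarrow> real \<Rightarrow> real^'d) \<Rightarrow> real" where
  "op_form \<Gamma> T f = L2_inner \<Gamma> (act T f) f"

definition form_bounded_below ::
  "('v, 'e) metric_graph \<Rightarrow> ('e \<Rightarrow> real \<Rightarrow> real^'d) unbounded_op \<Rightarrow> bool" where
  "form_bounded_below \<Gamma> T \<longleftrightarrow> (\<exists>C::real. \<forall>f\<in>dom T. C * (L2_norm \<Gamma> f)\<^sup>2 \<le> op_form \<Gamma> T f)"

text \<open>
  Vector space dimensions are computed in \<open>dom T\<close> itself, so this is meant for domains which contain
  only one representative of each element; \<open>W22\<close> below has this property.
\<close>
definition morse_index ::
  "('v, 'e) metric_graph \<Rightarrow> ('e \<Rightarrow> real \<Rightarrow> real^'d) unbounded_op \<Rightarrow> enat" where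
  "morse_index \<Gamma> T = neg_index (dom T) (op_form \<Gamma> T)"

section \<open>Sturm--Liouville operators\<close>

definition edge_deriv ::
  "('v, 'e) metric_graph \<Rightarrow> ('e \<Rightarrow> real \<Rightarrow> real^'d) \<Rightarrow> 'e \<Rightarrow> real \<Rightarrow> real^'d" where
  "edge_deriv \<Gamma> f j t = vector_derivative (f j) (at t within edge_interval \<Gamma> j)"

text \<open>
  \<open>f\<close> is an indefinite integral of the locally integrable function \<open>g\<close> on the interval \<open>I\<close>, that is,
  \<open>f\<close> is locally absolutely continuous on \<open>I\<close> with \<open>f' = g\<close> almost everywhere.
\<close>
definition has_weak_deriv_on :: "(real \<Rightarrow> real^'d) \<Rightarrow> (real \<Rightarrow> real^'d) \<Rightarrow> real set \<Rightarrow> bool" where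
  "has_weak_deriv_on f g I \<longleftrightarrow>
     (\<forall>s\<in>I. \<forall>t\<in>I. s \<le> t \<longrightarrow> (g has_integral (f t - f s)) {s..t})"

text \<open>
  Direct sum over the edges of the Sobolev spaces of order 2 with exponent 2.  Each element is given
  by its unique continuously differentiable representative, extended by 0 off the edges.
\<close>
definition W22 :: "('v, 'e) metric_graph \<Rightarrow> ('e \<Rightarrow> real \<Rightarrow> real^'d) set" where
  "W22 \<Gamma> = {f.
     (\<forall>j t. j \<notin> edges \<Gamma> \<or> t \<notin> edge_interval \<Gamma> j \<longrightarrow> f j t = 0) \<and>
     (\<forall>j\<in>edges \<Gamma>. \<exists>f' f''.
        square_integrable_on (f j) (edge_interval \<Gamma> j) \<and>
        square_integrable_on f' (edge_interval \<Gamma> j) \<and>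
        square_integrable_on f'' (edge_interval \<Gamma> j) \<and>
        has_weak_deriv_on (f j) f' (edge_interval \<Gamma> j) \<and>
        has_weak_deriv_on f' f'' (edge_interval \<Gamma> j))}"

definition W22_0 :: "('v, 'e) metric_graph \<Rightarrow> ('e \<Rightarrow> real \<Rightarrow> real^'d) set" where
  "W22_0 \<Gamma> = {f \<in> W22 \<Gamma>. \<forall>j\<in>edges \<Gamma>. \<forall>t\<in>finite_ends \<Gamma> j. f j t = 0 \<and> edge_deriv \<Gamma> f j t = 0}"

definition C1_on :: "(real \<Rightarrow> 'a::real_normed_vector) \<Rightarrow> real set \<Rightarrow> bool" where
  "C1_on f I \<longleftrightarrow>
     (\<exists>f'. continuous_on I f' \<and> (\<forall>t\<in>I. (f has_vector_derivative f' t) (at t within I)))"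

definition symmetric_matrix :: "real^'d^'d \<Rightarrow> bool" where
  "symmetric_matrix A \<longleftrightarrow> transpose A = A"

definition positive_definite_matrix :: "real^'d^'d \<Rightarrow> bool" where
  "positive_definite_matrix A \<longleftrightarrow> (\<forall>x. x \<noteq> 0 \<longrightarrow> 0 < x \<bullet> (A *v x))"

definition sl_coefficients ::
  "('v, 'e) metric_graph \<Rightarrow> ('e \<Rightarrow> real \<Rightarrow> real^'d^'d) \<Rightarrow> ('e \<Rightarrow> real \<Rightarrow> real^'d^'d) \<Rightarrow>
     ('e \<Rightarrow> real \<Rightarrow> real^'d^'d) \<Rightarrow> bool" where
  "sl_coefficients \<Gamma> P Q R \<longleftrightarrow>
     (\<forall>j\<in>edges \<Gamma>.
        (\<forall>t\<in>edge_interval \<Gamma> j. symmetric_matrix (P j t) \<and> positive_definite_matrix (P j t)) \<and>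
        C1_on (\<lambda>t. matrix_inv (P j t)) (edge_interval \<Gamma> j) \<and>
        (\<forall>t\<in>edge_interval \<Gamma> j. symmetric_matrix (matrix_inv (P j t))) \<and>
        C1_on (Q j) (edge_interval \<Gamma> j) \<and>
        continuous_on (edge_interval \<Gamma> j) (R j) \<and>
        (\<forall>t\<in>edge_interval \<Gamma> j. symmetric_matrix (R j t)))"

text \<open>The outer derivative exists almost everywhere for \<open>f \<in> W22 \<Gamma>\<close>.\<close>
definition sl_expr ::
  "('v, 'e) metric_graph \<Rightarrow> ('e \<Rightarrow> real \<Rightarrow> real^'d^'d) \<Rightarrow> ('e \<Rightarrow> real \<Rightarrow> real^'d^'d) \<Rightarrow>
     ('e \<Rightarrow> real \<Rightarrow> real^'d^'d) \<Rightarrow> ('e \<Rightarrow> real \<Rightarrow> real^'d) \<Rightarrow> 'e \<Rightarrow> real \<Rightarrow> real^'d" where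
  "sl_expr \<Gamma> P Q R f j t =
     - edge_deriv \<Gamma> (\<lambda>j s. P j s *v edge_deriv \<Gamma> f j s + Q j s *v f j s) j t
     + transpose (Q j t) *v edge_deriv \<Gamma> f j t + R j t *v f j t"

definition minimal_op ::
  "('v, 'e) metric_graph \<Rightarrow> ('e \<Rightarrow> real \<Rightarrow> real^'d^'d) \<Rightarrow> ('e \<Rightarrow> real \<Rightarrow> real^'d^'d) \<Rightarrow>
     ('e \<Rightarrow> real \<Rightarrow> real^'d^'d) \<Rightarrow> ('e \<Rightarrow> real \<Rightarrow> real^'d) unbounded_op" where
  "minimal_op \<Gamma> P Q R = \<lparr>dom = W22_0 \<Gamma>, act = sl_expr \<Gamma> P Q R\<rparr>"

definition maximal_op ::
  "('v, 'e) metric_graph \<Rightarrow> ('e \<Rightarrow> real \<Rightarrow> real^'d^'d) \<Rightarrow> ('e \<Rightarrow> real \<Rightarrow> real^'d^'d) \<Rightarrow>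
     ('e \<Rightarrow> real \<Rightarrow> real^'d^'d) \<Rightarrow> ('e \<Rightarrow> real \<Rightarrow> real^'d) unbounded_op" where
  "maximal_op \<Gamma> P Q R = \<lparr>dom = W22 \<Gamma>, act = sl_expr \<Gamma> P Q R\<rparr>"

definition extension_op ::
  "('v, 'e) metric_graph \<Rightarrow> ('e \<Rightarrow> real \<Rightarrow> real^'d^'d) \<Rightarrow> ('e \<Rightarrow> real \<Rightarrow> real^'d^'d) \<Rightarrow>
     ('e \<Rightarrow> real \<Rightarrow> real^'d^'d) \<Rightarrow> ('e \<Rightarrow> real \<Rightarrow> real^'d) set \<Rightarrow>
     ('e \<Rightarrow> real \<Rightarrow> real^'d) unbounded_op" where
  "extension_op \<Gamma> P Q R \<Lambda> =
     \<lparr>dom = subspace_sum (dom (minimal_op \<Gamma> P Q R)) \<Lambda>, act = act (maximal_op \<Gamma> P Q R)\<rparr>"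

definition boundary_form ::
  "('v, 'e) metric_graph \<Rightarrow> ('e \<Rightarrow> real \<Rightarrow> real^'d^'d) \<Rightarrow> ('e \<Rightarrow> real \<Rightarrow> real^'d^'d) \<Rightarrow>
     ('e \<Rightarrow> real \<Rightarrow> real^'d^'d) \<Rightarrow> ('e \<Rightarrow> real \<Rightarrow> real^'d) \<Rightarrow> ('e \<Rightarrow> real \<Rightarrow> real^'d) \<Rightarrow> real" where
  "boundary_form \<Gamma> P Q R f g =
     L2_inner \<Gamma> f (act (maximal_op \<Gamma> P Q R) g) - L2_inner \<Gamma> (act (maximal_op \<Gamma> P Q R) f) g"

definition boundary_space ::
  "('v, 'e) metric_graph \<Rightarrow> ('e \<Rightarrow> real \<Rightarrow> real^'d^'d) \<Rightarrow> ('e \<Rightarrow> real \<Rightarrow> real^'d^'d) \<Rightarrow>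
     ('e \<Rightarrow> real \<Rightarrow> real^'d^'d) \<Rightarrow> ('e \<Rightarrow> real \<Rightarrow> real^'d) set \<Rightarrow> bool" where
  "boundary_space \<Gamma> P Q R U \<longleftrightarrow>
     subspace U \<and>
     dim U = 2 * (num_left_ends \<Gamma> * CARD('d) + num_right_ends \<Gamma> * CARD('d)) \<and>
     dom (maximal_op \<Gamma> P Q R) = subspace_sum (dom (minimal_op \<Gamma> P Q R)) U \<and>
     dom (minimal_op \<Gamma> P Q R) \<inter> U = {0}"

definition dirichlet_space ::
  "('v, 'e) metric_graph \<Rightarrow> ('e \<Rightarrow> real \<Rightarrow> real^'d) set \<Rightarrow> ('e \<Rightarrow> real \<Rightarrow> real^'d) set" where
  "dirichlet_space \<Gamma> U = U \<inter> {f \<in> W22 \<Gamma>. \<forall>j\<in>edges \<Gamma>. \<forall>t\<in>finite_ends \<Gamma> j. f j t = 0}"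

end

theory Submission
  imports Defs
begin

text \<open>
  Let \<open>h(f, g) = \<langle>L\<^sup>* f, g\<rangle>\<close>, \<open>D\<^sub>X = D(L) + X\<close> and \<open>K = ker L\<^sup>*\<close>.  On \<open>D\<^sub>\<Lambda> \<times> D\<^sub>G\<close>, where \<open>G\<close> is the Dirichlet
  subspace, consider the symmetric form \<open>b((f, g)) = h(f, f) + 2 h(f, g) + h(g, g)\<close>.  Functions with
  Dirichlet boundary values are limits, in the sense of the form, of functions in \<open>D(L)\<close>, and the pairs
  \<open>(d, - d)\<close> with \<open>d \<in> D(L)\<close> lie in the radical; hence \<open>b\<close> has the same negative index as \<open>L\<^sub>\<Lambda>\<close>.  On the
  other hand the orthogonal complement of \<open>V = 0 \<times> D\<^sub>G\<close> consists of the pairs with \<open>f + g \<in> K\<close>, where \<open>b\<close>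
  is minus the form of the triple index.  The negative index of \<open>b\<close> is the sum of those of \<open>V\<close> and of its
  complement, plus the dimension of the intersection of the two modulo the radical of \<open>b\<close>, which is
  \<open>dim (p K \<inter> G) - dim (p K \<inter> \<Lambda> \<inter> G)\<close>.  This count uses that \<open>p K\<close> is Lagrangian, which is the closed range
  property of \<open>L\<close>, and that \<open>G\<close> is Lagrangian, which is Green's formula for functions concentrated near
  the finite end points.
\<close>

section \<open>Negative index of a symmetric bilinear form\<close>

text \<open>Neither of the two operator domains contains the other, so their forms cannot be
  compared by restriction; the product \<open>D\<^sub>\<Lambda> \<times> D\<^sub>G\<close> contains
  a copy of each. In infinite dimension a subspace and its orthogonal complement need not span, and
  \<open>b\<close> is degenerate; hence finite negative orthonormal sets with a nonnegative form on
  their complement take the place of spectral subspaces. An isotropic vector outside the radical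
  generates a hyperbolic plane and so raises the index by one, which is where the dimension terms of
  the triple index come from. The analytic obstacle is that the operator is given pointwise, by
  derivatives of representatives, with coefficients that may be unbounded on half-lines. Integration
  by parts is therefore carried out only against C^2 bumps at the finite ends; every other function
  is reduced to bumps modulo the minimal domain, where adjointness does the work of Green's formula.
  Linearity of the operator, too, is obtained only after pairing with L^2 functions, from density
  and adjointness.\<close>

locale sym_bilinear =
  fixes b :: "'a::real_vector \<Rightarrow> 'a \<Rightarrow> real"
  assumes bilin: "bilinear b" and sym: "b x y = b y x"
begin

lemmas ladd = bilinear_ladd[OF bilin]
  and radd = bilinear_radd[OF bilin]
  and lscale = bilinear_lmul[OF bilin, unfolded real_scaleR_def]
  and rscale = bilinear_rmul[OF bilin, unfolded real_scaleR_def]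
  and lsub = bilinear_lsub[OF bilin]
  and rsub = bilinear_rsub[OF bilin]

lemma lzero [simp]: "b 0 x = 0" and rzero [simp]: "b x 0 = 0"
  using bilinear_lzero[OF bilin] bilinear_rzero[OF bilin] by blast+

lemma linear_left: "linear (\<lambda>x. b x y)" and linear_right: "linear (b x)"
  using bilin by (auto simp: bilinear_def)

lemma lsum: "b (sum f A) y = (\<Sum>x\<in>A. b (f x) y)"
  using linear_sum[OF linear_left] by blast

lemma rsum: "b y (sum f A) = (\<Sum>x\<in>A. b y (f x))"
  using linear_sum[OF linear_right] by blast

definition neg_orthonormal :: "'a set \<Rightarrow> bool" where
  "neg_orthonormal B \<longleftrightarrow> finite B \<and> (\<forall>x\<in>B. \<forall>y\<in>B. b x y = (if x = y then -1 else 0))"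

text \<open>Plays the part of a basis of the negative spectral subspace, stated without any
  decomposition of V, which may be infinite-dimensional and on which \<open>b\<close> may be
  degenerate.\<close>

definition neg_basis :: "'a set \<Rightarrow> 'a set \<Rightarrow> bool" where
  "neg_basis V B \<longleftrightarrow>
     neg_orthonormal B \<and> B \<subseteq> V \<and> (\<forall>v\<in>V. (\<forall>x\<in>B. b x v = 0) \<longrightarrow> 0 \<le> b v v)"

text \<open>The component of \<open>v\<close> orthogonal to B; the sign is plus because
  \<open>b x x = -1\<close> on B.\<close>

definition remove :: "'a set \<Rightarrow> 'a \<Rightarrow> 'a" where
  "remove B v = v + (\<Sum>x\<in>B. b x v *\<^sub>R x)"

lemma orthogonal_remove:
  assumes "neg_orthonormal B" "y \<in> B"
  shows "b y (remove B v) = 0"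
proof -
  have "(\<Sum>x\<in>B. b x v * b y x) = (\<Sum>x\<in>B. if x = y then - b y v else 0)"
    using assms by (intro sum.cong) (auto simp: neg_orthonormal_def)
  also have "\<dots> = - b y v"
    using assms by (simp add: neg_orthonormal_def)
  finally show ?thesis
    by (simp add: remove_def radd rsum rscale)
qed

lemma form_remove:
  assumes "neg_orthonormal B"
  shows "b (remove B v) (remove B v) = b v v + (\<Sum>x\<in>B. (b x v)\<^sup>2)"
proof -
  have "b (remove B v) (remove B v) = b v (remove B v) + (\<Sum>x\<in>B. b x v * b x (remove B v))"
    by (subst (1) remove_def) (simp add: ladd lsum lscale)
  also have "\<dots> = b v (remove B v)"
    using orthogonal_remove[OF assms] by simp
  also have "\<dots> = b v v + (\<Sum>x\<in>B. b x v * b v x)"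
    by (simp add: remove_def radd rsum rscale)
  also have "(\<Sum>x\<in>B. b x v * b v x) = (\<Sum>x\<in>B. (b x v)\<^sup>2)"
    by (intro sum.cong refl) (metis sym power2_eq_square)
  finally show ?thesis .
qed

lemma remove_in_subspace: "subspace V \<Longrightarrow> B \<subseteq> V \<Longrightarrow> v \<in> V \<Longrightarrow> remove B v \<in> V"
  unfolding remove_def
  by (intro subspace_add[of V] real_vector.subspace_sum[of V] subspace_scale[of V]) blast+

lemma linear_remove: "linear (remove B)"
  unfolding remove_def
  by (intro linearI) (auto simp: radd rscale scaleR_add_left sum.distrib scaleR_sum_right algebra_simps)

lemma remove_eq_0:
  assumes "neg_orthonormal B" "v \<in> span B"
  shows "remove B v = 0"
proof (rule linear_eq_on[OF linear_remove _ assms(2)])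
  show "linear (\<lambda>_. 0 :: 'a)" by (rule module_hom_zero)
next
  fix y assume "y \<in> B"
  have "(\<Sum>x\<in>B. b x y *\<^sub>R x) = (\<Sum>x\<in>B. if x = y then - y else 0)"
    using assms(1) \<open>y \<in> B\<close> by (intro sum.cong) (auto simp: neg_orthonormal_def)
  also have "\<dots> = - y"
    using assms \<open>y \<in> B\<close> by (simp add: neg_orthonormal_def)
  finally show "remove B y = 0"
    by (simp add: remove_def)
qed

lemma neg_on_span:
  assumes "neg_orthonormal B" "v \<in> span B" "v \<noteq> 0"
  shows "b v v < 0"
proof -
  have *: "b v v = - (\<Sum>x\<in>B. (b x v)\<^sup>2)"
    using form_remove[OF assms(1), of v] remove_eq_0[OF assms(1,2)] by simp
  have "\<exists>x\<in>B. b x v \<noteq> 0"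
  proof (rule ccontr)
    assume "\<not> (\<exists>x\<in>B. b x v \<noteq> 0)"
    then show False using remove_eq_0[OF assms(1,2)] assms(3) by (simp add: remove_def)
  qed
  then have "0 < (\<Sum>x\<in>B. (b x v)\<^sup>2)"
    using assms(1) by (auto intro: sum_pos2 simp: neg_orthonormal_def)
  with * show ?thesis by simp
qed

lemma neg_orthonormal_independent:
  assumes "neg_orthonormal B"
  shows "independent B"
proof
  assume "dependent B"
  then obtain a where a: "a \<in> B" "a \<in> span (B - {a})"
    unfolding dependent_def by blast
  have "b a a = 0"
  proof (rule linear_eq_on[OF linear_right _ a(2), of "\<lambda>_. 0"])
    show "b a y = 0" if "y \<in> B - {a}" for y
      using that a assms by (auto simp: neg_orthonormal_def)
  qed (rule module_hom_zero)
  with assms a show False by (simp add: neg_orthonormal_def)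
qed

lemma neg_orthonormal_insert:
  assumes "neg_orthonormal B" "\<forall>x\<in>B. b x v = 0" "b v v < 0"
  defines "w \<equiv> (1 / sqrt (- b v v)) *\<^sub>R v"
  shows "neg_orthonormal (insert w B)" "w \<notin> B"
proof -
  have w: "b w w = -1"
    using assms(3) by (simp add: w_def lscale rscale field_simps)
  have x: "b x w = 0" "b w x = 0" if "x \<in> B" for x
    using assms(2) that by (simp_all add: w_def rscale lscale sym[of v x])
  show "w \<notin> B" using w x by fastforce
  with assms(1) w x show "neg_orthonormal (insert w B)"
    by (auto simp: neg_orthonormal_def)
qed

lemma card_le_neg_index:
  assumes "subspace V" "neg_orthonormal B" "B \<subseteq> V" "\<And>v. v \<in> V \<Longrightarrow> q v = b v v"
  shows "enat (card B) \<le> neg_index V q"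
proof -
  have "span B \<subseteq> V" using assms by (simp add: span_minimal)
  moreover have "finite B" using assms(2) by (simp add: neg_orthonormal_def)
  moreover have "0 < - q x" if "x \<in> span B" "x \<noteq> 0" for x
    using neg_on_span[OF assms(2) that] that assms(4)[of x] \<open>span B \<subseteq> V\<close> by auto
  ultimately show ?thesis
    unfolding neg_index_def pos_index_def
    using neg_orthonormal_independent[OF assms(2)]
    by (intro SUP_upper) auto
qed

text \<open>A subspace on which the form is negative meets the kernel of the projection
  \<open>T\<close> to \<open>span B\<close> only in 0, since vectors of V orthogonal to B have
  nonnegative form. Hence \<open>T\<close> embeds it into \<open>span B\<close>.\<close>

lemma neg_index_neg_basis:
  assumes "subspace V" "neg_basis V B" "\<And>v. v \<in> V \<Longrightarrow> q v = b v v"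
  shows "neg_index V q = enat (card B)"
proof (rule antisym)
  have B: "neg_orthonormal B" "B \<subseteq> V" "finite B"
    using assms(2) by (auto simp: neg_basis_def neg_orthonormal_def)
  show "enat (card B) \<le> neg_index V q"
    using card_le_neg_index[OF assms(1) B(1,2) assms(3)] .
  have "card C \<le> card B"
    if C: "finite C" "independent C" "span C \<subseteq> V" "\<forall>x\<in>span C. x \<noteq> 0 \<longrightarrow> 0 < - q x" for C
  proof -
    define T where "T v = (\<Sum>x\<in>B. b x v *\<^sub>R x)" for v
    have lin: "linear T"
      unfolding T_def
      by (intro linearI) (auto simp: radd rscale scaleR_add_left sum.distrib scaleR_sum_right)
    have "inj_on T (span C)"
    proof (subst linear_injective_on_subspace_0[OF lin subspace_span], intro ballI impI)
      fix v assume v: "v \<in> span C" "T v = 0"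
      then have "remove B v = v" by (simp add: remove_def T_def)
      then have "\<forall>x\<in>B. b x v = 0" using orthogonal_remove[OF B(1)] by metis
      then have "0 \<le> b v v" using assms(2) v C(3) by (auto simp: neg_basis_def)
      then show "v = 0" using C(3,4) v assms(3) by fastforce
    qed
    then have "independent (T ` C)" "inj_on T C"
      using linear_independent_injective_image[OF lin C(2)] inj_on_subset[OF _ span_superset]
      by blast+
    moreover have "T ` C \<subseteq> span B"
      unfolding T_def by (auto intro!: span_sum span_scale intro: span_base)
    ultimately have "card (T ` C) \<le> card B"
      using independent_span_bound[OF B(3)] by blast
    then show ?thesis using \<open>inj_on T C\<close> by (simp add: card_image)
  qed
  then show "neg_index V q \<le> enat (card B)"
    unfolding neg_index_def pos_index_def by (intro SUP_least) auto
qed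

text \<open>Finiteness of the index bounds the size of negative orthonormal sets; one of largest
  size leaves no room for a further negative vector in its complement.\<close>

lemma neg_basis_exists:
  assumes "subspace V" "neg_index V q \<noteq> \<infinity>" "\<And>v. v \<in> V \<Longrightarrow> q v = b v v"
  shows "\<exists>B. neg_basis V B"
proof -
  let ?P = "\<lambda>n. \<exists>B. neg_orthonormal B \<and> B \<subseteq> V \<and> card B = n"
  obtain N where "neg_index V q = enat N" using assms(2) by auto
  then have bound: "\<And>n. ?P n \<Longrightarrow> n \<le> N" using card_le_neg_index[OF assms(1) _ _ assms(3)]
    by (metis enat_ord_simps(1))
  have "?P 0" by (intro exI[of _ "{}"]) (auto simp: neg_orthonormal_def)
  with bound have g: "?P (Greatest ?P)" "\<And>n. ?P n \<Longrightarrow> n \<le> Greatest ?P"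
    using GreatestI_nat[of ?P 0 N] Greatest_le_nat[of ?P _ N] by blast+
  then obtain B where B: "neg_orthonormal B" "B \<subseteq> V" "card B = Greatest ?P" by blast
  have "0 \<le> b v v" if v: "v \<in> V" "\<forall>x\<in>B. b x v = 0" for v
  proof (rule ccontr)
    assume "\<not> 0 \<le> b v v"
    then obtain w where w: "neg_orthonormal (insert w B)" "w \<notin> B" "w \<in> V"
      using neg_orthonormal_insert[OF B(1) v(2)] subspace_scale[OF assms(1) v(1)] by (metis not_le)
    then have "card (insert w B) \<le> Greatest ?P" using B by (intro g(2)) blast
    then show False using w B by (simp add: neg_orthonormal_def)
  qed
  then show ?thesis using B unfolding neg_basis_def by blast
qed

text \<open>The sum need not be direct: a vector common to V and W is isotropic, and this already
  keeps B and C disjoint.\<close>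

lemma neg_basis_sum:
  assumes "neg_basis V B" "neg_basis W C" "\<And>v w. v \<in> V \<Longrightarrow> w \<in> W \<Longrightarrow> b v w = 0"
    "subspace V" "subspace W"
  shows "neg_basis (subspace_sum V W) (B \<union> C)" "B \<inter> C = {}"
proof -
  have 0: "b w v = 0" if "v \<in> V" "w \<in> W" for v w using assms(3)[OF that] sym by simp
  have BC: "B \<subseteq> V" "C \<subseteq> W" "neg_orthonormal B" "neg_orthonormal C"
    using assms by (auto simp: neg_basis_def)
  show "B \<inter> C = {}"
  proof (rule ccontr)
    assume "B \<inter> C \<noteq> {}"
    then obtain x where "x \<in> B" "x \<in> C" by blast
    with BC assms(3)[of x x] show False by (auto simp: neg_orthonormal_def)
  qed
  then have "neg_orthonormal (B \<union> C)"
    using BC assms(3) 0 unfolding neg_orthonormal_def by (auto simp: subset_iff)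
  moreover have "B \<union> C \<subseteq> subspace_sum V W"
    using BC subspace_0[OF assms(4)] subspace_0[OF assms(5)]
    by (force simp: subspace_sum_def)
  moreover have "0 \<le> b s s" if s: "s \<in> subspace_sum V W" "\<forall>x\<in>B \<union> C. b x s = 0" for s
  proof -
    obtain v w where vw: "v \<in> V" "w \<in> W" "s = v + w" using s(1) by (auto simp: subspace_sum_def)
    have "b x v = 0" if "x \<in> B" for x
    proof -
      have "b x w = 0" using that vw assms(3) BC by blast
      moreover have "b x (v + w) = 0" using s(2) that vw by blast
      ultimately show ?thesis by (simp add: radd)
    qed
    moreover have "b x w = 0" if "x \<in> C" for x
    proof -
      have "b x v = 0" using that vw 0 BC by blast
      moreover have "b x (v + w) = 0" using s(2) that vw by blast
      ultimately show ?thesis by (simp add: radd)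
    qed
    ultimately have "0 \<le> b v v" "0 \<le> b w w"
      using assms(1,2) vw by (auto simp: neg_basis_def)
    then show ?thesis using vw assms(3)[of v w] 0[of v w] by (simp add: ladd radd)
  qed
  ultimately show "neg_basis (subspace_sum V W) (B \<union> C)" by (auto simp: neg_basis_def)
qed

text \<open>The approximants need not be orthogonal to B, so they are projected:
  \<open>form_remove\<close> turns nonnegativity of the projected vectors into an inequality between
  form values and finitely many pairings, which passes to the limit.\<close>

lemma neg_basis_form_dense:
  assumes "neg_basis D B" "subspace D" "D \<subseteq> S"
    and approx: "\<And>s. s \<in> S \<Longrightarrow> \<exists>u. (\<forall>n::nat. u n \<in> D) \<and> (\<lambda>n. b (u n) (u n)) \<longlonglongrightarrow> b s s \<and>
           (\<forall>v\<in>D. (\<lambda>n. b v (u n)) \<longlonglongrightarrow> b v s)"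
  shows "neg_basis S B"
  unfolding neg_basis_def
proof (intro conjI ballI impI)
  show B: "neg_orthonormal B" "B \<subseteq> S" using assms by (auto simp: neg_basis_def)
  have BD: "B \<subseteq> D" using assms by (auto simp: neg_basis_def)
  fix s assume s: "s \<in> S" "\<forall>x\<in>B. b x s = 0"
  obtain u where u: "\<And>n::nat. u n \<in> D" "(\<lambda>n. b (u n) (u n)) \<longlonglongrightarrow> b s s"
    "\<And>v. v \<in> D \<Longrightarrow> (\<lambda>n. b v (u n)) \<longlonglongrightarrow> b v s"
    using approx[OF s(1)] by blast
  have "0 \<le> b (remove B (u n)) (remove B (u n))" for n
    using assms(1) remove_in_subspace[OF assms(2) BD u(1)] orthogonal_remove[OF B(1)]
    by (simp add: neg_basis_def)
  then have "0 \<le> b (u n) (u n) + (\<Sum>x\<in>B. (b x (u n))\<^sup>2)" for n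
    using form_remove[OF B(1)] by metis
  moreover have "(\<lambda>n. b (u n) (u n) + (\<Sum>x\<in>B. (b x (u n))\<^sup>2)) \<longlonglongrightarrow> b s s + (\<Sum>x\<in>B. (b x s)\<^sup>2)"
    using BD by (intro tendsto_intros u) auto
  ultimately have "0 \<le> b s s + (\<Sum>x\<in>B. (b x s)\<^sup>2)"
    by (intro LIMSEQ_le_const) auto
  then show "0 \<le> b s s" using s by simp
qed

section \<open>Isotropic vectors and hyperbolic planes\<close>

lemma subspace_orthogonal: "subspace S \<Longrightarrow> subspace {s \<in> S. \<forall>x\<in>B. b x s = 0}"
  using subspace_0[of S] subspace_add[of S] subspace_scale[of S]
  by (intro subspaceI) (simp_all add: radd rscale)

text \<open>Together with a vector \<open>y \<in> S\<close> such that \<open>b x y \<noteq> 0\<close>, the isotropic \<open>x\<close> spans a hyperbolic plane.\<close>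
lemma neg_basis_isotropic_vector:
  assumes "subspace S" "x \<in> S" "b x x = 0" "y \<in> S" "b x y \<noteq> 0" "neg_basis {s \<in> S. b x s = 0} C"
  shows "\<exists>z. z \<notin> C \<and> neg_basis S (insert z C)"
proof -
  have C: "neg_orthonormal C" "C \<subseteq> S" "\<And>c. c \<in> C \<Longrightarrow> b x c = 0" "\<And>c. c \<in> C \<Longrightarrow> b c x = 0"
  proof -
    show "neg_orthonormal C" "C \<subseteq> S" and xc: "\<And>c. c \<in> C \<Longrightarrow> b x c = 0"
      using assms(6) by (auto simp: neg_basis_def)
    show "b c x = 0" if "c \<in> C" for c using xc[OF that] sym[of c x] by simp
  qed
  let ?y = "remove C y"
  have yS: "?y \<in> S" using assms C by (simp add: remove_in_subspace)
  have xy: "b x ?y = b x y" by (simp add: remove_def radd rsum rscale C)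
  \<comment> \<open>Adding a multiple of the isotropic \<open>x\<close> changes the form of
    \<open>?y\<close> linearly; the coefficient is the one that gives
    \<open>b z z = -1\<close>.\<close>
  define z where "z = ?y + ((-1 - b ?y ?y) / (2 * b x y)) *\<^sub>R x"
  have zS: "z \<in> S" unfolding z_def using yS assms by (simp add: subspace_add subspace_scale)
  have zz: "b z z = -1"
    using assms(5) xy sym[of ?y x] by (simp add: z_def ladd radd lscale rscale assms(3) field_simps)
  have xz: "b x z = b x y" by (simp add: z_def radd rscale assms(3) xy)
  have cz: "b c z = 0" "b z c = 0" if "c \<in> C" for c
    using orthogonal_remove[OF C(1) that] C(4)[OF that] sym[of z c] by (simp_all add: z_def radd rscale)
  have "z \<notin> C" using xz C(3) assms(5) by auto
  moreover have "neg_orthonormal (insert z C)"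
    using C(1) zz cz unfolding neg_orthonormal_def by auto
  moreover have "0 \<le> b v v" if v: "v \<in> S" "\<forall>c\<in>insert z C. b c v = 0" for v
  proof -
    \<comment> \<open>Subtracting this multiple of \<open>z\<close> moves \<open>v\<close> into the
      complement of \<open>x\<close>, where the form is nonnegative; since \<open>b z v = 0\<close>
      and \<open>b z z = -1\<close>, the form of \<open>v\<close> itself is larger by
      \<open>\<alpha>\<^sup>2\<close>.\<close>
    define \<alpha> where "\<alpha> = b x v / b x y"
    let ?w = "v - \<alpha> *\<^sub>R z"
    have "?w \<in> S" using v zS assms(1) by (simp add: subspace_diff subspace_scale)
    moreover have "b x ?w = 0" using assms(5) by (simp add: rsub rscale xz \<alpha>_def)
    moreover have "b c ?w = 0" if "c \<in> C" for c using v cz[OF that] that by (simp add: rsub rscale)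
    ultimately have "0 \<le> b ?w ?w" using assms(6) by (simp add: neg_basis_def)
    also have "b ?w ?w = b v v - \<alpha>\<^sup>2"
      using v(2) sym[of v z] by (simp add: rsub rscale lsub lscale zz power2_eq_square)
    finally show ?thesis by (smt (verit) zero_le_power2)
  qed
  ultimately show ?thesis using C(2) zS unfolding neg_basis_def by blast
qed

text \<open>Each isotropic vector contributes one negative direction. Splitting off \<open>x\<close>
  replaces S by the complement of \<open>x\<close>, and the hypothesis that \<open>span X\<close>
  meets the radical only in 0 has to be recovered there for the remaining vectors.\<close>

lemma neg_basis_isotropic:
  assumes "finite X" "independent X" "X \<subseteq> S" "subspace S" "\<And>x y. x \<in> X \<Longrightarrow> y \<in> X \<Longrightarrow> b x y = 0"
    "\<And>u. u \<in> span X \<Longrightarrow> \<forall>s\<in>S. b u s = 0 \<Longrightarrow> u = 0"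
    "neg_basis {s \<in> S. \<forall>x\<in>X. b x s = 0} C"
  shows "\<exists>Z. neg_basis S Z \<and> card Z = card X + card C"
  using assms
proof (induction X arbitrary: S rule: finite_induct)
  case empty
  then show ?case by auto
next
  case (insert x X)
  let ?S = "{s \<in> S. b x s = 0}"
  have "x \<noteq> 0" using insert.prems(1) dependent_zero[of "insert x X"] by auto
  moreover have "x \<notin> span X" "independent X"
    using insert.prems(1) insert.hyps(2) by (simp_all add: independent_insert)
  ultimately have x: "x \<in> S" "x \<noteq> 0" "x \<notin> span X" "independent X" "b x x = 0"
    using insert.prems(2,4) by auto
  then obtain y where y: "y \<in> S" "b x y \<noteq> 0"
    using insert.prems(5)[of x] by (auto intro: span_base)
  have sub: "subspace ?S" using subspace_orthogonal[OF insert.prems(3), of "{x}"] by simp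
  have "\<exists>Z. neg_basis ?S Z \<and> card Z = card X + card C"
  proof (rule insert.IH[OF x(4) _ sub])
    show "X \<subseteq> ?S" using insert.prems by auto
    show "b u v = 0" if "u \<in> X" "v \<in> X" for u v using insert.prems(4) that by blast
    have "{s \<in> ?S. \<forall>x\<in>X. b x s = 0} = {s \<in> S. \<forall>x\<in>insert x X. b x s = 0}" by auto
    then show "neg_basis {s \<in> ?S. \<forall>x\<in>X. b x s = 0} C" using insert.prems(6) by simp
    fix u assume u: "u \<in> span X" "\<forall>s\<in>?S. b u s = 0"
    \<comment> \<open>Since \<open>u\<close> vanishes on the complement of \<open>x\<close>, it is
      proportional to \<open>x\<close> as a functional on S; the factor is read off at
      \<open>y\<close>.\<close>
    define k where "k = b u y / b x y"
    have "b (u - k *\<^sub>R x) s = 0" if "s \<in> S" for s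
    proof -
      let ?s = "s - (b x s / b x y) *\<^sub>R y"
      have "?s \<in> ?S" using that y insert.prems(3)
        by (simp add: subspace_diff subspace_scale rsub rscale)
      then have "b u ?s = 0" using u by blast
      then show ?thesis by (simp add: rsub rscale lsub lscale k_def field_simps)
    qed
    moreover have "u - k *\<^sub>R x \<in> span (insert x X)"
      using u(1) span_mono[of X "insert x X"] by (intro span_diff span_scale) (auto intro: span_base)
    ultimately have e: "u = k *\<^sub>R x" using insert.prems(5) by fastforce
    have "k = 0"
    proof (rule ccontr)
      assume "k \<noteq> 0"
      then have "x = (1 / k) *\<^sub>R u" using e by simp
      then show False using x(3) span_scale[OF u(1)] by metis
    qed
    then show "u = 0" using e by simp
  qed
  then obtain Z where Z: "neg_basis ?S Z" "card Z = card X + card C" by blast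
  obtain z where "z \<notin> Z" "neg_basis S (insert z Z)"
    using neg_basis_isotropic_vector[OF insert.prems(3) x(1,5) y Z(1)] by blast
  moreover have "finite Z" using Z by (simp add: neg_basis_def neg_orthonormal_def)
  ultimately show ?case using Z insert.hyps by (intro exI[of _ "insert z Z"]) simp
qed

end

text \<open>The kernel of \<open>T\<close> meets a positive definite subspace only in 0, so images
  keep their dimension, while a linear right inverse on W lifts positive definite subspaces back.
  This allows pairs \<open>(f, g)\<close> to be replaced by \<open>p (f + g)\<close> although the
  latter forgets part of the pair.\<close>

lemma pos_index_linear_surj:
  assumes lin: "linear T" and V: "subspace V" and TV: "T ` V = W"
    and q: "\<And>v. v \<in> V \<Longrightarrow> qw (T v) = qv v" and q0: "qw 0 = (0::real)"
  shows "pos_index V qv = pos_index W qw"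
proof (rule antisym)
  show "pos_index V qv \<le> pos_index W qw"
    unfolding pos_index_def
  proof (rule SUP_mono, clarify)
    fix B assume B: "finite B" "independent B" "span B \<subseteq> V" "\<forall>x\<in>span B. x \<noteq> 0 \<longrightarrow> 0 < qv x"
    have inj: "inj_on T (span B)"
    proof (subst linear_injective_on_subspace_0[OF lin subspace_span], intro ballI impI)
      fix v assume v: "v \<in> span B" "T v = 0"
      then have "qv v = 0" using q[of v] q0 B(3) by auto
      then show "v = 0" using B(4) v by fastforce
    qed
    have ind: "independent (T ` B)"
      using linear_independent_injective_image[OF lin B(2) inj] .
    have sp: "span (T ` B) = T ` span B" using linear_span_image[OF lin] .
    have "0 < qw x" if x: "x \<in> span (T ` B)" "x \<noteq> 0" for x
    proof -
      obtain v where v: "v \<in> span B" "x = T v" using x sp by auto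
      then have "v \<noteq> 0" using x linear_0[OF lin] by auto
      then show ?thesis using B(3,4) v q by (metis subsetD)
    qed
    moreover have "span (T ` B) \<subseteq> W" using sp B(3) TV by auto
    moreover have "card (T ` B) = card B"
      using inj_on_subset[OF inj span_superset] by (rule card_image)
    ultimately show "\<exists>C\<in>{B. finite B \<and> independent B \<and> span B \<subseteq> W \<and> (\<forall>x\<in>span B. x \<noteq> 0 \<longrightarrow> 0 < qw x)}.
         enat (card B) \<le> enat (card C)"
      using ind B(1) by (intro bexI[of _ "T ` B"]) auto
  qed
  show "pos_index W qw \<le> pos_index V qv"
    unfolding pos_index_def
  proof (rule SUP_mono, clarify)
    fix B assume B: "finite B" "independent B" "span B \<subseteq> W" "\<forall>x\<in>span B. x \<noteq> 0 \<longrightarrow> 0 < qw x"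
    obtain g where g: "range g \<subseteq> V" "linear g" "\<And>x. x \<in> span B \<Longrightarrow> T (g x) = x"
      using linear_exists_right_inverse_on[OF lin V] B(3) unfolding TV by blast
    have inj: "inj_on g (span B)" using g(3) by (metis inj_onI)
    have ind: "independent (g ` B)"
      using linear_independent_injective_image[OF g(2) B(2) inj] .
    have sp: "span (g ` B) = g ` span B" using linear_span_image[OF g(2)] .
    have "0 < qv x" if x: "x \<in> span (g ` B)" "x \<noteq> 0" for x
    proof -
      obtain v where v: "v \<in> span B" "x = g v" using x sp by auto
      then have "v \<noteq> 0" using x linear_0[OF g(2)] by auto
      then have "0 < qw v" using B v by blast
      also have "qw v = qv x" using v g q[of x] by (auto simp: image_subset_iff)
      finally show ?thesis .
    qed
    moreover have "span (g ` B) \<subseteq> V" using sp g by auto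
    moreover have "card (g ` B) = card B"
      using inj_on_subset[OF inj span_superset] by (rule card_image)
    ultimately show "\<exists>C\<in>{B. finite B \<and> independent B \<and> span B \<subseteq> V \<and> (\<forall>x\<in>span B. x \<noteq> 0 \<longrightarrow> 0 < qv x)}.
         enat (card B) \<le> enat (card C)"
      using ind B(1) by (intro bexI[of _ "g ` B"]) auto
  qed
qed

lemma pos_index_finite:
  assumes "finite X" "W \<subseteq> span X"
  shows "pos_index W q \<noteq> \<infinity>"
proof -
  have "pos_index W q \<le> enat (card X)"
    unfolding pos_index_def
    using independent_span_bound[OF assms(1)] assms(2)
    by (intro SUP_least) (auto, meson order_trans span_superset)
  then show ?thesis by (metis enat_ord_simps(5) infinity_ileE)
qed

section \<open>Comparison of two extensions of a symmetric form\<close>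

lemma pos_index_mono: "V \<subseteq> W \<Longrightarrow> pos_index V q \<le> pos_index W q"
  unfolding pos_index_def by (rule SUP_subset_mono) (simp_all add: subset_iff)

lemma span_Int_independent_Un:
  assumes "independent (A \<union> B)" "A \<inter> B = {}"
  shows "span A \<inter> span B = {0}"
proof -
  obtain f where f: "linear f" "\<forall>x\<in>A \<union> B. f x = (if x \<in> A then x else 0)"
    using linear_independent_extend[OF assms(1), of "\<lambda>x. if x \<in> A then x else 0"] by blast
  have "v = 0" if "v \<in> span A" "v \<in> span B" for v
  proof -
    have "f v = id v"
      by (rule linear_eq_on[OF f(1) linear_id that(1)]) (simp add: f(2))
    moreover have "f v = 0"
      by (rule linear_eq_0_on_span[OF f(1) _ that(2)]) (use f(2) assms(2) in auto)
    ultimately show ?thesis by simp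
  qed
  then show ?thesis by (auto simp: span_zero)
qed

lemma subspace_subspace_sum: "subspace A \<Longrightarrow> subspace B \<Longrightarrow> subspace (subspace_sum A B)"
  using subspace_sums[of A B] by (simp add: subspace_sum_def)

section \<open>Orthogonality in finite-dimensional nondegenerate spaces\<close>

locale nondegenerate_form =
  fixes \<omega> :: "'a::real_vector \<Rightarrow> 'a \<Rightarrow> real" and U :: "'a set"
  assumes bilin: "bilinear \<omega>" and subspace: "subspace U"
    and fin: "\<exists>B. finite B \<and> U \<subseteq> span B"
    and nondeg: "u \<in> U \<Longrightarrow> (\<And>v. v \<in> U \<Longrightarrow> \<omega> u v = 0) \<Longrightarrow> u = 0"
begin

lemma finite_independent:
  assumes "independent B" "B \<subseteq> U"
  shows "finite B"
proof -
  obtain C where "finite C" "U \<subseteq> span C" using fin by blast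
  then show ?thesis using independent_span_bound[of C B] assms by blast
qed

text \<open>\<open>J\<close> records a functional by its values on the basis; nondegeneracy makes it
  injective, and counting dimensions makes it surjective onto \<open>span B\<close>.\<close>

lemma represent_functional:
  assumes B: "independent B" "B \<subseteq> U" "U \<subseteq> span B"
  shows "\<exists>v\<in>U. \<forall>x\<in>B. \<omega> v x = c x"
proof -
  have finB: "finite B" using finite_independent B by blast
  have span: "span B = U" using B subspace by (simp add: span_minimal subset_antisym)
  define J where "J v = (\<Sum>x\<in>B. \<omega> v x *\<^sub>R x)" for v
  have lin: "linear J"
    unfolding J_def using bilin
    by (intro linearI)
       (simp_all add: bilinear_ladd bilinear_lmul scaleR_add_left sum.distrib scaleR_sum_right)
  have coeff: "\<forall>x\<in>B. \<omega> v x = c x" if "J v = (\<Sum>x\<in>B. c x *\<^sub>R x)" for v c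
  proof -
    have "(\<Sum>x\<in>B. (\<omega> v x - c x) *\<^sub>R x) = 0"
      using that by (simp add: J_def scaleR_diff_left sum_subtractf)
    then have "\<forall>x\<in>B. \<omega> v x - c x = 0"
      using independentD[OF B(1) finB order_refl, of "\<lambda>x. \<omega> v x - c x"] by blast
    then show ?thesis by simp
  qed
  have "inj_on J (span B)"
  proof (subst linear_injective_on_subspace_0[OF lin subspace_span], intro ballI impI)
    fix v assume v: "v \<in> span B" "J v = 0"
    have "\<forall>x\<in>B. \<omega> v x = 0" using coeff[of v "\<lambda>_. 0"] v by simp
    moreover have "linear (\<omega> v)" using bilin by (simp add: bilinear_def)
    ultimately have "\<omega> v w = 0" if "w \<in> U" for w
      using that span linear_eq_0_on_span[of "\<omega> v" B w] by simp
    then show "v = 0" using nondeg v span by blast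
  qed
  then have ind: "independent (J ` B)" and card: "card (J ` B) = card B"
    using linear_independent_injective_image[OF lin B(1)] card_image[OF inj_on_subset[OF _ span_superset]]
    by blast+
  have JB: "J v \<in> span B" for v
    unfolding J_def by (intro span_sum span_scale) (rule span_base)
  have "span B \<subseteq> span (J ` B)"
  proof
    fix y assume y: "y \<in> span B"
    show "y \<in> span (J ` B)"
    proof (rule ccontr)
      assume n: "y \<notin> span (J ` B)"
      then have "independent (insert y (J ` B))" using ind by (simp add: independent_insert)
      then have "card (insert y (J ` B)) \<le> card B"
        using independent_span_bound[OF finB, of "insert y (J ` B)"] y JB by blast
      moreover have "y \<notin> J ` B" using n span_base[of y "J ` B"] by argo
      ultimately show False using finB card by simp
    qed
  qed
  moreover have "(\<Sum>x\<in>B. c x *\<^sub>R x) \<in> span B"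
    by (intro span_sum span_scale) (rule span_base)
  ultimately have "(\<Sum>x\<in>B. c x *\<^sub>R x) \<in> J ` span B"
    using linear_span_image[OF lin, of B] by blast
  then obtain v where "v \<in> span B" "J v = (\<Sum>x\<in>B. c x *\<^sub>R x)" by auto
  then show ?thesis using coeff span by blast
qed

text \<open>A basis of X enlarged by \<open>u\<close> extends to a basis of U, and \<open>v\<close>
  represents the coordinate functional of \<open>u\<close>.\<close>

lemma separating_vector:
  assumes "subspace X" "X \<subseteq> U" "u \<in> U" "u \<notin> X"
  shows "\<exists>v\<in>U. (\<forall>x\<in>X. \<omega> v x = 0) \<and> \<omega> v u \<noteq> 0"
proof -
  obtain A where A: "A \<subseteq> X" "independent A" "X \<subseteq> span A" 
    using maximal_independent_subset[of X] by blast
  have sA: "span A = X" using A assms(1) by (simp add: span_minimal subset_antisym)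
  then have "independent (insert u A)" using A assms by (simp add: independent_insert)
  then obtain B where B: "insert u A \<subseteq> B" "B \<subseteq> U" "independent B" "U \<subseteq> span B"
    using maximal_independent_subset_extend[of "insert u A" U] A(1) assms(2,3) by blast
  obtain v where v: "v \<in> U" "\<forall>x\<in>B. \<omega> v x = (if x = u then 1 else 0)"
    using represent_functional[OF B(3,2,4), of "\<lambda>x. if x = u then 1 else 0"] by blast
  have "u \<notin> A" using assms(4) A by blast
  then have 0: "\<And>x. x \<in> A \<Longrightarrow> \<omega> v x = 0" using v(2) B(1) by auto
  have "linear (\<omega> v)" using bilin by (simp add: bilinear_def)
  then have "\<omega> v x = 0" if "x \<in> X" for x
    using linear_eq_0_on_span[of "\<omega> v" A x] 0 that sA by simp
  then show ?thesis using v B(1) by (intro bexI[of _ v]) auto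
qed

text \<open>A vector that separates \<open>u\<close> from the sum is orthogonal to both Lagrangians,
  so it lies in both; but then it is orthogonal to \<open>u\<close> by hypothesis.\<close>

lemma orthogonal_Int_lagrangian:
  assumes A: "lagrangian \<omega> U A" and B: "lagrangian \<omega> U B"
    and u: "u \<in> U" "\<And>x. x \<in> A \<inter> B \<Longrightarrow> \<omega> x u = 0"
  shows "u \<in> subspace_sum A B"
proof (rule ccontr)
  assume n: "u \<notin> subspace_sum A B"
  have sub: "subspace A" "subspace B" "A \<subseteq> U" "B \<subseteq> U"
    using A B by (auto simp: lagrangian_def)
  have "subspace (subspace_sum A B)" using sub by (simp add: subspace_subspace_sum)
  moreover have "subspace_sum A B \<subseteq> U"
    using sub subspace_add[OF subspace] by (auto simp: subspace_sum_def)
  ultimately obtain v where v: "v \<in> U" "\<forall>x\<in>subspace_sum A B. \<omega> v x = 0" "\<omega> v u \<noteq> 0"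
    using separating_vector[of "subspace_sum A B" u] n u(1) subspace_add
    by (force simp: subspace_sum_def)
  have "A \<subseteq> subspace_sum A B" "B \<subseteq> subspace_sum A B"
    using subspace_0[OF sub(1)] subspace_0[OF sub(2)] by (force simp: subspace_sum_def)+
  then have "v \<in> A" "v \<in> B" using A B v unfolding lagrangian_def by blast+
  then show False using u(2) v(3) by blast
qed

end

text \<open>Collects what the index count takes from analysis. W is the maximal domain, D the
  minimal one, and \<open>p\<close> the passage to boundary values; topology enters only through
  \<open>closed_range\<close> and \<open>approx\<close>. Linearity of \<open>h\<close> and
  \<open>p\<close> holds on the whole ambient space, while their other properties refer to
  W.\<close>

locale form_extension =
  fixes h :: "'a::real_vector \<Rightarrow> 'a \<Rightarrow> real" and \<omega> :: "'a \<Rightarrow> 'a \<Rightarrow> real"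
    and p :: "'a \<Rightarrow> 'a" and W D U K G \<Lambda> :: "'a set"
  assumes h: "bilinear h" and p: "linear p"
    and W: "subspace W" and D: "subspace D" "D \<subseteq> W" and U: "subspace U" "U \<subseteq> W"
    and fin: "\<exists>B. finite B \<and> U \<subseteq> span B"
    and p_U: "f \<in> W \<Longrightarrow> p f \<in> U" and p_D: "f \<in> W \<Longrightarrow> f - p f \<in> D"
    and p_id: "u \<in> U \<Longrightarrow> p u = u" and p_0: "f \<in> D \<Longrightarrow> p f = 0"
    and h_D: "f \<in> D \<Longrightarrow> g \<in> W \<Longrightarrow> h f g = h g f"
    and K: "subspace K" "K \<subseteq> W" and h_K: "k \<in> K \<Longrightarrow> g \<in> W \<Longrightarrow> h k g = 0"
    and K_I: "f \<in> W \<Longrightarrow> (\<And>g. g \<in> D \<Longrightarrow> h f g = 0) \<Longrightarrow> f \<in> K"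
    and closed_range: "u \<in> U \<Longrightarrow> (\<And>k. k \<in> K \<Longrightarrow> h u k = 0) \<Longrightarrow> \<exists>f\<in>D. u - f \<in> K"
    and nondeg: "u \<in> U \<Longrightarrow> (\<And>v. v \<in> U \<Longrightarrow> h v u = h u v) \<Longrightarrow> u = 0"
    and \<omega>: "f \<in> U \<Longrightarrow> g \<in> U \<Longrightarrow> \<omega> f g = h g f - h f g"
    and G: "lagrangian \<omega> U G" and \<Lambda>: "lagrangian \<omega> U \<Lambda>"
    and approx: "g \<in> subspace_sum D G \<Longrightarrow>
      \<exists>c. (\<forall>n::nat. g - c n \<in> D) \<and> (\<lambda>n. h (c n) (c n)) \<longlonglongrightarrow> 0 \<and> (\<forall>w\<in>W. (\<lambda>n. h w (c n)) \<longlonglongrightarrow> 0)"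
begin

lemmas h_simps = bilinear_ladd[OF h] bilinear_radd[OF h] bilinear_lsub[OF h] bilinear_rsub[OF h]
  bilinear_lmul[OF h] bilinear_rmul[OF h] bilinear_lneg[OF h] bilinear_rneg[OF h]

lemmas p_simps = linear_add[OF p] linear_diff[OF p] linear_scale[OF p] linear_0[OF p]

text \<open>The given \<open>\<omega>\<close> is tied to \<open>h\<close> only on U;
  \<open>om\<close> extends it to a bilinear form on the ambient space, to which
  \<open>nondegenerate_form\<close> applies.\<close>

definition om :: "'a \<Rightarrow> 'a \<Rightarrow> real" where
  "om f g = h g f - h f g"

lemma om_bilinear: "bilinear om"
  unfolding bilinear_def om_def
  by (auto intro!: linearI simp: h_simps algebra_simps)

lemma om_antisym: "om f g = - om g f"
  by (simp add: om_def)

lemma om_D: "f \<in> D \<Longrightarrow> g \<in> W \<Longrightarrow> om f g = 0" "f \<in> D \<Longrightarrow> g \<in> W \<Longrightarrow> om g f = 0"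
  using h_D[of f g] by (simp_all add: om_def)

text \<open>The pairing sees boundary values only, because D pairs to 0 with all of W.\<close>

lemma om_p:
  assumes "f \<in> W" "g \<in> W"
  shows "om (p f) g = om f g" "om f (p g) = om f g"
  using om_D[OF p_D[OF assms(1)] assms(2)] om_D[OF p_D[OF assms(2)] assms(1)]
  by (simp_all add: om_def h_simps)

sublocale nondegenerate_form om U
proof
  fix u assume "u \<in> U" "\<And>v. v \<in> U \<Longrightarrow> om u v = 0"
  then show "u = 0" using nondeg[of u] by (simp add: om_def)
qed (fact om_bilinear U(1) fin)+

lemma lagrangian_cong: "lagrangian \<omega> U X \<longleftrightarrow> lagrangian om U X"
proof -
  have "{u \<in> U. \<forall>v\<in>X. \<omega> u v = 0} = {u \<in> U. \<forall>v\<in>X. om u v = 0}" if "X \<subseteq> U"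
    using \<omega> that by (auto simp: om_def subset_iff)
  then show ?thesis unfolding lagrangian_def by auto
qed

lemma lagrangian_G: "lagrangian om U G" and lagrangian_\<Lambda>: "lagrangian om U \<Lambda>"
  using G \<Lambda> by (simp_all add: lagrangian_cong)

lemma lagrangianD:
  assumes "lagrangian om U X"
  shows "subspace X" "X \<subseteq> U" "X \<subseteq> W" "\<And>x y. x \<in> X \<Longrightarrow> y \<in> X \<Longrightarrow> om x y = 0"
    "\<And>u. u \<in> U \<Longrightarrow> (\<And>x. x \<in> X \<Longrightarrow> om u x = 0) \<Longrightarrow> u \<in> X"
  using assms U(2) unfolding lagrangian_def by blast+

lemma subspace_sum_DW:
  assumes "lagrangian om U X" "f \<in> subspace_sum D X"
  shows "f \<in> W" "p f \<in> X"
proof -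
  obtain d x where f: "d \<in> D" "x \<in> X" "f = d + x" using assms(2) by (auto simp: subspace_sum_def)
  then have x: "x \<in> U" "x \<in> W" using lagrangianD[OF assms(1)] by blast+
  then show "f \<in> W" using f D(2) subspace_add[OF W] by blast
  show "p f \<in> X" using f p_0[OF f(1)] p_id[OF x(1)] by (simp add: p_simps)
qed

lemma subspace_sum_DI:
  assumes "f \<in> W" "p f \<in> X" shows "f \<in> subspace_sum D X"
  using p_D[OF assms(1)] assms(2) unfolding subspace_sum_def
  by (intro CollectI exI[of _ "f - p f"] exI[of _ "p f"]) simp

lemma subspace_sum_D_iff:
  assumes "lagrangian om U X"
  shows "f \<in> subspace_sum D X \<longleftrightarrow> f \<in> W \<and> p f \<in> X"
  using subspace_sum_DW[OF assms] subspace_sum_DI by blast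

lemma h_sym:
  assumes "lagrangian om U X" "f \<in> subspace_sum D X" "g \<in> subspace_sum D X"
  shows "h f g = h g f"
proof -
  note f = subspace_sum_DW[OF assms(1,2)] and g = subspace_sum_DW[OF assms(1,3)]
  have "p g \<in> W" using g(2) lagrangianD(3)[OF assms(1)] by blast
  have "om f g = om (p f) (p g)" using om_p f(1) g(1) \<open>p g \<in> W\<close> by simp
  also have "\<dots> = 0" using lagrangianD(4)[OF assms(1) f(2) g(2)] .
  finally show ?thesis by (simp add: om_def)
qed

abbreviation D\<^sub>\<Lambda> where "D\<^sub>\<Lambda> \<equiv> subspace_sum D \<Lambda>"
abbreviation D\<^sub>G where "D\<^sub>G \<equiv> subspace_sum D G"

lemma subspace_D\<^sub>\<Lambda>: "subspace D\<^sub>\<Lambda>" and subspace_D\<^sub>G: "subspace D\<^sub>G"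
  using D(1) lagrangianD(1)[OF lagrangian_G] lagrangianD(1)[OF lagrangian_\<Lambda>]
  by (simp_all add: subspace_subspace_sum)

text \<open>Isotropy holds because \<open>h k\<close> vanishes on W for \<open>k\<close> in K.
  Conversely, a vector \<open>u\<close> of U orthogonal to the image of K satisfies
  \<open>h u k = 0\<close> on K, so \<open>closed_range\<close> produces an element of K with
  boundary value \<open>u\<close>.\<close>

lemma lagrangian_K: "lagrangian om U (p ` K)"
  unfolding lagrangian_def
proof (intro conjI equalityI subsetI CollectI ballI)
  show "subspace (p ` K)" using linear_subspace_image[OF p K(1)] .
  show pK: "u \<in> U" if "u \<in> p ` K" for u using that K(2) p_U by blast
  then show "u \<in> U" if "u \<in> p ` K" for u using that by blast
  show "om u v = 0" if uv: "u \<in> p ` K" "v \<in> p ` K" for u v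
  proof -
    obtain k l where kl: "k \<in> K" "l \<in> K" "u = p k" "v = p l" using uv by blast
    have W': "k \<in> W" "l \<in> W" "p l \<in> W" using kl K(2) p_U U(2) by blast+
    have "om u v = om k l" using kl W' om_p by simp
    also have "\<dots> = 0" using kl W' h_K by (simp add: om_def)
    finally show ?thesis .
  qed
  fix u assume u: "u \<in> {u \<in> U. \<forall>v\<in>p ` K. om u v = 0}"
  then have uU: "u \<in> U" "u \<in> W" using U(2) by blast+
  have "h u k = 0" if k: "k \<in> K" for k
  proof -
    have kW: "k \<in> W" using k K(2) by blast
    have "om u (p k) = 0" using u k by blast
    then have "om u k = 0" using om_p(2)[OF uU(2) kW] by simp
    then show ?thesis using h_K[OF k uU(2)] by (simp add: om_def)
  qed
  from closed_range[OF uU(1) this] obtain f where f: "f \<in> D" "u - f \<in> K" by blast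
  have "p (u - f) = u" using p_id[OF uU(1)] p_0[OF f(1)] by (simp add: p_simps)
  then show "u \<in> p ` K" using f(2) by (metis imageI)
qed

text \<open>
  On \<open>D\<^sub>\<Lambda> \<times> D\<^sub>G\<close> this is the form of \<open>f + g\<close>, except that the mixed term is \<open>2 h(f, g)\<close> instead of
  \<open>h(f, g) + h(g, f)\<close>.  It compares the two extensions: the pairs \<open>(d, - d)\<close> with \<open>d \<in> D\<close> lie in
  the radical, the orthogonal complement of \<open>0 \<times> D\<^sub>G\<close> consists of the pairs with \<open>f + g \<in> K\<close>, and
  there the form is minus the one which defines the triple index.
\<close>
definition b :: "'a \<times> 'a \<Rightarrow> 'a \<times> 'a \<Rightarrow> real" where
  "b s t = (h (fst s) (fst t) + h (fst t) (fst s)) / 2 + h (fst s) (snd t) + h (fst t) (snd s)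
     + (h (snd s) (snd t) + h (snd t) (snd s)) / 2"

sublocale B: sym_bilinear b
proof
  show "bilinear b"
    unfolding bilinear_def b_def
    by (auto intro!: linearI simp: h_simps algebra_simps add_divide_distrib)
qed (simp add: b_def add.commute)

lemma b_mixed:
  assumes "f \<in> D\<^sub>\<Lambda>" "g \<in> D\<^sub>G" "g' \<in> D\<^sub>G"
  shows "b (f, g) (0, g') = h (f + g) g'" "b (0, g') (f, g) = h (f + g) g'"
  using h_sym[OF lagrangian_G assms(2,3)] by (simp_all add: b_def h_simps bilinear_lzero[OF h] bilinear_rzero[OF h])

lemma D_sub: "D \<subseteq> D\<^sub>\<Lambda>" "D \<subseteq> D\<^sub>G"
  using D(2) p_0 subspace_0[OF lagrangianD(1)[OF lagrangian_G]] subspace_0[OF lagrangianD(1)[OF lagrangian_\<Lambda>]]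
  by (auto simp: subspace_sum_D_iff lagrangian_G lagrangian_\<Lambda>)

definition V\<^sub>G where "V\<^sub>G = {0 :: 'a} \<times> D\<^sub>G"
definition V\<^sub>K where "V\<^sub>K = {s \<in> D\<^sub>\<Lambda> \<times> D\<^sub>G. fst s + snd s \<in> K}"

lemma subspace_V: "subspace (D\<^sub>\<Lambda> \<times> D\<^sub>G)" "subspace V\<^sub>G" "subspace V\<^sub>K"
proof -
  show 1: "subspace (D\<^sub>\<Lambda> \<times> D\<^sub>G)" using subspace_Times[OF subspace_D\<^sub>\<Lambda> subspace_D\<^sub>G] .
  show "subspace V\<^sub>G" unfolding V\<^sub>G_def
    by (rule subspace_Times[OF _ subspace_D\<^sub>G]) (rule subspace_single_0)
  have "subspace ((\<lambda>s. fst s + snd s) -` K)"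
    by (rule linear_subspace_vimage[OF _ K(1)]) (auto intro!: linearI simp: algebra_simps)
  then have "subspace (D\<^sub>\<Lambda> \<times> D\<^sub>G \<inter> (\<lambda>s. fst s + snd s) -` K)" using 1 by (rule subspace_inter[rotated])
  also have "D\<^sub>\<Lambda> \<times> D\<^sub>G \<inter> (\<lambda>s. fst s + snd s) -` K = V\<^sub>K" unfolding V\<^sub>K_def by blast
  finally show "subspace V\<^sub>K" .
qed

lemma b_V: assumes "s \<in> V\<^sub>G" "t \<in> V\<^sub>K" shows "b s t = 0"
proof -
  obtain g' where s: "s = (0, g')" "g' \<in> D\<^sub>G" using assms(1) by (auto simp: V\<^sub>G_def)
  obtain f g where t: "t = (f, g)" "f \<in> D\<^sub>\<Lambda>" "g \<in> D\<^sub>G" "f + g \<in> K"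
    using assms(2) by (auto simp: V\<^sub>K_def)
  have "g' \<in> W" using s subspace_sum_DW(1)[OF lagrangian_G] by blast
  then show ?thesis using b_mixed(2)[OF t(2,3) s(2)] h_K[OF t(4)] s t by simp
qed

text \<open>\<open>(p ` K) \<inter> G\<close> lifts to the pairs \<open>(0, k)\<close> with \<open>k \<in> K \<inter> D\<^sub>G\<close>, which are isotropic.\<close>
lemma orthogonal_to_isotropic:
  "{s \<in> D\<^sub>\<Lambda> \<times> D\<^sub>G. \<forall>k\<in>K \<inter> D\<^sub>G. b (0, k) s = 0} = subspace_sum V\<^sub>G V\<^sub>K" (is "?N = _")
proof (intro equalityI subsetI)
  fix s assume s: "s \<in> ?N"
  then obtain f g where fg: "s = (f, g)" "f \<in> D\<^sub>\<Lambda>" "g \<in> D\<^sub>G" by auto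
  have fW: "f \<in> W" and gW: "g \<in> W"
    using fg subspace_sum_DW(1) lagrangian_G lagrangian_\<Lambda> by blast+
  \<comment> \<open>Pairing with \<open>(0, k)\<close> sees only \<open>p f\<close>, so the
    condition puts \<open>p f\<close> into the complement of an intersection of two Lagrangians,
    which is their sum.\<close>
  have "om x (p f) = 0" if x: "x \<in> p ` K \<inter> G" for x
  proof -
    obtain k where k: "k \<in> K" "x = p k" using x by blast
    have kW: "k \<in> W" using k K by blast
    have kG: "k \<in> D\<^sub>G" using x k kW by (simp add: subspace_sum_D_iff[OF lagrangian_G])
    have "h f k + h g k = 0"
      using s k kG b_mixed(2)[OF fg(2,3) kG] fg by (auto simp: h_simps)
    moreover have "h g k = 0" using h_sym[OF lagrangian_G fg(3) kG] h_K[OF k(1) gW] by simp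
    ultimately have "om k f = 0" using h_K[OF k(1) fW] by (simp add: om_def)
    then show ?thesis using k om_p(1)[OF kW] om_p(2)[OF kW fW] U(2) p_U[OF fW] by auto
  qed
  from orthogonal_Int_lagrangian[OF lagrangian_K lagrangian_G p_U[OF fW] this]
  obtain k g' where k: "k \<in> K" "g' \<in> G" "p f = p k + g'" by (auto simp: subspace_sum_def)
  \<comment> \<open>\<open>g''\<close> completes \<open>f\<close> to a pair with sum in K; the given
    second component differs from it by an element of \<open>D\<^sub>G\<close>.\<close>
  define g'' where "g'' = k - f"
  have kW: "k \<in> W" using k K by blast
  have "p g'' = - g'" unfolding g''_def using k(3) by (simp add: p_simps)
  moreover have "g'' \<in> W" unfolding g''_def using kW fW subspace_diff[OF W] by blast
  ultimately have g'': "g'' \<in> D\<^sub>G"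
    using subspace_neg[OF lagrangianD(1)[OF lagrangian_G] k(2)]
    by (simp add: subspace_sum_D_iff[OF lagrangian_G])
  have "(f, g'') \<in> V\<^sub>K" using fg g'' k(1) by (simp add: V\<^sub>K_def g''_def)
  moreover have "(0, g - g'') \<in> V\<^sub>G"
    using subspace_diff[OF subspace_D\<^sub>G fg(3) g''] by (simp add: V\<^sub>G_def)
  ultimately show "s \<in> subspace_sum V\<^sub>G V\<^sub>K"
    unfolding subspace_sum_def fg(1)
    by (intro CollectI exI[of _ "(0, g - g'')"] exI[of _ "(f, g'')"]) simp
next
  fix s assume "s \<in> subspace_sum V\<^sub>G V\<^sub>K"
  then obtain s1 s2 where s12: "s1 \<in> V\<^sub>G" "s2 \<in> V\<^sub>K" "s = s1 + s2"
    by (auto simp: subspace_sum_def)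
  have "s1 \<in> D\<^sub>\<Lambda> \<times> D\<^sub>G" "s2 \<in> D\<^sub>\<Lambda> \<times> D\<^sub>G"
    using s12 subspace_0[OF subspace_D\<^sub>\<Lambda>] by (auto simp: V\<^sub>G_def V\<^sub>K_def)
  then have "s \<in> D\<^sub>\<Lambda> \<times> D\<^sub>G" using s12(3) subspace_add[OF subspace_V(1)] by blast
  moreover have "b (0, k) s = 0" if k: "k \<in> K" "k \<in> D\<^sub>G" for k
  proof -
    obtain g' where s1: "s1 = (0, g')" "g' \<in> D\<^sub>G" using s12(1) by (auto simp: V\<^sub>G_def)
    have g'W: "g' \<in> W" using s1 subspace_sum_DW(1)[OF lagrangian_G] by blast
    have "b (0, k) s1 = h g' k"
      using b_mixed(2)[OF subspace_0[OF subspace_D\<^sub>\<Lambda>] s1(2) k(2)] s1 by simp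
    also have "\<dots> = 0" using h_sym[OF lagrangian_G s1(2) k(2)] h_K[OF k(1) g'W] by simp
    finally have "b (0, k) s1 = 0" .
    moreover have "b (0, k) s2 = 0" using k s12(2) by (intro b_V) (simp_all add: V\<^sub>G_def)
    ultimately show ?thesis using s12(3) by (simp add: B.radd)
  qed
  ultimately show "s \<in> ?N" by blast
qed

text \<open>The natural choice in the triple form is \<open>v = - p f\<close>. Any other admissible
  \<open>v\<close> differs from it by an element of \<open>\<Lambda> \<inter> G\<close>, which pairs
  to 0 with \<open>p f\<close> and with \<open>p g\<close>, so the value is the same.\<close>

lemma triple_form_eq:
  assumes "s \<in> V\<^sub>K"
  shows "triple_form \<omega> \<Lambda> G (p (fst s + snd s)) = - b s s"
    "p (fst s + snd s) \<in> p ` K \<inter> subspace_sum \<Lambda> G"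
proof -
  obtain f g where s: "s = (f, g)" "f \<in> D\<^sub>\<Lambda>" "g \<in> D\<^sub>G" "f + g \<in> K"
    using assms by (auto simp: V\<^sub>K_def)
  note f = subspace_sum_DW[OF lagrangian_\<Lambda> s(2)] and g = subspace_sum_DW[OF lagrangian_G s(3)]
  note L = lagrangianD[OF lagrangian_\<Lambda>] and G = lagrangianD[OF lagrangian_G]
  let ?u = "p (f + g)"
  define v where "v = (SOME v. v \<in> \<Lambda> \<and> ?u + v \<in> G)"
  have u: "?u = p f + p g" by (simp add: p_simps)
  have "- p f \<in> \<Lambda> \<and> ?u + - p f \<in> G" using f g subspace_neg[OF L(1)] by (simp add: u)
  then have "v \<in> \<Lambda> \<and> ?u + v \<in> G" unfolding v_def by (rule someI)
  then have v: "v \<in> \<Lambda>" "?u + v \<in> G" by blast+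
  have vW: "v \<in> W" "v \<in> U" using v L by blast+
  have fgW: "f + g \<in> W" "p f \<in> U" "p g \<in> U" "?u \<in> U"
    using f g subspace_add[OF W] p_U by blast+
  have vf: "v + p f \<in> \<Lambda>" using v f subspace_add[OF L(1)] by blast
  have "v + p f = (?u + v) - p g" by (simp add: u)
  then have "v + p f \<in> G" using v(2) g(2) subspace_diff[OF G(1)] by metis
  then have "om (p f) (v + p f) = 0" "om (p g) (v + p f) = 0"
    using L(4)[OF f(2) vf] G(4)[OF g(2)] by blast+
  then have "om ?u v = - om ?u (p f)"
    using bilinear_ladd[OF om_bilinear] bilinear_radd[OF om_bilinear] unfolding u by (smt (verit))
  also have "om ?u (p f) = om (f + g) f"
    using om_p(1)[OF fgW(1), of "p f"] om_p(2)[OF fgW(1) f(1)] fgW(2) U(2) by auto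
  also have "\<dots> = h f (f + g)" using h_K[OF s(4) f(1)] by (simp add: om_def)
  \<comment> \<open>The added term is 0 because \<open>f + g\<close> is in K; it supplies the second
    \<open>h f g\<close> and the \<open>h g g\<close> of \<open>b s s\<close>.\<close>
  also have "\<dots> = h f (f + g) + h (f + g) g" using h_K[OF s(4) g(1)] by simp
  also have "\<dots> = b s s" using s(1) by (simp add: b_def h_simps)
  finally show "triple_form \<omega> \<Lambda> G (p (fst s + snd s)) = - b s s"
    using \<omega>[OF fgW(4) vW(2)] s(1) by (simp add: triple_form_def v_def om_def)
  show "p (fst s + snd s) \<in> p ` K \<inter> subspace_sum \<Lambda> G"
  proof
    show "p (fst s + snd s) \<in> p ` K" using s by simp
    show "p (fst s + snd s) \<in> subspace_sum \<Lambda> G"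
      using f(2) g(2) u s(1) unfolding subspace_sum_def by auto
  qed
qed

lemma V\<^sub>K_image: "(\<lambda>s. p (fst s + snd s)) ` V\<^sub>K = p ` K \<inter> subspace_sum \<Lambda> G"
proof (intro equalityI subsetI)
  fix u assume "u \<in> p ` K \<inter> subspace_sum \<Lambda> G"
  then obtain k x y where k: "k \<in> K" "u = p k" "x \<in> \<Lambda>" "y \<in> G" "p k = x + y"
    unfolding subspace_sum_def by blast
  have W': "k \<in> W" "x \<in> W" "y \<in> W" "x \<in> U" "y \<in> U"
    using k K(2) lagrangianD[OF lagrangian_G] lagrangianD[OF lagrangian_\<Lambda>] by blast+
  have "x \<in> D\<^sub>\<Lambda>"
    using W' k(3) p_id by (simp add: subspace_sum_D_iff[OF lagrangian_\<Lambda>])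
  moreover have "k - x \<in> D\<^sub>G"
    using W' k(4,5) p_id[of x] subspace_diff[OF W]
    by (simp add: subspace_sum_D_iff[OF lagrangian_G] p_simps)
  ultimately have "(x, k - x) \<in> V\<^sub>K" using k(1) by (simp add: V\<^sub>K_def)
  then show "u \<in> (\<lambda>s. p (fst s + snd s)) ` V\<^sub>K"
    using k(2) by (intro image_eqI[of _ _ "(x, k - x)"]) simp_all
qed (use triple_form_eq(2) in blast)

text \<open>The part \<open>d = g - c n\<close> of \<open>g\<close> is moved to the first component,
  along the radical direction \<open>(d, - d)\<close>; what is dropped is \<open>(0, c n)\<close>,
  which is small in the sense of the form.\<close>

lemma b_dense:
  assumes "s \<in> D\<^sub>\<Lambda> \<times> D\<^sub>G"
  shows "\<exists>u. (\<forall>n::nat. u n \<in> D\<^sub>\<Lambda> \<times> {0}) \<and> (\<lambda>n. b (u n) (u n)) \<longlonglongrightarrow> b s s \<and>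
           (\<forall>v\<in>D\<^sub>\<Lambda> \<times> {0}. (\<lambda>n. b v (u n)) \<longlonglongrightarrow> b v s)"
proof -
  obtain f g where s: "s = (f, g)" "f \<in> D\<^sub>\<Lambda>" "g \<in> D\<^sub>G" using assms by auto
  have fg: "f \<in> W" "g \<in> W"
    using s subspace_sum_DW(1) lagrangian_G lagrangian_\<Lambda> by blast+
  obtain c where c: "\<And>n::nat. g - c n \<in> D" "(\<lambda>n. h (c n) (c n)) \<longlonglongrightarrow> 0"
    "\<And>w. w \<in> W \<Longrightarrow> (\<lambda>n. h w (c n)) \<longlonglongrightarrow> 0"
    using approx[OF s(3)] by blast
  have cW: "c n \<in> W" and cG: "c n \<in> D\<^sub>G" for n
  proof -
    have "g - c n \<in> D\<^sub>G" using c(1) D_sub(2) by blast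
    from subspace_diff[OF subspace_D\<^sub>G s(3) this] show "c n \<in> D\<^sub>G" by simp
    then show "c n \<in> W" by (rule subspace_sum_DW(1)[OF lagrangian_G])
  qed
  define u where "u n = (f + (g - c n), 0 :: 'a)" for n
  have 1: "u n \<in> D\<^sub>\<Lambda> \<times> {0}" for n
    using subspace_add[OF subspace_D\<^sub>\<Lambda> s(2)] c(1) D_sub(1) by (auto simp: u_def)
  have uu: "b (u n) (u n) = b s s - 2 * h f (c n) - 2 * h g (c n) + h (c n) (c n)" for n
  proof -
    have "h (g - c n) f = h f (g - c n)" using h_D[OF c(1) fg(1)] .
    moreover have "h g (c n) = h (c n) g" using h_sym[OF lagrangian_G s(3) cG] .
    ultimately show ?thesis
      by (simp add: u_def s(1) b_def h_simps bilinear_lzero[OF h] bilinear_rzero[OF h])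
  qed
  have "(\<lambda>n. b s s - 2 * h f (c n) - 2 * h g (c n) + h (c n) (c n)) \<longlonglongrightarrow> b s s - 2 * 0 - 2 * 0 + 0"
    by (intro tendsto_intros c fg)
  then have 2: "(\<lambda>n. b (u n) (u n)) \<longlonglongrightarrow> b s s" by (simp add: uu)
  have 3: "(\<lambda>n. b v (u n)) \<longlonglongrightarrow> b v s" if v: "v \<in> D\<^sub>\<Lambda> \<times> {0}" for v
  proof -
    obtain w where w: "v = (w, 0)" "w \<in> D\<^sub>\<Lambda>" using v by auto
    have wW: "w \<in> W" using w(2) by (rule subspace_sum_DW(1)[OF lagrangian_\<Lambda>])
    have "b v (u n) = b v s - h w (c n)" for n
    proof -
      have "h (g - c n) w = h w (g - c n)" using h_D[OF c(1) wW] .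
      then show ?thesis
        by (simp add: u_def s(1) w(1) b_def h_simps bilinear_lzero[OF h] bilinear_rzero[OF h] field_simps)
    qed
    moreover have "(\<lambda>n. b v s - h w (c n)) \<longlonglongrightarrow> b v s - 0" by (intro tendsto_intros c wW)
    ultimately show ?thesis by simp
  qed
  show ?thesis using 1 2 3 by blast
qed

text \<open>A pair \<open>(0, k)\<close> with \<open>k\<close> in K and \<open>p k\<close> in
  \<open>\<Lambda> \<inter> G\<close> lies in the radical, so only a complement of these boundary
  values is lifted. The lift is isotropic, meets the radical in 0 and imposes the same orthogonality
  conditions as all of \<open>K \<inter> D\<^sub>G\<close>.\<close>

lemma isotropic_lift:
  "\<exists>X. finite X \<and> independent X \<and> X \<subseteq> D\<^sub>\<Lambda> \<times> D\<^sub>G \<and> (\<forall>x\<in>X. \<forall>y\<in>X. b x y = 0) \<and>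
     (\<forall>u\<in>span X. (\<forall>s\<in>D\<^sub>\<Lambda> \<times> D\<^sub>G. b u s = 0) \<longrightarrow> u = 0) \<and>
     {s \<in> D\<^sub>\<Lambda> \<times> D\<^sub>G. \<forall>x\<in>X. b x s = 0} = subspace_sum V\<^sub>G V\<^sub>K \<and>
     int (card X) = int (dim (p ` K \<inter> G)) - int (dim (p ` K \<inter> \<Lambda> \<inter> G))"
proof -
  note L = lagrangianD[OF lagrangian_\<Lambda>] and G = lagrangianD[OF lagrangian_G]
  note A = lagrangianD[OF lagrangian_K]
  let ?I = "p ` K \<inter> \<Lambda> \<inter> G"
  obtain B0 where B0: "B0 \<subseteq> ?I" "independent B0" "?I \<subseteq> span B0" "card B0 = dim ?I"
    using basis_exists[of ?I] by blast
  have "B0 \<subseteq> p ` K \<inter> G" using B0(1) by blast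
  then obtain B1 where B1: "B0 \<subseteq> B1" "B1 \<subseteq> p ` K \<inter> G" "independent B1" "p ` K \<inter> G \<subseteq> span B1"
    using maximal_independent_subset_extend[OF _ B0(2)] by blast
  have fin1: "finite B1" using finite_independent[OF B1(3)] B1(2) A(2) by blast
  define Y where "Y = B1 - B0"
  have Y: "finite Y" "independent Y" "Y \<subseteq> p ` K \<inter> G"
    using fin1 B1 independent_mono[OF B1(3)] by (auto simp: Y_def)
  have cardY: "int (card Y) = int (dim (p ` K \<inter> G)) - int (dim ?I)"
  proof -
    have "card B1 = dim (p ` K \<inter> G)" using basis_card_eq_dim[OF B1(2,4,3)] .
    moreover have "card B1 = card B0 + card Y"
      using fin1 B1(1) card_mono[OF fin1 B1(1)] by (simp add: Y_def card_Diff_subset finite_subset)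
    ultimately show ?thesis using B0(4) by simp
  qed
  have I0: "u = 0" if "u \<in> span Y" "u \<in> \<Lambda>" for u
  proof -
    have "subspace (p ` K \<inter> G)" using A(1) G(1) by (rule subspace_inter)
    then have "u \<in> p ` K \<inter> G" using span_minimal[OF Y(3)] that(1) by blast
    then have "u \<in> span B0" using that(2) B0(3) by blast
    moreover have "span B0 \<inter> span Y = {0}"
    proof (rule span_Int_independent_Un)
      have "B0 \<union> Y = B1" using B1(1) by (auto simp: Y_def)
      then show "independent (B0 \<union> Y)" using B1(3) by simp
    qed (auto simp: Y_def)
    ultimately show ?thesis using that(1) by blast
  qed
  have sub: "subspace (K \<inter> D\<^sub>G)" using K(1) subspace_D\<^sub>G by (rule subspace_inter)
  \<comment> \<open>Preimages under \<open>p\<close> are chosen linearly, so that independence of Y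
    and its span carry over to the lifts.\<close>
  obtain r where r: "range r \<subseteq> K \<inter> D\<^sub>G" "linear r" "\<forall>u\<in>p ` (K \<inter> D\<^sub>G). p (r u) = u"
    using linear_exists_right_inverse_on[OF p sub] by blast
  have rY: "p (r u) = u" if "u \<in> span Y" for u
  proof -
    have "p ` K \<inter> G \<subseteq> p ` (K \<inter> D\<^sub>G)"
      using K(2) by (auto simp: subspace_sum_D_iff[OF lagrangian_G])
    moreover have "subspace (p ` (K \<inter> D\<^sub>G))" using linear_subspace_image[OF p sub] .
    ultimately have "span Y \<subseteq> p ` (K \<inter> D\<^sub>G)" using Y(3) by (meson order_trans span_minimal)
    then show ?thesis using r(3) that by blast
  qed
  define T where "T u = (0 :: 'a, r u)" for u
  have linT: "linear T"
    unfolding T_def by (intro linearI) (simp_all add: linear_add[OF r(2)] linear_scale[OF r(2)])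
  have inj: "inj_on T (span Y)"
    by (rule inj_onI) (metis T_def prod.inject rY)
  have rK: "r u \<in> K" "r u \<in> D\<^sub>G" "r u \<in> W" for u
    using r(1) K(2) by blast+
  have isotropic: "b (0, k) (0, l) = 0" if "k \<in> K" "l \<in> K" for k l
    using h_K that K(2) by (simp add: b_def subset_iff bilinear_lzero[OF h] bilinear_rzero[OF h])
  show ?thesis
  proof (intro exI[of _ "T ` Y"] conjI ballI impI)
    show "finite (T ` Y)" using Y(1) by simp
    show "independent (T ` Y)" using linear_independent_injective_image[OF linT Y(2) inj] .
    show "T ` Y \<subseteq> D\<^sub>\<Lambda> \<times> D\<^sub>G" using rK(2) subspace_0[OF subspace_D\<^sub>\<Lambda>] by (auto simp: T_def)
    show "b x y = 0" if "x \<in> T ` Y" "y \<in> T ` Y" for x y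
      using that isotropic rK(1) by (auto simp: T_def)
    have "card (T ` Y) = card Y" using inj_on_subset[OF inj span_superset] by (rule card_image)
    then show "int (card (T ` Y)) = int (dim (p ` K \<inter> G)) - int (dim ?I)" using cardY by simp
  next
    fix t assume t: "t \<in> span (T ` Y)" "\<forall>s\<in>D\<^sub>\<Lambda> \<times> D\<^sub>G. b t s = 0"
    then obtain u where u: "u \<in> span Y" "t = (0, r u)"
      using linear_span_image[OF linT, of Y] by (auto simp: T_def)
    have uU: "u \<in> U" using p_U[OF rK(3)[of u]] rY[OF u(1)] by simp
    \<comment> \<open>Testing with \<open>(x, 0)\<close> shows that the boundary value of a radical
      vector is orthogonal to \<open>\<Lambda>\<close>, hence in \<open>\<Lambda>\<close>, hence 0
      by the choice of Y.\<close>
    have "om u x = 0" if x: "x \<in> \<Lambda>" for x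
    proof -
      have xW: "x \<in> W" "x \<in> U" using x L by blast+
      have xD: "x \<in> D\<^sub>\<Lambda>" using x xW p_id by (simp add: subspace_sum_D_iff[OF lagrangian_\<Lambda>])
      have "b t (x, 0) = 0" using t(2) xD subspace_0[OF subspace_D\<^sub>G] by blast
      then have "h x (r u) = 0"
        using u(2) by (simp add: b_def bilinear_lzero[OF h] bilinear_rzero[OF h])
      then have "om (r u) x = 0" using h_K[OF rK(1) xW(1)] by (simp add: om_def)
      then show ?thesis using om_p(1)[OF rK(3) xW(1), of u] rY[OF u(1)] by simp
    qed
    then have "u \<in> \<Lambda>" using L(5)[OF uU] by blast
    then show "t = 0" using I0[OF u(1)] u(2) linear_0[OF r(2)] by (simp add: zero_prod_def)
  next
    have "(\<forall>x\<in>T ` Y. b x s = 0) \<longleftrightarrow> (\<forall>k\<in>K \<inter> D\<^sub>G. b (0, k) s = 0)"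
      if s: "s \<in> D\<^sub>\<Lambda> \<times> D\<^sub>G" for s
    proof
      assume "\<forall>k\<in>K \<inter> D\<^sub>G. b (0, k) s = 0"
      then show "\<forall>x\<in>T ` Y. b x s = 0" using rK by (simp add: T_def)
    next
      assume Y0: "\<forall>x\<in>T ` Y. b x s = 0"
      obtain f g where fg: "s = (f, g)" "f \<in> D\<^sub>\<Lambda>" "g \<in> D\<^sub>G" using s by auto
      have fW: "f \<in> W" "g \<in> W" using fg subspace_sum_DW(1) lagrangian_G lagrangian_\<Lambda> by blast+
      have pf: "p f \<in> \<Lambda>" using subspace_sum_DW(2)[OF lagrangian_\<Lambda> fg(2)] .
      have eq: "b (0, k) s = - om (p f) (p k)" if k: "k \<in> K" "k \<in> D\<^sub>G" for k
      proof -
        have kW: "k \<in> W" using k K by blast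
        have "b (0, k) s = h f k + h g k" using b_mixed(2)[OF fg(2,3) k(2)] fg(1) by (simp add: h_simps)
        also have "\<dots> = h f k - h k f"
          using h_sym[OF lagrangian_G fg(3) k(2)] h_K[OF k(1) fW(1)] h_K[OF k(1) fW(2)] by simp
        also have "\<dots> = - om (p f) (p k)"
          using om_p(1)[OF fW(1), of "p k"] om_p(2)[OF fW(1) kW] p_U[OF kW] U(2) by (auto simp: om_def)
        finally show ?thesis .
      qed
      have lin: "linear (om (p f))" using om_bilinear by (simp add: bilinear_def)
      \<comment> \<open>Basis vectors in B0 lie in \<open>\<Lambda>\<close>, as \<open>p f\<close>
        does, and pair to 0 with it; the others are covered by the lifts.\<close>
      have "om (p f) y = 0" if y: "y \<in> B1" for y
      proof (cases "y \<in> B0")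
        case True
        then show ?thesis using L(4)[OF pf] B0(1) by blast
      next
        case False
        then have yY: "y \<in> Y" using y by (simp add: Y_def)
        then have "b (0, r y) s = 0" using Y0 by (simp add: T_def)
        then show ?thesis using eq[OF rK(1,2)] rY[OF span_base[OF yY]] by simp
      qed
      then have "om (p f) y = 0" if "y \<in> p ` K \<inter> G" for y
        using linear_eq_0_on_span[OF lin, of B1 y] that B1(4) by blast
      then show "\<forall>k\<in>K \<inter> D\<^sub>G. b (0, k) s = 0"
        using eq by (simp add: subspace_sum_D_iff[OF lagrangian_G])
    qed
    then show "{s \<in> D\<^sub>\<Lambda> \<times> D\<^sub>G. \<forall>x\<in>T ` Y. b x s = 0} = subspace_sum V\<^sub>G V\<^sub>K"
      unfolding orthogonal_to_isotropic[symmetric] by (rule Collect_cong[OF conj_cong[OF refl]])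
  qed
qed

theorem index_difference:
  assumes "neg_index D\<^sub>G (\<lambda>f. h f f) \<noteq> \<infinity>"
  shows "\<exists>m n. neg_index D\<^sub>\<Lambda> (\<lambda>f. h f f) = enat m \<and> neg_index D\<^sub>G (\<lambda>f. h f f) = enat n \<and>
           int m - int n = triple_index \<omega> (p ` K) \<Lambda> G"
proof -
  let ?S = "D\<^sub>\<Lambda> \<times> D\<^sub>G" and ?D = "D\<^sub>\<Lambda> \<times> {0}" and ?q = "\<lambda>s. b s s"
  have nG: "neg_index V\<^sub>G ?q = neg_index D\<^sub>G (\<lambda>f. h f f)"
    unfolding neg_index_def
  proof (rule pos_index_linear_surj[of snd])
    show "snd ` V\<^sub>G = D\<^sub>G" by (force simp: V\<^sub>G_def)
  qed (auto simp: V\<^sub>G_def b_def linear_snd subspace_V(2)[unfolded V\<^sub>G_def] bilinear_lzero[OF h] bilinear_rzero[OF h])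
  have subD: "subspace ?D" by (rule subspace_Times[OF subspace_D\<^sub>\<Lambda>]) (rule subspace_single_0)
  have nL: "neg_index ?D ?q = neg_index D\<^sub>\<Lambda> (\<lambda>f. h f f)"
    unfolding neg_index_def
  proof (rule pos_index_linear_surj[of fst])
    show "fst ` ?D = D\<^sub>\<Lambda>" by force
  qed (auto simp: b_def linear_fst subD bilinear_lzero[OF h] bilinear_rzero[OF h])
  have nK: "neg_index V\<^sub>K ?q = pos_index (p ` K \<inter> subspace_sum \<Lambda> G) (triple_form \<omega> \<Lambda> G)"
    unfolding neg_index_def
  proof (rule pos_index_linear_surj[OF _ subspace_V(3) V\<^sub>K_image])
    show "linear (\<lambda>s. p (fst s + snd s))"
      by (intro linearI) (simp_all add: p_simps algebra_simps)
    show "triple_form \<omega> \<Lambda> G (p (fst s + snd s)) = - b s s" if "s \<in> V\<^sub>K" for s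
      using triple_form_eq(1)[OF that] .
    show "triple_form \<omega> \<Lambda> G 0 = 0"
      using triple_form_eq(1)[OF subspace_0[OF subspace_V(3)]] by (simp add: p_simps)
  qed
  obtain C where C: "finite C" "U \<subseteq> span C" using fin by blast
  have "p ` K \<inter> subspace_sum \<Lambda> G \<subseteq> span C" using C(2) lagrangianD(2)[OF lagrangian_K] by blast
  then have finK: "pos_index (p ` K \<inter> subspace_sum \<Lambda> G) (triple_form \<omega> \<Lambda> G) \<noteq> \<infinity>"
    by (rule pos_index_finite[OF C(1)])
  obtain B1 where B1: "B.neg_basis V\<^sub>G B1"
    using B.neg_basis_exists[OF subspace_V(2), of ?q] assms nG by auto
  obtain B2 where B2: "B.neg_basis V\<^sub>K B2"
    using B.neg_basis_exists[OF subspace_V(3), of ?q] finK nK by auto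
  obtain X where X: "finite X" "independent X" "X \<subseteq> ?S" "\<forall>x\<in>X. \<forall>y\<in>X. b x y = 0"
    "\<forall>u\<in>span X. (\<forall>s\<in>?S. b u s = 0) \<longrightarrow> u = 0"
    "{s \<in> ?S. \<forall>x\<in>X. b x s = 0} = subspace_sum V\<^sub>G V\<^sub>K"
    "int (card X) = int (dim (p ` K \<inter> G)) - int (dim (p ` K \<inter> \<Lambda> \<inter> G))"
    using isotropic_lift by (elim exE conjE) (rule that; assumption)
  note B12 = B.neg_basis_sum[OF B1 B2 b_V subspace_V(2,3)]
  have "\<exists>Z. B.neg_basis ?S Z \<and> card Z = card X + card (B1 \<union> B2)"
  proof (rule B.neg_basis_isotropic[OF X(1-3) subspace_V(1)])
    show "b x y = 0" if "x \<in> X" "y \<in> X" for x y using X(4) that by blast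
    show "u = 0" if "u \<in> span X" "\<forall>s\<in>?S. b u s = 0" for u using X(5) that by blast
    show "B.neg_basis {s \<in> ?S. \<forall>x\<in>X. b x s = 0} (B1 \<union> B2)" unfolding X(6) by (rule B12(1))
  qed
  then obtain Z where Z: "B.neg_basis ?S Z" "card Z = card X + card (B1 \<union> B2)" by blast
  have "finite B1" "finite B2" using B1 B2 by (auto simp: B.neg_basis_def B.neg_orthonormal_def)
  then have cardZ: "card Z = card X + (card B1 + card B2)" using Z(2) B12(2) by (simp add: card_Un_disjoint)
  have nS: "neg_index ?S ?q = enat (card Z)"
    using B.neg_index_neg_basis[OF subspace_V(1) Z(1)] by simp
  have DS: "?D \<subseteq> ?S" using subspace_0[OF subspace_D\<^sub>G] by auto
  \<comment> \<open>Finiteness of the index of \<open>D\<^sub>\<Lambda>\<close> comes from the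
    finite count on the larger space; it yields a negative basis of \<open>?D\<close>, which by form
    density is one of \<open>?S\<close> as well.\<close>
  have "neg_index ?D ?q \<le> neg_index ?S ?q" unfolding neg_index_def by (rule pos_index_mono[OF DS])
  then have "neg_index ?D ?q \<noteq> \<infinity>" using nS enat_ile by force
  then obtain B where B: "B.neg_basis ?D B" using B.neg_basis_exists[OF subD, of ?q] by auto
  have "B.neg_basis ?S B" by (rule B.neg_basis_form_dense[OF B subD DS b_dense])
  then have "neg_index ?S ?q = enat (card B)" using B.neg_index_neg_basis[OF subspace_V(1)] by simp
  moreover have "neg_index ?D ?q = enat (card B)" using B.neg_index_neg_basis[OF subD B] by simp
  ultimately have "neg_index D\<^sub>\<Lambda> (\<lambda>f. h f f) = enat (card Z)" using nS nL by simp
  moreover have "neg_index D\<^sub>G (\<lambda>f. h f f) = enat (card B1)"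
    using B.neg_index_neg_basis[OF subspace_V(2) B1] nG by simp
  moreover have "pos_index (p ` K \<inter> subspace_sum \<Lambda> G) (triple_form \<omega> \<Lambda> G) = enat (card B2)"
    using B.neg_index_neg_basis[OF subspace_V(3) B2] nK by simp
  ultimately show ?thesis
    using cardZ X(7) by (intro exI[of _ "card Z"] exI[of _ "card B1"]) (simp add: triple_index_def)
qed

end

section \<open>Square integrable functions\<close>

text \<open>Vectors are representatives of classes, so \<open>ip x x = 0\<close> does not force
  \<open>x = 0\<close>, and the laws are restricted to members of H, where the integrals
  exist.\<close>

locale semi_inner_space =
  fixes H :: "'a::real_vector set" and ip :: "'a \<Rightarrow> 'a \<Rightarrow> real"
  assumes H: "subspace H"
    and add: "x \<in> H \<Longrightarrow> y \<in> H \<Longrightarrow> z \<in> H \<Longrightarrow> ip (x + y) z = ip x z + ip y z"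
    and scale: "x \<in> H \<Longrightarrow> z \<in> H \<Longrightarrow> ip (c *\<^sub>R x) z = c * ip x z"
    and sym: "x \<in> H \<Longrightarrow> y \<in> H \<Longrightarrow> ip x y = ip y x"
    and nonneg: "x \<in> H \<Longrightarrow> 0 \<le> ip x x"
begin

lemmas mem_add = subspace_add[OF H] and mem_scale = subspace_scale[OF H]
  and mem_diff = subspace_diff[OF H]

lemma diff: "x \<in> H \<Longrightarrow> y \<in> H \<Longrightarrow> z \<in> H \<Longrightarrow> ip (x - y) z = ip x z - ip y z"
  using add[of x "(-1) *\<^sub>R y" z] scale[of y z "-1"] mem_scale[of y "-1"] by simp

lemma add_right: "x \<in> H \<Longrightarrow> y \<in> H \<Longrightarrow> z \<in> H \<Longrightarrow> ip z (x + y) = ip z x + ip z y"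
  using add[of x y z] sym[of x z] sym[of y z] sym[of "x + y" z] mem_add by simp

lemma scale_right: "x \<in> H \<Longrightarrow> z \<in> H \<Longrightarrow> ip z (c *\<^sub>R x) = c * ip z x"
  using scale[of x z c] sym[of x z] sym[of "c *\<^sub>R x" z] mem_scale by simp

lemma diff_right: "x \<in> H \<Longrightarrow> y \<in> H \<Longrightarrow> z \<in> H \<Longrightarrow> ip z (x - y) = ip z x - ip z y"
  using diff[of x y z] sym[of x z] sym[of y z] sym[of "x - y" z] mem_diff by simp

lemmas ip_simps = add add_right scale scale_right diff diff_right mem_add mem_scale mem_diff

lemma ip_zero: "z \<in> H \<Longrightarrow> ip 0 z = 0" "z \<in> H \<Longrightarrow> ip z 0 = 0"
  using scale[of 0 z 0] scale_right[of 0 z 0] subspace_0[OF H] by auto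

lemma cauchy_schwarz:
  assumes "x \<in> H" "y \<in> H"
  shows "(ip x y)\<^sup>2 \<le> ip x x * ip y y"
proof -
  have *: "0 \<le> ip x x + 2 * t * ip x y + t\<^sup>2 * ip y y" for t
    using nonneg[of "x + t *\<^sub>R y"] sym[OF assms] assms
    by (simp add: ip_simps power2_eq_square algebra_simps)
  show ?thesis
  proof (cases "ip y y = 0")
    case True
    have "ip x y = 0"
    proof (rule ccontr)
      assume "ip x y \<noteq> 0"
      \<comment> \<open>With \<open>ip y y = 0\<close> the quadratic is affine in \<open>t\<close>,
        and at this \<open>t\<close> its value is -1.\<close>
      then show False using *[of "- (ip x x + 1) / (2 * ip x y)"] True by (simp add: field_simps)
    qed
    then show ?thesis using True by simp
  next
    case False
    then have "0 < ip y y" using nonneg[OF assms(2)] by simp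
    then show ?thesis using *[of "- ip x y / ip y y"] by (simp add: field_simps power2_eq_square)
  qed
qed

lemma ip_tendsto:
  assumes "\<And>n. u n \<in> H" "y \<in> H" "(\<lambda>n::nat. ip (u n) (u n)) \<longlonglongrightarrow> 0"
  shows "(\<lambda>n. ip (u n) y) \<longlonglongrightarrow> 0"
proof -
  have "(\<lambda>n. ip (u n) (u n) * ip y y) \<longlonglongrightarrow> 0 * ip y y" by (intro tendsto_intros assms(3))
  then have lim: "(\<lambda>n. ip (u n) (u n) * ip y y) \<longlonglongrightarrow> 0" by simp
  have "(\<lambda>n. (ip (u n) y)\<^sup>2) \<longlonglongrightarrow> 0"
    by (rule tendsto_sandwich[OF _ _ tendsto_const lim]) (simp_all add: cauchy_schwarz assms)
  then have "(\<lambda>n. sqrt ((ip (u n) y)\<^sup>2)) \<longlonglongrightarrow> sqrt 0" by (rule tendsto_real_sqrt)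
  then show ?thesis by (simp add: tendsto_rabs_zero_iff)
qed

lemma orthogonal_projection:
  assumes complete: "\<And>u. (\<And>n::nat. u n \<in> H) \<Longrightarrow>
      (\<And>e. 0 < e \<Longrightarrow> \<exists>k. \<forall>m\<ge>k. \<forall>n\<ge>k. ip (u m - u n) (u m - u n) < e) \<Longrightarrow>
      \<exists>f\<in>H. (\<lambda>n. ip (u n - f) (u n - f)) \<longlonglongrightarrow> 0"
    and N: "subspace N" "N \<subseteq> H"
    and closed: "\<And>u f. (\<And>n::nat. u n \<in> N) \<Longrightarrow> f \<in> H \<Longrightarrow> (\<lambda>n. ip (u n - f) (u n - f)) \<longlonglongrightarrow> 0 \<Longrightarrow> f \<in> N"
    and z: "z \<in> H"
  shows "\<exists>f\<in>N. \<forall>m\<in>N. ip (z - f) m = 0"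
proof -
  define A where "A = (\<lambda>n. ip (z - n) (z - n)) ` N"
  define d where "d = Inf A"
  have NH: "x \<in> H" if "x \<in> N" for x using N(2) that by blast
  have A: "A \<noteq> {}" "bdd_below A"
    using subspace_0[OF N(1)] nonneg mem_diff[OF z NH] by (auto simp: A_def intro!: bdd_belowI[of _ 0])
  have d: "d \<le> ip (z - n) (z - n)" if "n \<in> N" for n
    unfolding d_def using that A by (intro cInf_lower) (auto simp: A_def)
  have "\<exists>n\<in>N. ip (z - n) (z - n) < d + e" if e: "0 < e" for e
  proof -
    have "\<exists>x\<in>A. x < d + e" using e by (intro cInf_lessD[OF A(1)]) (simp add: d_def)
    then show ?thesis by (auto simp: A_def)
  qed
  then have "\<forall>k. \<exists>n\<in>N. ip (z - n) (z - n) < d + inverse (real (Suc k))" by simp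
  then obtain u where u: "\<And>k. u k \<in> N" "\<And>k. ip (z - u k) (z - u k) < d + inverse (real (Suc k))"
    by metis
  \<comment> \<open>Parallelogram identity: the midpoint \<open>?c\<close> lies in N, so its squared
    distance to \<open>z\<close> is at least \<open>d\<close>, and the minimizing sequence is
    Cauchy.\<close>
  have par: "ip (u m - u n) (u m - u n) < 2 * inverse (real (Suc m)) + 2 * inverse (real (Suc n))" for m n
  proof -
    let ?c = "(1/2) *\<^sub>R (u m + u n)"
    have "?c \<in> N" using u N(1) by (intro subspace_scale subspace_add)
    then have "d \<le> ip (z - ?c) (z - ?c)" by (rule d)
    moreover have "ip (u m - u n) (u m - u n)
        = 2 * ip (z - u m) (z - u m) + 2 * ip (z - u n) (z - u n) - 4 * ip (z - ?c) (z - ?c)"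
      using NH[OF u(1)] z sym[of z "u m"] sym[of z "u n"] sym[of "u m" "u n"]
      by (simp add: ip_simps algebra_simps)
    ultimately show ?thesis using u(2)[of m] u(2)[of n] by linarith
  qed
  have "\<exists>f\<in>H. (\<lambda>n. ip (u n - f) (u n - f)) \<longlonglongrightarrow> 0"
  proof (rule complete)
    show "u n \<in> H" for n using NH u by blast
    fix e :: real assume "0 < e"
    then obtain k where k: "inverse (real (Suc k)) < e / 4" using reals_Archimedean[of "e / 4"] by auto
    have "ip (u m - u n) (u m - u n) < e" if "m \<ge> k" "n \<ge> k" for m n
    proof -
      have "inverse (real (Suc m)) \<le> inverse (real (Suc k))" "inverse (real (Suc n)) \<le> inverse (real (Suc k))"
        using that by simp_all
      then show ?thesis using par[of m n] k by linarith
    qed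
    then show "\<exists>k. \<forall>m\<ge>k. \<forall>n\<ge>k. ip (u m - u n) (u m - u n) < e" by blast
  qed
  then obtain f where f: "f \<in> H" "(\<lambda>n. ip (u n - f) (u n - f)) \<longlonglongrightarrow> 0" by blast
  have fN: "f \<in> N" using closed[OF u(1) f] .
  have "ip (z - f) m = 0" if m: "m \<in> N" for m
  proof -
    have uH: "u n \<in> H" and mH: "m \<in> H" for n using NH u m by blast+
    have "(\<lambda>n. ip (u n - f) m) \<longlonglongrightarrow> 0" using f uH mH by (intro ip_tendsto) (auto intro: mem_diff)
    then have "(\<lambda>n. ip (z - f) m - ip (u n - f) m) \<longlonglongrightarrow> ip (z - f) m - 0" by (intro tendsto_intros)
    then have lim: "(\<lambda>n. ip (z - u n) m) \<longlonglongrightarrow> ip (z - f) m"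
      using uH mH f(1) z by (simp add: ip_simps)
    \<comment> \<open>Moving the almost minimal \<open>u n\<close> by \<open>t *\<^sub>R m\<close>
      stays in N, so the squared distance cannot fall below \<open>d\<close>; in the limit the error
      \<open>inverse (real (Suc n))\<close> disappears.\<close>
    have le: "2 * t * ip (z - f) m \<le> t\<^sup>2 * ip m m" for t
    proof (rule LIMSEQ_le)
      show "(\<lambda>n. 2 * t * ip (z - u n) m) \<longlonglongrightarrow> 2 * t * ip (z - f) m" by (intro tendsto_intros lim)
      have "(\<lambda>n. inverse (real (Suc n)) + t\<^sup>2 * ip m m) \<longlonglongrightarrow> 0 + t\<^sup>2 * ip m m"
        by (intro tendsto_intros LIMSEQ_inverse_real_of_nat)
      then show "(\<lambda>n. inverse (real (Suc n)) + t\<^sup>2 * ip m m) \<longlonglongrightarrow> t\<^sup>2 * ip m m" by simp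
      have "2 * t * ip (z - u n) m \<le> inverse (real (Suc n)) + t\<^sup>2 * ip m m" for n
      proof -
        have "u n + t *\<^sub>R m \<in> N" using u m N(1) by (intro subspace_scale subspace_add)
        then have "d \<le> ip (z - (u n + t *\<^sub>R m)) (z - (u n + t *\<^sub>R m))" by (rule d)
        also have "\<dots> = ip (z - u n) (z - u n) - 2 * t * ip (z - u n) m + t\<^sup>2 * ip m m"
          using uH[of n] mH z sym[of m z] sym[of m "u n"] sym[of z "u n"]
          by (simp add: ip_simps algebra_simps power2_eq_square)
        finally show ?thesis using u(2)[of n] by linarith
      qed
      then show "\<exists>k. \<forall>n\<ge>k. 2 * t * ip (z - u n) m \<le> inverse (real (Suc n)) + t\<^sup>2 * ip m m" by blast
    qed
    have mm: "0 \<le> ip m m" using nonneg mH by blast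
    show ?thesis
    proof (rule ccontr)
      assume n: "ip (z - f) m \<noteq> 0"
      \<comment> \<open>The 1 keeps the denominator positive when \<open>ip m m = 0\<close>; for
        this \<open>t\<close> the bound \<open>le\<close> reads
        \<open>t\<^sup>2 * (ip m m + 2) \<le> 0\<close>.\<close>
      define t where "t = ip (z - f) m / (ip m m + 1)"
      have "2 * t * ip (z - f) m = 2 * t\<^sup>2 * (ip m m + 1)"
        using mm by (simp add: t_def power2_eq_square)
      then have "t\<^sup>2 * (ip m m + 2) \<le> 0" using le[of t] by (simp add: algebra_simps)
      moreover have "0 < t\<^sup>2 * (ip m m + 2)" using n mm by (simp add: t_def)
      ultimately show False by simp
    qed
  qed
  then show ?thesis using fN by blast
qed

end

text \<open>Riesz--Fischer.  A subsequence \<open>r\<close> with \<open>\<integral> (norm (u (r (n + 1)) - u (r n)))\<^sup>2 \<le> 4\<^sup>-\<^sup>n\<close> converges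
  almost everywhere because \<open>x \<le> (2\<^sup>-\<^sup>n + 2\<^sup>n x\<^sup>2) / 2\<close>; its limit is the \<open>L\<^sup>2\<close>-limit by Fatou's lemma.\<close>
lemma square_integrable_complete:
  fixes u :: "nat \<Rightarrow> 'a \<Rightarrow> 'b::euclidean_space"
  assumes meas: "\<And>n. u n \<in> borel_measurable M"
    and int: "\<And>m n. integrable M (\<lambda>x. (norm (u m x - u n x))\<^sup>2)"
    and cauchy: "\<And>e. 0 < e \<Longrightarrow> \<exists>k. \<forall>m\<ge>k. \<forall>n\<ge>k. (\<integral>x. (norm (u m x - u n x))\<^sup>2 \<partial>M) < e"
  shows "\<exists>f. f \<in> borel_measurable M \<and> (\<forall>n. integrable M (\<lambda>x. (norm (u n x - f x))\<^sup>2)) \<and>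
           (\<lambda>n. \<integral>x. (norm (u n x - f x))\<^sup>2 \<partial>M) \<longlonglongrightarrow> 0"
proof -
  have "\<forall>n. \<exists>k. \<forall>m\<ge>k. \<forall>l\<ge>k. (\<integral>x. (norm (u m x - u l x))\<^sup>2 \<partial>M) < (1/4)^n"
    using cauchy by simp
  then obtain K where K: "\<And>n m l. m \<ge> K n \<Longrightarrow> l \<ge> K n \<Longrightarrow> (\<integral>x. (norm (u m x - u l x))\<^sup>2 \<partial>M) < (1/4)^n"
    by metis
  \<comment> \<open>Summing all thresholds up to n puts both \<open>r n\<close> and
    \<open>r (Suc n)\<close> beyond \<open>K n\<close>; the summand \<open>n\<close> makes
    \<open>r\<close> tend to infinity.\<close>
  define r where "r n = (\<Sum>i\<le>n. K i) + n" for n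
  have rK: "K n \<le> r n" "K n \<le> r (Suc n)" for n
    using member_le_sum[of n "{..n}" K] member_le_sum[of n "{..Suc n}" K] by (auto simp: r_def)
  have r_ge: "n \<le> r n" for n by (simp add: r_def)
  define \<delta> where "\<delta> n x = norm (u (r (Suc n)) x - u (r n) x)" for n x
  have \<delta>_meas: "\<delta> n \<in> borel_measurable M" for n
    unfolding \<delta>_def using meas by measurable
  have \<delta>_int: "(\<integral>\<^sup>+x. ennreal (2^n * (\<delta> n x)\<^sup>2) \<partial>M) \<le> ennreal ((1/2)^n)" for n
  proof -
    have "(\<integral>\<^sup>+x. ennreal (2^n * (\<delta> n x)\<^sup>2) \<partial>M) = ennreal (\<integral>x. 2^n * (\<delta> n x)\<^sup>2 \<partial>M)"
      unfolding \<delta>_def using int by (intro nn_integral_eq_integral) auto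
    also have "\<dots> \<le> ennreal (2^n * (1/4)^n)"
      unfolding \<delta>_def using K[OF rK(2) rK(1), of n] by (intro ennreal_leI) simp
    also have "(2::real)^n * (1/4)^n = (1/2)^n" by (simp flip: power_mult_distrib)
    finally show ?thesis .
  qed
  have "(\<integral>\<^sup>+x. (\<Sum>n. ennreal (2^n * (\<delta> n x)\<^sup>2)) \<partial>M) = (\<Sum>n. \<integral>\<^sup>+x. ennreal (2^n * (\<delta> n x)\<^sup>2) \<partial>M)"
    using \<delta>_meas by (intro nn_integral_suminf) measurable
  also have "\<dots> \<le> (\<Sum>n. ennreal ((1/2)^n))" by (intro suminf_le \<delta>_int) auto
  also have "\<dots> = ennreal (\<Sum>n. (1/2)^n)" by (intro suminf_ennreal2) (auto simp: summable_geometric)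
  also have "\<dots> < \<infinity>" by simp
  finally have "(\<integral>\<^sup>+x. (\<Sum>n. ennreal (2^n * (\<delta> n x)\<^sup>2)) \<partial>M) \<noteq> \<infinity>" by simp
  then have "AE x in M. (\<Sum>n. ennreal (2^n * (\<delta> n x)\<^sup>2)) \<noteq> \<infinity>"
    using \<delta>_meas by (intro nn_integral_noteq_infinite) measurable
  then have conv: "AE x in M. convergent (\<lambda>n. u (r n) x)"
  proof (rule AE_mp, intro AE_I2 impI)
    fix x assume "(\<Sum>n. ennreal (2^n * (\<delta> n x)\<^sup>2)) \<noteq> \<infinity>"
    then have s: "summable (\<lambda>n. 2^n * (\<delta> n x)\<^sup>2)"
      by (intro summable_suminf_not_top) auto
    have "summable (\<lambda>n. ((1/2)^n + 2^n * (\<delta> n x)\<^sup>2) / 2)"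
      using s by (intro summable_divide summable_add) (auto simp: summable_geometric)
    then have "summable (\<lambda>n. u (r (Suc n)) x - u (r n) x)"
    proof (rule summable_comparison_test'[of _ 0])
      fix n :: nat
      have sq: "(1 - p * d)\<^sup>2 / p = 1 / p - 2 * d + p * d\<^sup>2" if "p > 0" for p d :: real
        using that by (simp add: field_simps power2_eq_square)
      have "0 \<le> (1 - 2^n * \<delta> n x)\<^sup>2 / 2^n" by simp
      also have "\<dots> = (1/2)^n - 2 * \<delta> n x + 2^n * (\<delta> n x)\<^sup>2"
        by (simp add: sq power_divide)
      finally show "norm (u (r (Suc n)) x - u (r n) x) \<le> ((1/2)^n + 2^n * (\<delta> n x)\<^sup>2) / 2"
        unfolding \<delta>_def by simp
    qed
    then have "(\<lambda>n. \<Sum>i<n. u (r (Suc i)) x - u (r i) x) \<longlonglongrightarrow> (\<Sum>i. u (r (Suc i)) x - u (r i) x)"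
      by (rule summable_LIMSEQ)
    then have "(\<lambda>n. (u (r n) x - u (r 0) x) + u (r 0) x) \<longlonglongrightarrow> (\<Sum>i. u (r (Suc i)) x - u (r i) x) + u (r 0) x"
      using sum_lessThan_telescope[of "\<lambda>i. u (r i) x"]
      by (intro tendsto_add tendsto_const) simp
    then show "convergent (\<lambda>n. u (r n) x)" by (auto simp: convergent_def)
  qed
  define f where "f x = lim (\<lambda>n. u (r n) x)" for x
  have f_meas: "f \<in> borel_measurable M"
    unfolding f_def using meas by (intro borel_measurable_lim_metric)
  \<comment> \<open>Fatou's lemma is applied along the subsequence, while \<open>n\<close> runs
    through the full sequence; the Cauchy property thus gives convergence of all of
    \<open>u\<close>.\<close>
  have fatou: "(\<integral>\<^sup>+x. ennreal ((norm (u n x - f x))\<^sup>2) \<partial>M) \<le> ennreal e"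
    if k: "\<forall>m\<ge>k. \<forall>n\<ge>k. (\<integral>x. (norm (u m x - u n x))\<^sup>2 \<partial>M) < e" and n: "n \<ge> k" for n k e
  proof -
    have "(\<integral>\<^sup>+x. ennreal ((norm (u n x - f x))\<^sup>2) \<partial>M)
        = (\<integral>\<^sup>+x. liminf (\<lambda>i. ennreal ((norm (u n x - u (r i) x))\<^sup>2)) \<partial>M)"
    proof (rule nn_integral_cong_AE, rule AE_mp[OF conv], intro AE_I2 impI)
      fix x assume "convergent (\<lambda>n. u (r n) x)"
      then have "(\<lambda>i. u (r i) x) \<longlonglongrightarrow> f x" by (simp add: f_def convergent_LIMSEQ_iff)
      then have "(\<lambda>i. ennreal ((norm (u n x - u (r i) x))\<^sup>2)) \<longlonglongrightarrow> ennreal ((norm (u n x - f x))\<^sup>2)"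
        by (intro tendsto_intros tendsto_ennrealI)
      then show "ennreal ((norm (u n x - f x))\<^sup>2) = liminf (\<lambda>i. ennreal ((norm (u n x - u (r i) x))\<^sup>2))"
        by (rule lim_imp_Liminf[OF trivial_limit_sequentially, symmetric])
    qed
    also have "\<dots> \<le> liminf (\<lambda>i. \<integral>\<^sup>+x. ennreal ((norm (u n x - u (r i) x))\<^sup>2) \<partial>M)"
      using meas by (intro nn_integral_liminf) measurable
    also have "\<dots> \<le> liminf (\<lambda>i. ennreal e)"
    proof (rule Liminf_mono, rule eventually_sequentiallyI[of k])
      fix i assume "k \<le> i"
      then have "k \<le> r i" using r_ge[of i] by simp
      then have "(\<integral>x. (norm (u n x - u (r i) x))\<^sup>2 \<partial>M) < e" using k n by blast
      moreover have "(\<integral>\<^sup>+x. ennreal ((norm (u n x - u (r i) x))\<^sup>2) \<partial>M) = ennreal (\<integral>x. (norm (u n x - u (r i) x))\<^sup>2 \<partial>M)"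
        using int by (intro nn_integral_eq_integral) auto
      ultimately show "(\<integral>\<^sup>+x. ennreal ((norm (u n x - u (r i) x))\<^sup>2) \<partial>M) \<le> ennreal e"
        by (simp add: ennreal_leI)
    qed
    also have "\<dots> = ennreal e" by (simp add: Liminf_const)
    finally show ?thesis .
  qed
  have norm_meas: "(\<lambda>x. (norm (u n x - f x))\<^sup>2) \<in> borel_measurable M" for n
    using meas f_meas by measurable
  obtain k1 where k1: "\<forall>m\<ge>k1. \<forall>n\<ge>k1. (\<integral>x. (norm (u m x - u n x))\<^sup>2 \<partial>M) < 1"
    using cauchy[of 1] by auto
  have int1: "integrable M (\<lambda>x. (norm (u k1 x - f x))\<^sup>2)"
    using le_less_trans[OF fatou[OF k1 order_refl] ennreal_less_top] norm_meas
    by (intro integrableI_nonneg) auto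
  have intf: "integrable M (\<lambda>x. (norm (u n x - f x))\<^sup>2)" for n
  proof (rule Bochner_Integration.integrable_bound)
    show "integrable M (\<lambda>x. 2 * (norm (u n x - u k1 x))\<^sup>2 + 2 * (norm (u k1 x - f x))\<^sup>2)"
      using int int1 by auto
    have "(norm (a - c))\<^sup>2 \<le> 2 * (norm (a - b))\<^sup>2 + 2 * (norm (b - c))\<^sup>2" for a b c :: 'b
    proof -
      have "norm (a - c) \<le> norm (a - b) + norm (b - c)" using norm_triangle_ineq[of "a - b" "b - c"] by simp
      then have "(norm (a - c))\<^sup>2 \<le> (norm (a - b) + norm (b - c))\<^sup>2" by (intro power_mono) auto
      also have "\<dots> \<le> 2 * (norm (a - b))\<^sup>2 + 2 * (norm (b - c))\<^sup>2"
        using zero_le_power2[of "norm (a - b) - norm (b - c)"] by (simp add: power2_diff power2_sum)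
      finally show ?thesis .
    qed
    then show "AE x in M. norm ((norm (u n x - f x))\<^sup>2) \<le> norm (2 * (norm (u n x - u k1 x))\<^sup>2 + 2 * (norm (u k1 x - f x))\<^sup>2)"
      by (intro AE_I2) simp
  qed (rule norm_meas)
  have "(\<lambda>n. \<integral>x. (norm (u n x - f x))\<^sup>2 \<partial>M) \<longlonglongrightarrow> 0"
  proof (rule LIMSEQ_I)
    fix e :: real assume e: "0 < e"
    then obtain k where k: "\<forall>m\<ge>k. \<forall>n\<ge>k. (\<integral>x. (norm (u m x - u n x))\<^sup>2 \<partial>M) < e / 2"
      using cauchy[of "e / 2"] by auto
    have "norm ((\<integral>x. (norm (u n x - f x))\<^sup>2 \<partial>M) - 0) < e" if n: "n \<ge> k" for n
    proof -
      have "ennreal (\<integral>x. (norm (u n x - f x))\<^sup>2 \<partial>M) \<le> ennreal (e / 2)"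
        using fatou[OF k n] nn_integral_eq_integral[OF intf] by simp
      then have "(\<integral>x. (norm (u n x - f x))\<^sup>2 \<partial>M) \<le> e / 2" using e by (simp add: ennreal_le_iff)
      moreover have "0 \<le> (\<integral>x. (norm (u n x - f x))\<^sup>2 \<partial>M)" by simp
      ultimately show ?thesis using e by simp
    qed
    then show "\<exists>k. \<forall>n\<ge>k. norm ((\<integral>x. (norm (u n x - f x))\<^sup>2 \<partial>M) - 0) < e" by blast
  qed
  then show ?thesis using f_meas intf by blast
qed

section \<open>The L^2 space of a metric graph\<close>

lemma square_integrable_on_inner:
  assumes "square_integrable_on f I" "square_integrable_on g I"
  shows "integrable (lebesgue_on I) (\<lambda>t. f t \<bullet> g t)"
proof (rule Bochner_Integration.integrable_bound)
  show "integrable (lebesgue_on I) (\<lambda>t. (norm (f t))\<^sup>2 + (norm (g t))\<^sup>2)"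
    using assms by (auto simp: square_integrable_on_def)
  show "(\<lambda>t. f t \<bullet> g t) \<in> borel_measurable (lebesgue_on I)"
    using assms by (auto simp: square_integrable_on_def)
  have "\<bar>x \<bullet> y\<bar> \<le> (norm x)\<^sup>2 + (norm y)\<^sup>2" for x y :: "real^'a"
  proof -
    have "\<bar>x \<bullet> y\<bar> \<le> norm x * norm y" by (rule Cauchy_Schwarz_ineq2)
    moreover have "0 \<le> norm x * norm y" by simp
    ultimately show ?thesis using zero_le_power2[of "norm x - norm y"] unfolding power2_diff by linarith
  qed
  then show "AE t in lebesgue_on I. norm (f t \<bullet> g t) \<le> norm ((norm (f t))\<^sup>2 + (norm (g t))\<^sup>2)"
    by (intro AE_I2) simp
qed

lemma square_integrable_on_iff_inner:
  "square_integrable_on f I \<longleftrightarrow> f \<in> borel_measurable (lebesgue_on I) \<and> integrable (lebesgue_on I) (\<lambda>t. f t \<bullet> f t)"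
  by (simp add: square_integrable_on_def power2_norm_eq_inner)

lemma square_integrable_on_add:
  assumes "square_integrable_on f I" "square_integrable_on g I"
  shows "square_integrable_on (\<lambda>t. f t + g t) I"
  using assms square_integrable_on_inner[OF assms] square_integrable_on_inner[OF assms(2,1)]
  by (auto simp: square_integrable_on_iff_inner inner_add_left inner_add_right)

lemma square_integrable_on_scaleR:
  "square_integrable_on f I \<Longrightarrow> square_integrable_on (\<lambda>t. c *\<^sub>R f t) I"
  by (auto simp: square_integrable_on_iff_inner)

lemma subspace_L2: "subspace (L2 \<Gamma>)"
proof (rule subspaceI)
  show "0 \<in> L2 \<Gamma>" by (simp add: L2_def square_integrable_on_def zero_fun_def)
qed (auto simp: L2_def scaleR_fun_def plus_fun_def square_integrable_on_add square_integrable_on_scaleR)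

lemma L2_inner_integrable:
  "f \<in> L2 \<Gamma> \<Longrightarrow> g \<in> L2 \<Gamma> \<Longrightarrow> j \<in> edges \<Gamma> \<Longrightarrow> integrable (lebesgue_on (edge_interval \<Gamma> j)) (\<lambda>t. f j t \<bullet> g j t)"
  by (simp add: L2_def square_integrable_on_inner)

interpretation L2: semi_inner_space "L2 \<Gamma>" "L2_inner \<Gamma>" for \<Gamma>
proof
  show "subspace (L2 \<Gamma>)" by (rule subspace_L2)
  show "L2_inner \<Gamma> (x + y) z = L2_inner \<Gamma> x z + L2_inner \<Gamma> y z"
    if "x \<in> L2 \<Gamma>" "y \<in> L2 \<Gamma>" "z \<in> L2 \<Gamma>" for x y z :: "'b \<Rightarrow> real \<Rightarrow> real^'c"
    unfolding L2_inner_def using that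
    by (simp add: inner_add_left L2_inner_integrable sum.distrib)
  show "L2_inner \<Gamma> (c *\<^sub>R x) z = c * L2_inner \<Gamma> x z" for x z :: "'b \<Rightarrow> real \<Rightarrow> real^'c" and c
    by (simp add: L2_inner_def scaleR_fun_def sum_distrib_left)
  show "L2_inner \<Gamma> x y = L2_inner \<Gamma> y x" for x y :: "'b \<Rightarrow> real \<Rightarrow> real^'c"
    by (simp add: L2_inner_def inner_commute)
  show "0 \<le> L2_inner \<Gamma> x x" for x :: "'b \<Rightarrow> real \<Rightarrow> real^'c"
    by (simp add: L2_inner_def sum_nonneg)
qed

lemma L2_norm_square: "(L2_norm \<Gamma> f)\<^sup>2 = L2_inner \<Gamma> f f"
  by (simp add: L2_norm_def L2_inner_def sum_nonneg)

lemma L2_norm_tendsto_0: "(\<lambda>n. L2_norm \<Gamma> (u n)) \<longlonglongrightarrow> 0 \<longleftrightarrow> (\<lambda>n. L2_inner \<Gamma> (u n) (u n)) \<longlonglongrightarrow> 0"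
  using tendsto_power[of "\<lambda>n. L2_norm \<Gamma> (u n)" 0 sequentially 2] 
    tendsto_real_sqrt[of "\<lambda>n. L2_inner \<Gamma> (u n) (u n)" 0 sequentially]
  by (auto simp: L2_norm_square) (auto simp: L2_norm_def)

lemma ae_equal_refl: "ae_equal \<Gamma> f f"
  by (simp add: ae_equal_def)

lemma ae_equal_sym: "ae_equal \<Gamma> f g \<Longrightarrow> ae_equal \<Gamma> g f"
  by (auto simp: ae_equal_def elim!: AE_mp)

lemma ae_equal_L2_inner:
  assumes "ae_equal \<Gamma> f f'" "ae_equal \<Gamma> g g'" "f \<in> L2 \<Gamma>" "g \<in> L2 \<Gamma>" "f' \<in> L2 \<Gamma>" "g' \<in> L2 \<Gamma>"
  shows "L2_inner \<Gamma> f g = L2_inner \<Gamma> f' g'"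
  unfolding L2_inner_def
proof (intro sum.cong refl integral_cong_AE)
  fix j assume j: "j \<in> edges \<Gamma>"
  have "AE t in lebesgue_on (edge_interval \<Gamma> j). f j t = f' j t"
    "AE t in lebesgue_on (edge_interval \<Gamma> j). g j t = g' j t"
    using assms(1,2) j by (auto simp: ae_equal_def)
  then show "AE t in lebesgue_on (edge_interval \<Gamma> j). f j t \<bullet> g j t = f' j t \<bullet> g' j t"
    by eventually_elim simp
qed (use assms(3-6) in \<open>auto dest: L2_inner_integrable\<close>)

lemma ae_equal_iff_norm:
  assumes "finite (edges \<Gamma>)" "f \<in> L2 \<Gamma>"
  shows "ae_equal \<Gamma> f 0 \<longleftrightarrow> L2_inner \<Gamma> f f = 0"
proof -
  have "L2_inner \<Gamma> f f = 0 \<longleftrightarrow> (\<forall>j\<in>edges \<Gamma>. integral\<^sup>L (lebesgue_on (edge_interval \<Gamma> j)) (\<lambda>t. f j t \<bullet> f j t) = 0)"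
    unfolding L2_inner_def using assms(1) by (subst sum_nonneg_eq_0_iff) auto
  also have "\<dots> \<longleftrightarrow> ae_equal \<Gamma> f 0"
    unfolding ae_equal_def
    using integral_nonneg_eq_0_iff_AE[OF L2_inner_integrable[OF assms(2,2)]] by simp
  finally show ?thesis by simp
qed

lemma L2_complete:
  fixes u :: "nat \<Rightarrow> 'e \<Rightarrow> real \<Rightarrow> real^'d"
  assumes fin: "finite (edges \<Gamma>)" and u: "\<And>n. u n \<in> L2 \<Gamma>"
    and cauchy: "\<And>e. 0 < e \<Longrightarrow> \<exists>k. \<forall>m\<ge>k. \<forall>n\<ge>k. L2_inner \<Gamma> (u m - u n) (u m - u n) < e"
  shows "\<exists>f\<in>L2 \<Gamma>. (\<lambda>n. L2_inner \<Gamma> (u n - f) (u n - f)) \<longlonglongrightarrow> 0"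
proof -
  let ?M = "\<lambda>j. lebesgue_on (edge_interval \<Gamma> j)"
  define P where "P j g \<longleftrightarrow> g \<in> borel_measurable (?M j) \<and>
      (\<forall>n. integrable (?M j) (\<lambda>t. (norm (u n j t - g t))\<^sup>2)) \<and>
      (\<lambda>n. \<integral>t. (norm (u n j t - g t))\<^sup>2 \<partial>?M j) \<longlonglongrightarrow> 0" for j and g :: "real \<Rightarrow> real^'d"
  have "\<exists>g. P j g" if j: "j \<in> edges \<Gamma>" for j
    unfolding P_def
  proof (rule square_integrable_complete)
    show "u n j \<in> borel_measurable (?M j)" for n
      using u[of n] j by (simp add: L2_def square_integrable_on_def)
    have "u m - u n \<in> L2 \<Gamma>" for m n using u by (intro L2.mem_diff)
    from L2_inner_integrable[OF this this j]
    show "integrable (?M j) (\<lambda>t. (norm (u m j t - u n j t))\<^sup>2)" for m n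
      by (simp add: power2_norm_eq_inner)
    fix e :: real assume "0 < e"
    then obtain k where k: "\<forall>m\<ge>k. \<forall>n\<ge>k. L2_inner \<Gamma> (u m - u n) (u m - u n) < e" using cauchy by blast
    have "(\<integral>t. (norm (u m j t - u n j t))\<^sup>2 \<partial>?M j) \<le> L2_inner \<Gamma> (u m - u n) (u m - u n)" for m n
      unfolding L2_inner_def power2_norm_eq_inner
      using member_le_sum[OF j, of "\<lambda>j. \<integral>t. (u m - u n) j t \<bullet> (u m - u n) j t \<partial>?M j"] fin by simp
    then show "\<exists>k. \<forall>m\<ge>k. \<forall>n\<ge>k. (\<integral>t. (norm (u m j t - u n j t))\<^sup>2 \<partial>?M j) < e"
      using k by (meson le_less_trans)
  qed
  then obtain f where "\<And>j. j \<in> edges \<Gamma> \<Longrightarrow> P j (f j)" by metis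
  then have f: "\<And>j. j \<in> edges \<Gamma> \<Longrightarrow> f j \<in> borel_measurable (?M j)"
    "\<And>j n. j \<in> edges \<Gamma> \<Longrightarrow> integrable (?M j) (\<lambda>t. (norm (u n j t - f j t))\<^sup>2)"
    "\<And>j. j \<in> edges \<Gamma> \<Longrightarrow> (\<lambda>n. \<integral>t. (norm (u n j t - f j t))\<^sup>2 \<partial>?M j) \<longlonglongrightarrow> 0"
    unfolding P_def by blast+
  have "u 0 - f \<in> L2 \<Gamma>"
    using f u[of 0] by (auto simp: L2_def square_integrable_on_def fun_diff_def)
  from L2.mem_diff[OF u[of 0] this] have "f \<in> L2 \<Gamma>" by simp
  moreover have "(\<lambda>n. L2_inner \<Gamma> (u n - f) (u n - f)) \<longlonglongrightarrow> (\<Sum>j\<in>edges \<Gamma>. 0)"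
    unfolding L2_inner_def using f(3) by (intro tendsto_sum) (simp add: power2_norm_eq_inner)
  ultimately show ?thesis by auto
qed

section \<open>Coefficients and cut-off functions on an edge\<close>

lemma has_vector_derivative_iff_slope:
  "(f has_vector_derivative f') (at x within S) \<longleftrightarrow>
     ((\<lambda>y. (1 / (y - x)) *\<^sub>R (f y - f x)) \<longlongrightarrow> f') (at x within S)"
proof -
  have "(f has_vector_derivative f') (at x within S) \<longleftrightarrow>
      ((\<lambda>y. norm (f y - f x - (y - x) *\<^sub>R f') / norm (y - x)) \<longlongrightarrow> 0) (at x within S)"
    by (simp add: has_vector_derivative_def has_derivative_iff_norm bounded_linear_scaleR_left)
  also have "\<dots> \<longleftrightarrow> ((\<lambda>y. norm ((1 / (y - x)) *\<^sub>R (f y - f x) - f')) \<longlongrightarrow> 0) (at x within S)"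
  proof (rule filterlim_cong[OF refl refl])
    have "norm (f y - f x - (y - x) *\<^sub>R f') / norm (y - x) = norm ((1 / (y - x)) *\<^sub>R (f y - f x) - f')"
      if "y \<noteq> x" for y
    proof -
      have "f y - f x - (y - x) *\<^sub>R f' = (y - x) *\<^sub>R ((1 / (y - x)) *\<^sub>R (f y - f x) - f')"
        using that by (simp add: scaleR_diff_right)
      then have "norm (f y - f x - (y - x) *\<^sub>R f') = norm (y - x) * norm ((1 / (y - x)) *\<^sub>R (f y - f x) - f')"
        by (metis norm_scaleR real_norm_def)
      then show ?thesis using that by simp
    qed
    then show "\<forall>\<^sub>F y in at x within S. norm (f y - f x - (y - x) *\<^sub>R f') / norm (y - x)
        = norm ((1 / (y - x)) *\<^sub>R (f y - f x) - f')"
      by (simp add: eventually_at_filter)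
  qed
  also have "\<dots> \<longleftrightarrow> ((\<lambda>y. (1 / (y - x)) *\<^sub>R (f y - f x)) \<longlongrightarrow> f') (at x within S)"
    by (simp add: tendsto_norm_zero_iff LIM_zero_iff)
  finally show ?thesis .
qed

lemma bounded_bilinear_matrix_mult:
  "bounded_bilinear (\<lambda>(A::real^'n^'n) (B::real^'n^'n). A ** B)"
  unfolding bilinear_conv_bounded_bilinear[symmetric] bilinear_def
  by (auto intro!: linearI simp: vec_eq_iff matrix_matrix_mult_def sum_distrib_left sum.distrib algebra_simps)

lemma bounded_bilinear_matrix_vector_mult:
  "bounded_bilinear (\<lambda>(A::real^'n^'m) (x::real^'n). A *v x)"
  unfolding bilinear_conv_bounded_bilinear[symmetric] bilinear_def
  by (auto intro!: linearI simp: vec_eq_iff matrix_vector_mult_def sum_distrib_left sum.distrib algebra_simps)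

interpretation matmul: bounded_bilinear "\<lambda>(A::real^'n^'n) (B::real^'n^'n). A ** B"
  by (rule bounded_bilinear_matrix_mult)

interpretation matvec: bounded_bilinear "\<lambda>(A::real^'n^'m) (x::real^'n). A *v x"
  by (rule bounded_bilinear_matrix_vector_mult)

text \<open>A resolvent identity, which reduces continuity and differentiability of an inverse to
  those of the matrix itself.\<close>

lemma inverse_matrix_difference:
  fixes A A' B B' :: "real^'n^'n"
  assumes "B ** A = mat 1" "A' ** B' = mat 1"
  shows "B - B' = - (B ** ((A - A') ** B'))"
proof -
  have "B ** ((A - A') ** B') = (B ** A) ** B' - B ** (A' ** B')"
    by (simp add: matmul.diff_left matmul.diff_right matrix_mul_assoc)
  then show ?thesis using assms by simp
qed

text \<open>The resolvent identity bounds \<open>B t - B x\<close> by a small multiple of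
  \<open>norm (B t)\<close>; once the factor is below 1/2, that norm is absorbed and
  \<open>B\<close> is locally bounded, which turns the estimate into convergence.\<close>

lemma continuous_matrix_inverse:
  fixes A B :: "real \<Rightarrow> real^'n^'n"
  assumes inv: "\<And>t. t \<in> S \<Longrightarrow> A t ** B t = mat 1" "\<And>t. t \<in> S \<Longrightarrow> B t ** A t = mat 1"
    and x: "x \<in> S" and A: "(A \<longlongrightarrow> A x) (at x within S)"
  shows "(B \<longlongrightarrow> B x) (at x within S)"
proof -
  obtain c where c: "c > 0" "\<And>(X::real^'n^'n) (Y::real^'n^'n). norm (X ** Y) \<le> norm X * norm Y * c"
    using matmul.pos_bounded by blast
  define k where "k = c * c * norm (B x)"
  have k: "0 \<le> k" using c by (simp add: k_def)
  have step: "norm (B t - B x) \<le> norm (B t) * (norm (A t - A x) * k)" if "t \<in> S" for t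
  proof -
    have "norm (B t - B x) = norm (B t ** ((A t - A x) ** B x))"
      using inverse_matrix_difference[OF inv(2)[OF that] inv(1)[OF x]] by simp
    also have "\<dots> \<le> norm (B t) * norm ((A t - A x) ** B x) * c" by (rule c)
    also have "\<dots> \<le> norm (B t) * (norm (A t - A x) * norm (B x) * c) * c"
      using c by (intro mult_right_mono mult_left_mono) auto
    finally show ?thesis by (simp add: k_def algebra_simps)
  qed
  have lim: "((\<lambda>t. norm (A t - A x) * k) \<longlongrightarrow> 0) (at x within S)"
    using A by (intro tendsto_mult_left_zero) (simp add: tendsto_norm_zero_iff LIM_zero_iff)
  then have small: "\<forall>\<^sub>F t in at x within S. norm (A t - A x) * k < 1/2"
    by (rule order_tendstoD) simp
  have "\<forall>\<^sub>F t in at x within S. norm (B t - B x) \<le> 2 * norm (B x) * (norm (A t - A x) * k)"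
    using small eventually_at_filter[of "\<lambda>t. t \<in> S" x S, simplified]
  proof eventually_elim
    case (elim t)
    then have tS: "t \<in> S" by (simp add: eventually_at_filter)
    have "norm (B t) \<le> norm (B x) + norm (B t - B x)" by (metis add.commute diff_add_cancel norm_triangle_ineq)
    also have "norm (B t - B x) \<le> norm (B t) * (1/2)"
      using step[OF tS] elim(1) by (smt (verit) mult_left_mono norm_ge_zero)
    finally have "norm (B t) \<le> 2 * norm (B x)" by simp
    then have "norm (B t) * (norm (A t - A x) * k) \<le> 2 * norm (B x) * (norm (A t - A x) * k)"
      using k by (intro mult_right_mono) auto
    then show ?case using step[OF tS] by linarith
  qed
  moreover have "((\<lambda>t. 2 * norm (B x) * (norm (A t - A x) * k)) \<longlongrightarrow> 0) (at x within S)"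
    using tendsto_mult_right_zero[OF lim] by simp
  ultimately have "((\<lambda>t. B t - B x) \<longlongrightarrow> 0) (at x within S)"
    by (rule Lim_null_comparison)
  then show ?thesis by (simp add: LIM_zero_iff)
qed

text \<open>Up to sign, the difference quotient of \<open>B\<close> is the product of
  \<open>B t\<close>, the quotient of \<open>A\<close> and \<open>B x\<close>. It is used with
  \<open>B\<close> equal to P and \<open>A\<close> to its inverse, since the C^1 hypothesis is on
  the inverse.\<close>

lemma has_vector_derivative_matrix_inverse:
  fixes A B :: "real \<Rightarrow> real^'n^'n"
  assumes inv: "\<And>t. t \<in> S \<Longrightarrow> A t ** B t = mat 1" "\<And>t. t \<in> S \<Longrightarrow> B t ** A t = mat 1"
    and x: "x \<in> S" and A: "(A has_vector_derivative A') (at x within S)"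
  shows "(B has_vector_derivative - (B x ** (A' ** B x))) (at x within S)"
  unfolding has_vector_derivative_iff_slope
proof -
  have contA: "(A \<longlongrightarrow> A x) (at x within S)"
    using has_vector_derivative_continuous[OF A] by (simp add: continuous_within)
  note contB = continuous_matrix_inverse[OF inv x contA]
  have slope: "((\<lambda>t. (1 / (t - x)) *\<^sub>R (A t - A x)) \<longlongrightarrow> A') (at x within S)"
    using A by (simp add: has_vector_derivative_iff_slope)
  have "((\<lambda>t. - (B t ** (((1 / (t - x)) *\<^sub>R (A t - A x)) ** B x))) \<longlongrightarrow> - (B x ** (A' ** B x))) (at x within S)"
    by (intro tendsto_minus matmul.tendsto contB slope tendsto_const)
  moreover have "\<forall>\<^sub>F t in at x within S. - (B t ** (((1 / (t - x)) *\<^sub>R (A t - A x)) ** B x)) = (1 / (t - x)) *\<^sub>R (B t - B x)"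
  proof -
    have "- (B t ** (((1 / (t - x)) *\<^sub>R (A t - A x)) ** B x)) = (1 / (t - x)) *\<^sub>R (B t - B x)" if "t \<in> S" for t
      using inverse_matrix_difference[OF inv(2)[OF that] inv(1)[OF x]]
      by (simp add: matmul.scaleR_left matmul.scaleR_right)
    then show ?thesis by (simp add: eventually_at_filter)
  qed
  ultimately show "((\<lambda>t. (1 / (t - x)) *\<^sub>R (B t - B x)) \<longlongrightarrow> - (B x ** (A' ** B x))) (at x within S)"
    by (rule Lim_transform_eventually)
qed

lemma positive_definite_matrix_inv:
  assumes "positive_definite_matrix A"
  shows "A ** matrix_inv A = mat 1" "matrix_inv A ** A = mat 1"
proof -
  have "x = 0" if "A *v x = 0" for x
    using assms that unfolding positive_definite_matrix_def by (metis inner_zero_right less_irrefl)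
  then have "invertible A"
    using matrix_left_invertible_ker[of A] invertible_left_inverse by blast
  then have "A ** matrix_inv A = mat 1 \<and> matrix_inv A ** A = mat 1"
    unfolding invertible_def matrix_inv_def by (rule someI_ex)
  then show "A ** matrix_inv A = mat 1" "matrix_inv A ** A = mat 1" by blast+
qed

section \<open>Truncated powers and cut-off functions\<close>

lemma has_real_derivative_max_0_power2:
  "((\<lambda>x. (max 0 x)\<^sup>2) has_real_derivative 2 * max 0 x) (at (x::real))"
proof -
  consider "x > 0" | "x < 0" | "x = 0" by linarith
  then show ?thesis
  proof cases
    case 1
    have "((\<lambda>x. x\<^sup>2) has_real_derivative 2 * x) (at x)" by (auto intro!: derivative_eq_intros)
    then have "((\<lambda>x. (max 0 x)\<^sup>2) has_real_derivative 2 * x) (at x)"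
      by (rule has_field_derivative_transform_within_open[of _ _ _ "{0<..}"]) (use 1 in auto)
    then show ?thesis using 1 by simp
  next
    case 2
    have "((\<lambda>x. 0) has_real_derivative 0) (at x)" by simp
    then have "((\<lambda>x. (max 0 x)\<^sup>2) has_real_derivative 0) (at x)"
      by (rule has_field_derivative_transform_within_open[of _ _ _ "{..<0}"]) (use 2 in auto)
    then show ?thesis using 2 by simp
  next
    case 3
    have "((\<lambda>h::real. max 0 h) \<longlongrightarrow> max 0 0) (at 0)" by (intro tendsto_intros)
    then have "((\<lambda>h::real. (max 0 h)\<^sup>2 / h) \<longlongrightarrow> 0) (at 0)"
      by (intro Lim_transform_eventually[of "\<lambda>h. max 0 h" 0 "at 0" "\<lambda>h. (max 0 h)\<^sup>2 / h"])
         (auto simp: eventually_at_filter max_def power2_eq_square)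
    then show ?thesis using 3 by (simp add: DERIV_def)
  qed
qed

lemma has_real_derivative_max_0_power3:
  "((\<lambda>x. (max 0 x)^3) has_real_derivative 3 * (max 0 x)\<^sup>2) (at (x::real))"
proof -
  have e: "(max 0 y)^3 = y * (max 0 y)\<^sup>2" for y :: real by (simp add: max_def power3_eq_cube power2_eq_square)
  have "((\<lambda>y. y * (max 0 y)\<^sup>2) has_real_derivative 1 * (max 0 x)\<^sup>2 + (2 * max 0 x) * x) (at x)"
    by (intro DERIV_mult DERIV_ident has_real_derivative_max_0_power2)
  moreover have "1 * (max 0 x)\<^sup>2 + (2 * max 0 x) * x = 3 * (max 0 x)\<^sup>2" by (simp add: max_def power2_eq_square)
  ultimately show ?thesis unfolding e by (simp only:)
qed

text \<open>Each differentiation lowers the exponent by one, so \<open>cutoff 3\<close> has two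
  continuous derivatives. At 0 the value is 1 and the slope 0, so a factor \<open>cutoff 3\<close>
  preserves value and slope there.\<close>

definition cutoff :: "nat \<Rightarrow> real \<Rightarrow> real" where
  "cutoff n s = (max 0 (1 - s\<^sup>2))^n"

lemma cutoff_deriv3: "(cutoff 3 has_real_derivative - 6 * s * cutoff 2 s) (at s)"
proof -
  have "((\<lambda>s. (max 0 (1 - s\<^sup>2))^3) has_real_derivative 3 * (max 0 (1 - s\<^sup>2))\<^sup>2 * (- (2 * s))) (at s)"
    by (rule DERIV_chain2[OF has_real_derivative_max_0_power3]) (auto intro!: derivative_eq_intros)
  then show ?thesis by (simp add: cutoff_def[abs_def] algebra_simps)
qed

lemma cutoff_deriv2: "(cutoff 2 has_real_derivative - 4 * s * cutoff 1 s) (at s)"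
proof -
  have "((\<lambda>s. (max 0 (1 - s\<^sup>2))\<^sup>2) has_real_derivative 2 * (max 0 (1 - s\<^sup>2)) * (- (2 * s))) (at s)"
    by (rule DERIV_chain2[OF has_real_derivative_max_0_power2]) (auto intro!: derivative_eq_intros)
  then show ?thesis by (simp add: cutoff_def[abs_def] algebra_simps)
qed

lemma cutoff_bounds: "0 \<le> cutoff n s" "cutoff n s \<le> 1"
  by (auto simp: cutoff_def intro!: power_le_one)

lemma cutoff_eq_0: "1 \<le> \<bar>s\<bar> \<Longrightarrow> 0 < n \<Longrightarrow> cutoff n s = 0"
  using abs_le_square_iff[of 1 s] by (simp add: cutoff_def)

lemma continuous_cutoff: "continuous_on A f \<Longrightarrow> continuous_on A (\<lambda>t. cutoff n (f t))"
  unfolding cutoff_def by (intro continuous_intros)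

text \<open>A \<open>C\<^sup>2\<close> function with value \<open>x\<close> and derivative \<open>y\<close> at \<open>e\<close>, supported in \<open>[e - \<delta>, e + \<delta>]\<close>.\<close>
definition bump :: "real \<Rightarrow> real \<Rightarrow> real^'d \<Rightarrow> real^'d \<Rightarrow> real \<Rightarrow> real^'d" where
  "bump e \<delta> x y t = cutoff 3 ((t - e) / \<delta>) *\<^sub>R (x + (t - e) *\<^sub>R y)"

definition bump' :: "real \<Rightarrow> real \<Rightarrow> real^'d \<Rightarrow> real^'d \<Rightarrow> real \<Rightarrow> real^'d" where
  "bump' e \<delta> x y t = (- 6 * ((t - e) / \<delta>) * cutoff 2 ((t - e) / \<delta>) / \<delta>) *\<^sub>R (x + (t - e) *\<^sub>R y)
     + cutoff 3 ((t - e) / \<delta>) *\<^sub>R y"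

text \<open>The coefficient 24 is 6 * 4, the 4 coming from \<open>cutoff_deriv2\<close>; 12 is 6 +
  6, one part from each summand of \<open>bump'\<close>.\<close>

definition bump'' :: "real \<Rightarrow> real \<Rightarrow> real^'d \<Rightarrow> real^'d \<Rightarrow> real \<Rightarrow> real^'d" where
  "bump'' e \<delta> x y t =
     ((- 6 * cutoff 2 ((t - e) / \<delta>) + 24 * ((t - e) / \<delta>)\<^sup>2 * cutoff 1 ((t - e) / \<delta>)) / \<delta>\<^sup>2) *\<^sub>R (x + (t - e) *\<^sub>R y)
     + (- 12 * ((t - e) / \<delta>) * cutoff 2 ((t - e) / \<delta>) / \<delta>) *\<^sub>R y"

lemma bump_deriv:
  assumes "0 < \<delta>"
  shows "(bump e \<delta> x y has_vector_derivative bump' e \<delta> x y t) (at t within S)"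
proof -
  let ?s = "(t - e) / \<delta>"
  have s: "((\<lambda>t. (t - e) / \<delta>) has_real_derivative 1 / \<delta>) (at t)" using assms by (auto intro!: derivative_eq_intros)
  have c: "((\<lambda>t. cutoff 3 ((t - e) / \<delta>)) has_real_derivative - 6 * ?s * cutoff 2 ?s / \<delta>) (at t)"
    using DERIV_chain2[OF cutoff_deriv3 s] by simp
  have v: "((\<lambda>t. x + (t - e) *\<^sub>R y) has_vector_derivative y) (at t)"
    by (auto intro!: derivative_eq_intros)
  have "((\<lambda>t. cutoff 3 ((t - e) / \<delta>) *\<^sub>R (x + (t - e) *\<^sub>R y)) has_vector_derivative
      cutoff 3 ?s *\<^sub>R y + (- 6 * ?s * cutoff 2 ?s / \<delta>) *\<^sub>R (x + (t - e) *\<^sub>R y)) (at t)"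
    by (rule has_vector_derivative_scaleR[OF c v])
  then have "(bump e \<delta> x y has_vector_derivative bump' e \<delta> x y t) (at t)"
    by (simp add: bump_def[abs_def] bump'_def add.commute)
  then show ?thesis by (rule has_vector_derivative_at_within)
qed

lemma bump'_deriv:
  assumes "0 < \<delta>"
  shows "(bump' e \<delta> x y has_vector_derivative bump'' e \<delta> x y t) (at t within S)"
proof -
  let ?s = "(t - e) / \<delta>"
  have s: "((\<lambda>t. (t - e) / \<delta>) has_real_derivative 1 / \<delta>) (at t)" using assms by (auto intro!: derivative_eq_intros)
  have c3: "((\<lambda>t. cutoff 3 ((t - e) / \<delta>)) has_real_derivative - 6 * ?s * cutoff 2 ?s / \<delta>) (at t)"
    using DERIV_chain2[OF cutoff_deriv3 s] by simp
  have c2: "((\<lambda>t. cutoff 2 ((t - e) / \<delta>)) has_real_derivative - 4 * ?s * cutoff 1 ?s / \<delta>) (at t)"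
    using DERIV_chain2[OF cutoff_deriv2 s] by simp
  have c: "((\<lambda>t. - 6 * ((t - e) / \<delta>) * cutoff 2 ((t - e) / \<delta>) / \<delta>) has_real_derivative
      (- 6 * cutoff 2 ?s + 24 * ?s\<^sup>2 * cutoff 1 ?s) / \<delta>\<^sup>2) (at t)"
    using assms by (auto intro!: derivative_eq_intros s c2 simp: field_simps power2_eq_square)
  have v: "((\<lambda>t. x + (t - e) *\<^sub>R y) has_vector_derivative y) (at t)"
    by (auto intro!: derivative_eq_intros)
  have "((\<lambda>t. (- 6 * ((t - e) / \<delta>) * cutoff 2 ((t - e) / \<delta>) / \<delta>) *\<^sub>R (x + (t - e) *\<^sub>R y)
       + cutoff 3 ((t - e) / \<delta>) *\<^sub>R y) has_vector_derivative
      ((- 6 * ?s * cutoff 2 ?s / \<delta>) *\<^sub>R y + ((- 6 * cutoff 2 ?s + 24 * ?s\<^sup>2 * cutoff 1 ?s) / \<delta>\<^sup>2) *\<^sub>R (x + (t - e) *\<^sub>R y))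
       + (cutoff 3 ?s *\<^sub>R 0 + (- 6 * ?s * cutoff 2 ?s / \<delta>) *\<^sub>R y)) (at t)"
    by (intro has_vector_derivative_add has_vector_derivative_scaleR[OF c v]
          has_vector_derivative_scaleR[OF c3 has_vector_derivative_const])
  moreover have "((- 6 * ?s * cutoff 2 ?s / \<delta>) *\<^sub>R y + ((- 6 * cutoff 2 ?s + 24 * ?s\<^sup>2 * cutoff 1 ?s) / \<delta>\<^sup>2) *\<^sub>R (x + (t - e) *\<^sub>R y))
       + (cutoff 3 ?s *\<^sub>R 0 + (- 6 * ?s * cutoff 2 ?s / \<delta>) *\<^sub>R y) = bump'' e \<delta> x y t"
  proof -
    have "(- 12 * ?s * cutoff 2 ?s / \<delta>) *\<^sub>R y = (- 6 * ?s * cutoff 2 ?s / \<delta>) *\<^sub>R y + (- 6 * ?s * cutoff 2 ?s / \<delta>) *\<^sub>R y"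
      by (simp flip: scaleR_add_left)
    then show ?thesis unfolding bump''_def by (simp only: scaleR_zero_right add_0_left add.assoc add.left_commute add.commute)
  qed
  ultimately have "(bump' e \<delta> x y has_vector_derivative bump'' e \<delta> x y t) (at t)"
    unfolding bump'_def[abs_def] by simp
  then show ?thesis by (rule has_vector_derivative_at_within)
qed

lemma continuous_bump:
  assumes "0 < \<delta>"
  shows "continuous_on A (bump e \<delta> x y)" "continuous_on A (bump' e \<delta> x y)" "continuous_on A (bump'' e \<delta> x y)"
proof -
  show "continuous_on A (bump'' e \<delta> x y)"
    unfolding bump''_def[abs_def] using assms by (intro continuous_intros continuous_cutoff) auto
  show "continuous_on A (bump e \<delta> x y)" "continuous_on A (bump' e \<delta> x y)"
    unfolding continuous_on_eq_continuous_within
    using has_vector_derivative_continuous[OF bump_deriv[OF assms]]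
      has_vector_derivative_continuous[OF bump'_deriv[OF assms]] by blast+
qed

lemma bump_eq_0:
  assumes "0 < \<delta>" "\<delta> \<le> \<bar>t - e\<bar>"
  shows "bump e \<delta> x y t = 0" "bump' e \<delta> x y t = 0" "bump'' e \<delta> x y t = 0"
proof -
  have "1 \<le> \<bar>(t - e) / \<delta>\<bar>" using assms by (simp add: abs_divide)
  then show "bump e \<delta> x y t = 0" "bump' e \<delta> x y t = 0" "bump'' e \<delta> x y t = 0"
    by (simp_all add: bump_def bump'_def bump''_def cutoff_eq_0)
qed

lemma bump_at [simp]: "bump e \<delta> x y e = x" "bump' e \<delta> x y e = y"
  by (simp_all add: bump_def bump'_def cutoff_def)

text \<open>For end value 0 the factor \<open>1 / \<delta>\<close> of the differentiated cut-off is
  cancelled by \<open>\<bar>t - e\<bar> \<le> \<delta>\<close>, so the derivative is bounded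
  independently of \<delta>, with constant 6 + 1. Over an interval of length \<delta> the energy is
  then O(\<delta>).\<close>

lemma bump_bounds:
  assumes "0 < \<delta>" "\<bar>t - e\<bar> \<le> \<delta>"
  shows "norm (bump e \<delta> 0 y t) \<le> \<delta> * norm y" "norm (bump' e \<delta> 0 y t) \<le> 7 * norm y"
proof -
  let ?s = "(t - e) / \<delta>"
  have s: "\<bar>?s\<bar> \<le> 1" using assms by (simp add: abs_divide)
  have "norm (bump e \<delta> 0 y t) = cutoff 3 ?s * \<bar>t - e\<bar> * norm y"
    using cutoff_bounds(1)[of 3 ?s] by (simp add: bump_def abs_mult del: mult_cancel_right)
  also have "\<dots> \<le> 1 * \<delta> * norm y"
    using assms cutoff_bounds[of 3 ?s] by (intro mult_right_mono mult_mono) auto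
  finally show "norm (bump e \<delta> 0 y t) \<le> \<delta> * norm y" by simp
  have k: "(- 6 * ?s * cutoff 2 ?s / \<delta>) * (t - e) = - 6 * ?s\<^sup>2 * cutoff 2 ?s"
    by (simp add: power2_eq_square algebra_simps)
  have "bump' e \<delta> 0 y t = ((- 6 * ?s * cutoff 2 ?s / \<delta>) * (t - e)) *\<^sub>R y + cutoff 3 ?s *\<^sub>R y"
    by (simp only: bump'_def add_0_left scaleR_scaleR)
  then have "bump' e \<delta> 0 y t = (- 6 * ?s\<^sup>2 * cutoff 2 ?s + cutoff 3 ?s) *\<^sub>R y"
    unfolding k by (simp only: scaleR_add_left)
  moreover have "\<bar>- 6 * ?s\<^sup>2 * cutoff 2 ?s + cutoff 3 ?s\<bar> \<le> 7"
  proof -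
    have "?s\<^sup>2 \<le> 1" using s abs_square_le_1 by blast
    then have "?s\<^sup>2 * cutoff 2 ?s \<le> 1" "0 \<le> ?s\<^sup>2 * cutoff 2 ?s"
      using cutoff_bounds[of 2 ?s] mult_mono[of "?s\<^sup>2" 1 "cutoff 2 ?s" 1] by auto
    then show ?thesis using cutoff_bounds[of 3 ?s] by (simp add: abs_le_iff mult.assoc)
  qed
  ultimately show "norm (bump' e \<delta> 0 y t) \<le> 7 * norm y"
    by (simp add: mult_right_mono)
qed

section \<open>Green's formula\<close>

lemma edge_interval_convex: "s \<in> edge_interval \<Gamma> j \<Longrightarrow> t \<in> edge_interval \<Gamma> j \<Longrightarrow> {s..t} \<subseteq> edge_interval \<Gamma> j"
proof
  fix x assume st: "s \<in> edge_interval \<Gamma> j" "t \<in> edge_interval \<Gamma> j" and "x \<in> {s..t}"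
  then have "ereal s \<le> ereal x" "ereal x \<le> ereal t" by simp_all
  then show "x \<in> edge_interval \<Gamma> j"
    using st unfolding edge_interval_def mem_Collect_eq by (metis order_trans)
qed

lemma is_interval_edge_interval: "is_interval (edge_interval \<Gamma> j)"
  unfolding is_interval_1
proof (intro ballI allI impI)
  fix a b x assume "a \<in> edge_interval \<Gamma> j" "b \<in> edge_interval \<Gamma> j" "a \<le> x \<and> x \<le> b"
  then show "x \<in> edge_interval \<Gamma> j" using edge_interval_convex[of a \<Gamma> j b] by auto
qed

lemma closed_edge_interval: "closed (edge_interval \<Gamma> j)"
  unfolding edge_interval_def
  by (intro closed_Collect_conj closed_Collect_le continuous_intros)

lemma lebesgue_edge_interval: "edge_interval \<Gamma> j \<in> sets lebesgue"
  using borel_closed[OF closed_edge_interval[of \<Gamma> j]] by (intro sets_completionI_sets) simp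

text \<open>Edges have positive length; hence derivatives within an edge are unique, also one-sided
  ones at the ends, and \<open>vector_derivative\<close> returns them.\<close>

lemma at_within_edge_interval:
  assumes "is_metric_graph \<Gamma>" "j \<in> edges \<Gamma>" "t \<in> edge_interval \<Gamma> j"
  shows "at t within edge_interval \<Gamma> j \<noteq> bot"
proof -
  have "left_end \<Gamma> j < right_end \<Gamma> j" using assms by (simp add: is_metric_graph_def)
  then obtain z where z: "left_end \<Gamma> j < ereal z" "ereal z < right_end \<Gamma> j" using ereal_dense2 by blast
  then obtain z' where z': "left_end \<Gamma> j < ereal z'" "ereal z' < ereal z" using ereal_dense2 by blast
  have "ereal z' \<le> right_end \<Gamma> j" using z'(2) z(2) by (metis less_imp_le order_trans)
  then have "z \<in> edge_interval \<Gamma> j" "z' \<in> edge_interval \<Gamma> j" "z \<noteq> z'"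
    using z z' by (auto simp: edge_interval_def)
  then have ne: "\<And>x. edge_interval \<Gamma> j \<noteq> {x}" by (metis singletonD)
  have "t islimpt edge_interval \<Gamma> j"
    using connected_imp_perfect[OF is_interval_connected[OF is_interval_edge_interval] assms(3) ne] .
  then show ?thesis by (simp add: trivial_limit_within)
qed

lemma edge_deriv_eq:
  assumes "is_metric_graph \<Gamma>" "j \<in> edges \<Gamma>" "t \<in> edge_interval \<Gamma> j"
    "(f j has_vector_derivative d) (at t within edge_interval \<Gamma> j)"
  shows "edge_deriv \<Gamma> f j t = d"
  unfolding edge_deriv_def using at_within_edge_interval[OF assms(1-3)] assms(4) by (rule vector_derivative_within)

lemma finite_edges: "is_metric_graph \<Gamma> \<Longrightarrow> finite (edges \<Gamma>)"
  unfolding is_metric_graph_def edges_def using fin_digraph.finite_arcs by blast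

lemma finite_ends_subset:
  "is_metric_graph \<Gamma> \<Longrightarrow> j \<in> edges \<Gamma> \<Longrightarrow> finite_ends \<Gamma> j \<subseteq> edge_interval \<Gamma> j"
  unfolding is_metric_graph_def finite_ends_def edge_interval_def by (auto simp: less_imp_le)

lemma finite_finite_ends: "finite (finite_ends \<Gamma> j)"
proof -
  have "finite_ends \<Gamma> j \<subseteq> {real_of_ereal (left_end \<Gamma> j), real_of_ereal (right_end \<Gamma> j)}"
    unfolding finite_ends_def by (auto, metis real_of_ereal.simps(1), metis real_of_ereal.simps(1))
  then show ?thesis by (rule finite_subset) simp
qed

text \<open>The factor 2 leaves the \<delta>-neighbourhoods of the two ends of an edge with at most
  one common point, where the bumps vanish.\<close>

definition small :: "('v, 'e) metric_graph \<Rightarrow> real \<Rightarrow> bool" where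
  "small \<Gamma> \<delta> \<longleftrightarrow> 0 < \<delta> \<and> (\<forall>j\<in>edges \<Gamma>. \<forall>e.
     (left_end \<Gamma> j = ereal e \<longrightarrow> ereal (e + 2 * \<delta>) \<le> right_end \<Gamma> j) \<and>
     (right_end \<Gamma> j = ereal e \<longrightarrow> left_end \<Gamma> j \<le> ereal (e - 2 * \<delta>)))"

lemma eventually_small:
  assumes "is_metric_graph \<Gamma>"
  shows "\<forall>\<^sub>F \<delta> in at_right 0. small \<Gamma> \<delta>"
proof -
  have "\<forall>\<^sub>F \<delta> in at_right 0.
      (\<forall>e. (left_end \<Gamma> j = ereal e \<longrightarrow> ereal (e + 2 * \<delta>) \<le> right_end \<Gamma> j) \<and>
           (right_end \<Gamma> j = ereal e \<longrightarrow> left_end \<Gamma> j \<le> ereal (e - 2 * \<delta>)))" if j: "j \<in> edges \<Gamma>" for j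
  proof -
    have "left_end \<Gamma> j < right_end \<Gamma> j" using assms j by (simp add: is_metric_graph_def)
    then obtain z where z: "left_end \<Gamma> j < ereal z" "ereal z < right_end \<Gamma> j" using ereal_dense2 by blast
    obtain d where d: "0 < d" "\<And>e. left_end \<Gamma> j = ereal e \<Longrightarrow> e + 2 * d \<le> z" "\<And>e. right_end \<Gamma> j = ereal e \<Longrightarrow> z \<le> e - 2 * d"
    proof
      \<comment> \<open>Half the distance from a finite end to the interior point \<open>z\<close>;
        an infinite end imposes no bound and gets the default 1.\<close>
      define a where "a = (if \<bar>left_end \<Gamma> j\<bar> = \<infinity> then 1 else (z - real_of_ereal (left_end \<Gamma> j)) / 2)"
      define b where "b = (if \<bar>right_end \<Gamma> j\<bar> = \<infinity> then 1 else (real_of_ereal (right_end \<Gamma> j) - z) / 2)"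
      show "0 < min a b" using z unfolding a_def b_def
        by (cases "left_end \<Gamma> j"; cases "right_end \<Gamma> j") auto
      show "e + 2 * min a b \<le> z" if "left_end \<Gamma> j = ereal e" for e
        using that by (auto simp: a_def min_def field_simps)
      show "z \<le> e - 2 * min a b" if "right_end \<Gamma> j = ereal e" for e
        using that by (auto simp: b_def min_def field_simps)
    qed
    have "\<forall>\<^sub>F \<delta> in at_right 0. \<delta> \<in> {0<..<d}" using d(1) by (rule eventually_at_right_real)
    then show ?thesis
    proof eventually_elim
      case (elim \<delta>)
      show ?case
      proof (intro allI conjI impI)
        fix e assume "left_end \<Gamma> j = ereal e"
        then have "e + 2 * \<delta> \<le> z" using d(2)[of e] elim by auto
        then have "ereal (e + 2 * \<delta>) \<le> ereal z" by simp
        then show "ereal (e + 2 * \<delta>) \<le> right_end \<Gamma> j" using z(2) by (meson less_imp_le order_trans)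
      next
        fix e assume "right_end \<Gamma> j = ereal e"
        then have "z \<le> e - 2 * \<delta>" using d(3)[of e] elim by auto
        then have "ereal z \<le> ereal (e - 2 * \<delta>)" by simp
        then show "left_end \<Gamma> j \<le> ereal (e - 2 * \<delta>)" using z(1) by (meson less_imp_le order_trans)
      qed
    qed
  qed
  then have "\<forall>\<^sub>F \<delta> in at_right 0. \<forall>j\<in>edges \<Gamma>. \<forall>e.
      (left_end \<Gamma> j = ereal e \<longrightarrow> ereal (e + 2 * \<delta>) \<le> right_end \<Gamma> j) \<and>
      (right_end \<Gamma> j = ereal e \<longrightarrow> left_end \<Gamma> j \<le> ereal (e - 2 * \<delta>))"
    using finite_edges[OF assms] by (intro eventually_ball_finite) auto
  then show ?thesis
    using eventually_at_right_less[of "0::real"]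
    by eventually_elim (simp add: small_def)
qed

text \<open>The sign with which the end value enters the integral of \<open>- u' \<bullet> g\<close>
  after integration by parts.\<close>

definition end_sign :: "('v, 'e) metric_graph \<Rightarrow> 'e \<Rightarrow> real \<Rightarrow> real" where
  "end_sign \<Gamma> j e = (if left_end \<Gamma> j = ereal e then 1 else -1)"

definition end_interval :: "('v, 'e) metric_graph \<Rightarrow> 'e \<Rightarrow> real \<Rightarrow> real \<Rightarrow> real set" where
  "end_interval \<Gamma> j e \<delta> = (if left_end \<Gamma> j = ereal e then {e..e + \<delta>} else {e - \<delta>..e})"

lemma end_interval:
  assumes "is_metric_graph \<Gamma>" "j \<in> edges \<Gamma>" "e \<in> finite_ends \<Gamma> j" "small \<Gamma> \<delta>"
  shows "end_interval \<Gamma> j e \<delta> = {t \<in> edge_interval \<Gamma> j. \<bar>t - e\<bar> \<le> \<delta>}"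
proof (cases "left_end \<Gamma> j = ereal e")
  case True
  have "ereal (e + 2 * \<delta>) \<le> right_end \<Gamma> j" "0 < \<delta>" using assms(2,4) True unfolding small_def by blast+
  then have "ereal t \<le> right_end \<Gamma> j" if "t \<le> e + \<delta>" for t
    using that by (intro order_trans[OF _ \<open>ereal (e + 2 * \<delta>) \<le> right_end \<Gamma> j\<close>]) simp
  then show ?thesis using True by (auto simp: end_interval_def edge_interval_def)
next
  case False
  then have r: "right_end \<Gamma> j = ereal e" using assms(3) by (auto simp: finite_ends_def)
  have "left_end \<Gamma> j \<le> ereal (e - 2 * \<delta>)" "0 < \<delta>" using assms(2,4) r unfolding small_def by blast+
  then have "left_end \<Gamma> j \<le> ereal t" if "e - \<delta> \<le> t" for t
    using that by (intro order_trans[OF \<open>left_end \<Gamma> j \<le> ereal (e - 2 * \<delta>)\<close>]) simp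
  then show ?thesis using False r by (auto simp: end_interval_def edge_interval_def)
qed

lemma finite_ends_apart:
  assumes "j \<in> edges \<Gamma>" "e \<in> finite_ends \<Gamma> j" "e' \<in> finite_ends \<Gamma> j" "e \<noteq> e'" "small \<Gamma> \<delta>"
  shows "2 * \<delta> \<le> \<bar>e - e'\<bar>"
proof -
  have sm: "left_end \<Gamma> j = ereal a \<Longrightarrow> ereal (a + 2 * \<delta>) \<le> right_end \<Gamma> j" for a
    using assms(1,5) unfolding small_def by blast
  consider "ereal e = left_end \<Gamma> j" "ereal e' = right_end \<Gamma> j" | "ereal e' = left_end \<Gamma> j" "ereal e = right_end \<Gamma> j"
    using assms(2-4) unfolding finite_ends_def by (smt (verit) ereal.inject mem_Collect_eq)
  then show ?thesis
  proof cases
    case 1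
    then have "ereal (e + 2 * \<delta>) \<le> ereal e'" using sm[of e] by simp
    then show ?thesis by simp
  next
    case 2
    then have "ereal (e' + 2 * \<delta>) \<le> ereal e" using sm[of e'] by simp
    then show ?thesis by simp
  qed
qed

text \<open>Cut off outside the edge because elements of \<open>W22\<close> are normalized to vanish
  there.\<close>

definition end_bump ::
  "('v, 'e) metric_graph \<Rightarrow> 'e \<Rightarrow> real \<Rightarrow> real \<Rightarrow> real^'d \<Rightarrow> real^'d \<Rightarrow> 'e \<Rightarrow> real \<Rightarrow> real^'d" where
  "end_bump \<Gamma> j e \<delta> x y i t = (if i = j \<and> t \<in> edge_interval \<Gamma> j then bump e \<delta> x y t else 0)"

lemma square_integrable_on_compact_support:
  fixes f :: "real \<Rightarrow> real^'d"
  assumes "continuous_on UNIV f" "\<And>t. t \<notin> {a..b} \<Longrightarrow> f t = 0" "S \<in> sets lebesgue"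
  shows "square_integrable_on f S"
  unfolding square_integrable_on_def
proof
  have "f \<in> borel_measurable borel" using assms(1) by (rule borel_measurable_continuous_onI)
  then show "f \<in> borel_measurable (lebesgue_on S)"
    by (intro measurable_restrict_space1 measurable_completion) simp
  have "(\<lambda>t. (norm (f t))\<^sup>2) absolutely_integrable_on {a..b}"
    using assms(1) by (intro absolutely_integrable_continuous_real continuous_intros) (auto intro: continuous_on_subset)
  moreover have "(\<lambda>t. indicat_real {a..b} t *\<^sub>R (norm (f t))\<^sup>2) = (\<lambda>t. (norm (f t))\<^sup>2)"
    using assms(2) by (auto simp: fun_eq_iff indicator_def)
  ultimately have "integrable lebesgue (\<lambda>t. (norm (f t))\<^sup>2)" by (simp add: set_integrable_def)
  then have "integrable lebesgue (\<lambda>t. indicat_real S t *\<^sub>R (norm (f t))\<^sup>2)"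
    using assms(3) by (intro integrable_mult_indicator)
  then show "integrable (lebesgue_on S) (\<lambda>t. (norm (f t))\<^sup>2)"
    using assms(3) by (subst integrable_restrict_space) auto
qed

lemma square_integrable_on_cong:
  assumes "\<And>t. t \<in> S \<Longrightarrow> f t = g t" "square_integrable_on g S"
  shows "square_integrable_on f S"
proof -
  have "f \<in> borel_measurable (lebesgue_on S) \<longleftrightarrow> g \<in> borel_measurable (lebesgue_on S)"
    using assms(1) by (intro measurable_cong) simp
  moreover have "integrable (lebesgue_on S) (\<lambda>t. (norm (f t))\<^sup>2) \<longleftrightarrow> integrable (lebesgue_on S) (\<lambda>t. (norm (g t))\<^sup>2)"
    using assms(1) by (intro Bochner_Integration.integrable_cong) auto
  ultimately show ?thesis using assms(2) by (simp add: square_integrable_on_def)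
qed

lemma square_integrable_on_bump:
  assumes "0 < \<delta>"
  shows "square_integrable_on (bump e \<delta> x y) (edge_interval \<Gamma> j)"
    "square_integrable_on (bump' e \<delta> x y) (edge_interval \<Gamma> j)"
    "square_integrable_on (bump'' e \<delta> x y) (edge_interval \<Gamma> j)"
proof -
  have out: "\<delta> \<le> \<bar>t - e\<bar>" if "t \<notin> {e - \<delta>..e + \<delta>}" for t using that by auto
  note supp = square_integrable_on_compact_support[OF _ _ lebesgue_edge_interval, of _ "e - \<delta>" "e + \<delta>"]
  show "square_integrable_on (bump e \<delta> x y) (edge_interval \<Gamma> j)"
    by (rule supp[OF continuous_bump(1)[OF assms]]) (rule bump_eq_0(1)[OF assms out])
  show "square_integrable_on (bump' e \<delta> x y) (edge_interval \<Gamma> j)"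
    by (rule supp[OF continuous_bump(2)[OF assms]]) (rule bump_eq_0(2)[OF assms out])
  show "square_integrable_on (bump'' e \<delta> x y) (edge_interval \<Gamma> j)"
    by (rule supp[OF continuous_bump(3)[OF assms]]) (rule bump_eq_0(3)[OF assms out])
qed

lemma end_bump_W22:
  assumes "0 < \<delta>" "j \<in> edges \<Gamma>"
  shows "end_bump \<Gamma> j e \<delta> x y \<in> W22 \<Gamma>"
proof -
  let ?f = "end_bump \<Gamma> j e \<delta> x y"
  have "\<exists>f' f''. square_integrable_on (?f i) (edge_interval \<Gamma> i) \<and>
        square_integrable_on f' (edge_interval \<Gamma> i) \<and> square_integrable_on f'' (edge_interval \<Gamma> i) \<and>
        has_weak_deriv_on (?f i) f' (edge_interval \<Gamma> i) \<and> has_weak_deriv_on f' f'' (edge_interval \<Gamma> i)" for i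
  proof (cases "i = j")
    case False
    then have "?f i = (\<lambda>_. 0)" by (simp add: end_bump_def fun_eq_iff)
    then show ?thesis
      by (intro exI[of _ "\<lambda>_. 0"]) (simp add: square_integrable_on_def has_weak_deriv_on_def)
  next
    case True
    have f: "?f i t = bump e \<delta> x y t" if "t \<in> edge_interval \<Gamma> i" for t
      using that True by (simp add: end_bump_def)
    have "has_weak_deriv_on (?f i) (bump' e \<delta> x y) (edge_interval \<Gamma> i)"
      unfolding has_weak_deriv_on_def
    proof (intro ballI impI)
      fix s t assume st: "s \<in> edge_interval \<Gamma> i" "t \<in> edge_interval \<Gamma> i" "s \<le> t"
      show "(bump' e \<delta> x y has_integral ?f i t - ?f i s) {s..t}"
        unfolding f[OF st(1)] f[OF st(2)]
        using st(3) bump_deriv[OF assms(1)] by (intro fundamental_theorem_of_calculus) auto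
    qed
    moreover have "has_weak_deriv_on (bump' e \<delta> x y) (bump'' e \<delta> x y) (edge_interval \<Gamma> i)"
      unfolding has_weak_deriv_on_def
      using bump'_deriv[OF assms(1)] by (intro ballI impI fundamental_theorem_of_calculus) auto
    moreover have "square_integrable_on (?f i) (edge_interval \<Gamma> i)"
      by (rule square_integrable_on_cong[OF f square_integrable_on_bump(1)[OF assms(1)]])
    ultimately show ?thesis
      by (intro exI[of _ "bump' e \<delta> x y"] exI[of _ "bump'' e \<delta> x y"] conjI square_integrable_on_bump[OF assms(1)])
  qed
  moreover have "?f i t = 0" if "i \<notin> edges \<Gamma> \<or> t \<notin> edge_interval \<Gamma> i" for i t
    using that assms(2) by (auto simp: end_bump_def)
  ultimately show ?thesis unfolding W22_def by blast
qed

lemma symmetric_matrix_inner: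
  assumes "symmetric_matrix A" shows "(A *v x) \<bullet> y = (A *v y) \<bullet> x"
  using assms unfolding symmetric_matrix_def
  by (metis dot_lmul_matrix inner_commute transpose_matrix_vector)

section \<open>Green's formula against bumps\<close>

locale sturm_liouville =
  fixes \<Gamma> :: "('v, 'e) metric_graph" and P Q R :: "'e \<Rightarrow> real \<Rightarrow> real^'d^'d"
  assumes graph: "is_metric_graph \<Gamma>" and coefficients: "sl_coefficients \<Gamma> P Q R"
    and adjoint: "is_adjoint \<Gamma> (maximal_op \<Gamma> P Q R) (minimal_op \<Gamma> P Q R)"
begin

abbreviation I where "I \<equiv> edge_interval \<Gamma>"

lemma P_differentiable:
  assumes "j \<in> edges \<Gamma>" "t \<in> I j"
  shows "\<exists>P'. (P j has_vector_derivative P') (at t within I j)"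
proof -
  have pd: "positive_definite_matrix (P j t)" if "t \<in> I j" for t
    using coefficients assms(1) that by (simp add: sl_coefficients_def)
  obtain M' where "((\<lambda>t. matrix_inv (P j t)) has_vector_derivative M') (at t within I j)"
    using coefficients assms unfolding sl_coefficients_def C1_on_def by blast
  from has_vector_derivative_matrix_inverse[OF positive_definite_matrix_inv(2)[OF pd]
      positive_definite_matrix_inv(1)[OF pd] assms(2) this]
  show ?thesis by blast
qed

lemma Q_differentiable:
  assumes "j \<in> edges \<Gamma>" "t \<in> I j"
  shows "\<exists>Q'. (Q j has_vector_derivative Q') (at t within I j)"
  using coefficients assms unfolding sl_coefficients_def C1_on_def by blast

lemma continuous_coefficients:
  assumes "j \<in> edges \<Gamma>"
  shows "continuous_on (I j) (P j)" "continuous_on (I j) (Q j)" "continuous_on (I j) (R j)"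
proof -
  show "continuous_on (I j) (P j)" "continuous_on (I j) (Q j)"
    unfolding continuous_on_eq_continuous_within
    using P_differentiable[OF assms] Q_differentiable[OF assms] has_vector_derivative_continuous by blast+
  show "continuous_on (I j) (R j)"
    using coefficients assms by (simp add: sl_coefficients_def)
qed

lemma symmetric_coefficients:
  assumes "j \<in> edges \<Gamma>" "t \<in> I j"
  shows "symmetric_matrix (P j t)" "symmetric_matrix (R j t)"
  using coefficients assms by (auto simp: sl_coefficients_def)

text \<open>The symmetric density that remains of the pairing of \<open>sl_expr\<close> with
  \<open>g\<close> once the outer derivative has been moved to \<open>g\<close>; primed arguments
  stand for derivatives.\<close>

definition energy :: "'e \<Rightarrow> real \<Rightarrow> real^'d \<Rightarrow> real^'d \<Rightarrow> real^'d \<Rightarrow> real^'d \<Rightarrow> real" where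
  "energy j t f f' g g' = (P j t *v f') \<bullet> g' + (Q j t *v f) \<bullet> g' + f' \<bullet> (Q j t *v g) + (R j t *v f) \<bullet> g"

lemma energy_sym: "j \<in> edges \<Gamma> \<Longrightarrow> t \<in> I j \<Longrightarrow> energy j t f f' g g' = energy j t g g' f f'"
  using symmetric_matrix_inner[OF symmetric_coefficients(1), of j t f' g']
    symmetric_matrix_inner[OF symmetric_coefficients(2), of j t f g]
  by (simp add: energy_def inner_commute)

lemma W22_L2: "f \<in> W22 \<Gamma> \<Longrightarrow> f \<in> L2 \<Gamma>"
  by (auto simp: W22_def L2_def)

lemma adjoint_graphI: "f \<in> W22 \<Gamma> \<Longrightarrow> (f, sl_expr \<Gamma> P Q R f) \<in> adjoint_graph \<Gamma> (minimal_op \<Gamma> P Q R)"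
proof -
  assume "f \<in> W22 \<Gamma>"
  then have "(f, sl_expr \<Gamma> P Q R f) \<in> op_graph \<Gamma> (maximal_op \<Gamma> P Q R)"
    by (auto simp: op_graph_def maximal_op_def intro!: bexI[of _ f] ae_equal_refl)
  then show ?thesis using adjoint by (simp add: is_adjoint_def)
qed

text \<open>On a half-line the coefficients may be unbounded, so membership is not a matter of the
  regularity of \<open>f\<close>; it is read off from the adjoint.\<close>

lemma sl_expr_L2: "f \<in> W22 \<Gamma> \<Longrightarrow> sl_expr \<Gamma> P Q R f \<in> L2 \<Gamma>"
  using adjoint_graphI by (auto simp: adjoint_graph_def)

text \<open>Two classical derivatives of \<open>f\<close> on the edge make the fundamental theorem
  of calculus applicable; bumps have them, and general elements of \<open>W22\<close> are reached
  later modulo the minimal domain. The bump vanishes at distance \<delta> from \<open>e\<close>, so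
  a single boundary term survives.\<close>

lemma green:
  assumes j: "j \<in> edges \<Gamma>" and e: "e \<in> finite_ends \<Gamma> j" and \<delta>: "small \<Gamma> \<delta>"
    and f: "f \<in> W22 \<Gamma>" "\<And>t. t \<in> I j \<Longrightarrow> f j t = F t"
    and F: "\<And>t. t \<in> I j \<Longrightarrow> (F has_vector_derivative F' t) (at t within I j)"
      "\<And>t. t \<in> I j \<Longrightarrow> (F' has_vector_derivative F'' t) (at t within I j)"
  shows "L2_inner \<Gamma> (sl_expr \<Gamma> P Q R f) (end_bump \<Gamma> j e \<delta> x y) =
    end_sign \<Gamma> j e * ((P j e *v F' e + Q j e *v F e) \<bullet> x)
    + integral (end_interval \<Gamma> j e \<delta>) (\<lambda>t. energy j t (F t) (F' t) (bump e \<delta> x y t) (bump' e \<delta> x y t))"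
proof -
  let ?g = "bump e \<delta> x y" and ?g' = "bump' e \<delta> x y" and ?J = "end_interval \<Gamma> j e \<delta>"
  let ?Lf = "sl_expr \<Gamma> P Q R f" and ?\<phi> = "end_bump \<Gamma> j e \<delta> x y"
  have \<delta>0: "0 < \<delta>" using \<delta> by (simp add: small_def)
  note J = end_interval[OF graph j e \<delta>]
  have JI: "?J \<subseteq> I j" unfolding J by blast
  define u where "u t = P j t *v F' t + Q j t *v F t" for t
  have "\<exists>u'. (u has_vector_derivative u') (at t within I j)" if t: "t \<in> I j" for t
  proof -
    obtain P' Q' where "(P j has_vector_derivative P') (at t within I j)" "(Q j has_vector_derivative Q') (at t within I j)"
      using P_differentiable[OF j t] Q_differentiable[OF j t] by blast
    then show ?thesis unfolding u_def
      using has_vector_derivative_add[OF matvec.has_vector_derivative[OF _ F(2)[OF t]] matvec.has_vector_derivative[OF _ F(1)[OF t]]]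
      by blast
  qed
  then obtain u' where u': "\<And>t. t \<in> I j \<Longrightarrow> (u has_vector_derivative u' t) (at t within I j)" by metis
  have fd: "edge_deriv \<Gamma> f j t = F' t" if t: "t \<in> I j" for t
    by (intro edge_deriv_eq[OF graph j t] has_vector_derivative_transform[OF t f(2) F(1)[OF t]])
  have Lf: "?Lf j t = - u' t + transpose (Q j t) *v F' t + R j t *v F t" if t: "t \<in> I j" for t
  proof -
    have "edge_deriv \<Gamma> (\<lambda>j s. P j s *v edge_deriv \<Gamma> f j s + Q j s *v f j s) j t = u' t"
      by (intro edge_deriv_eq[OF graph j t] has_vector_derivative_transform[OF t _ u'[OF t]])
         (simp add: fd f(2) u_def)
    then show ?thesis using t by (simp add: sl_expr_def fd f(2))
  qed
  have contF: "continuous_on (I j) F" "continuous_on (I j) F'"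
    using F by (auto simp: continuous_on_eq_continuous_within intro: has_vector_derivative_continuous)
  have "continuous_on (I j) (\<lambda>t. energy j t (F t) (F' t) (?g t) (?g' t))"
    unfolding energy_def
    by (intro continuous_intros matvec.continuous_on continuous_coefficients[OF j] contF continuous_bump[OF \<delta>0])
  then have "(\<lambda>t. energy j t (F t) (F' t) (?g t) (?g' t)) integrable_on ?J"
  proof -
    assume c: "continuous_on (I j) (\<lambda>t. energy j t (F t) (F' t) (?g t) (?g' t))"
    obtain p q where pq: "?J = {p..q}" unfolding end_interval_def by (metis (full_types))
    show ?thesis unfolding pq by (rule integrable_continuous_real[OF continuous_on_subset[OF c JI[unfolded pq]]])
  qed
  then have int_E: "((\<lambda>t. energy j t (F t) (F' t) (?g t) (?g' t)) has_integral
      integral ?J (\<lambda>t. energy j t (F t) (F' t) (?g t) (?g' t))) ?J"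
    by (rule integrable_integral)
  have deriv: "((\<lambda>t. u t \<bullet> ?g t) has_vector_derivative u t \<bullet> ?g' t + u' t \<bullet> ?g t) (at t within ?J)"
    if "t \<in> ?J" for t
  proof -
    have "(u has_vector_derivative u' t) (at t within ?J)"
      using u' that JI by (blast intro: has_vector_derivative_within_subset)
    then show ?thesis
      by (rule bounded_bilinear.has_vector_derivative[OF bounded_bilinear_inner _ bump_deriv[OF \<delta>0]])
  qed
  have "((\<lambda>t. u t \<bullet> ?g' t + u' t \<bullet> ?g t) has_integral - end_sign \<Gamma> j e * (u e \<bullet> x)) ?J"
  proof (cases "left_end \<Gamma> j = ereal e")
    case True
    then have Je: "?J = {e..e + \<delta>}" by (simp add: end_interval_def)
    have "((\<lambda>t. u t \<bullet> ?g' t + u' t \<bullet> ?g t) has_integral u (e + \<delta>) \<bullet> ?g (e + \<delta>) - u e \<bullet> ?g e) {e..e + \<delta>}"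
      using deriv \<delta>0 unfolding Je by (intro fundamental_theorem_of_calculus) auto
    then show ?thesis using True bump_eq_0(1)[OF \<delta>0, of "e + \<delta>" e x y] \<delta>0 by (simp add: Je end_sign_def)
  next
    case False
    then have Je: "?J = {e - \<delta>..e}" by (simp add: end_interval_def)
    have "((\<lambda>t. u t \<bullet> ?g' t + u' t \<bullet> ?g t) has_integral u e \<bullet> ?g e - u (e - \<delta>) \<bullet> ?g (e - \<delta>)) {e - \<delta>..e}"
      using deriv \<delta>0 unfolding Je by (intro fundamental_theorem_of_calculus) auto
    then show ?thesis using False bump_eq_0(1)[OF \<delta>0, of "e - \<delta>" e x y] \<delta>0 by (simp add: Je end_sign_def)
  qed
  from has_integral_diff[OF int_E this]
  have "((\<lambda>t. energy j t (F t) (F' t) (?g t) (?g' t) - (u t \<bullet> ?g' t + u' t \<bullet> ?g t)) has_integral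
      end_sign \<Gamma> j e * (u e \<bullet> x) + integral ?J (\<lambda>t. energy j t (F t) (F' t) (?g t) (?g' t))) ?J"
    by (simp add: add.commute)
  moreover have "energy j t (F t) (F' t) (?g t) (?g' t) - (u t \<bullet> ?g' t + u' t \<bullet> ?g t) = ?Lf j t \<bullet> ?\<phi> j t"
    if t: "t \<in> ?J" for t
  proof -
    have "(transpose (Q j t) *v F' t) \<bullet> ?g t = F' t \<bullet> (Q j t *v ?g t)"
      by (simp add: transpose_matrix_vector dot_lmul_matrix)
    moreover have "t \<in> I j" using t JI by blast
    ultimately show ?thesis by (simp add: Lf energy_def u_def end_bump_def inner_add_left inner_diff_left)
  qed
  ultimately have "((\<lambda>t. ?Lf j t \<bullet> ?\<phi> j t) has_integral
      end_sign \<Gamma> j e * (u e \<bullet> x) + integral ?J (\<lambda>t. energy j t (F t) (F' t) (?g t) (?g' t))) ?J"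
    by (rule has_integral_eq[rotated])
  then have "((\<lambda>t. if t \<in> ?J then ?Lf j t \<bullet> ?\<phi> j t else 0) has_integral
      end_sign \<Gamma> j e * (u e \<bullet> x) + integral ?J (\<lambda>t. energy j t (F t) (F' t) (?g t) (?g' t))) (I j)"
    by (simp add: has_integral_restrict[OF JI])
  moreover have "(if t \<in> ?J then ?Lf j t \<bullet> ?\<phi> j t else 0) = ?Lf j t \<bullet> ?\<phi> j t" if "t \<in> I j" for t
    using that bump_eq_0(1)[OF \<delta>0, of t e x y] by (simp add: J end_bump_def)
  ultimately have on_I: "((\<lambda>t. ?Lf j t \<bullet> ?\<phi> j t) has_integral
      end_sign \<Gamma> j e * (u e \<bullet> x) + integral ?J (\<lambda>t. energy j t (F t) (F' t) (?g t) (?g' t))) (I j)"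
    by (rule has_integral_eq[rotated])
  \<comment> \<open>Both factors are in L^2, so the Lebesgue integral exists and agrees with the
    gauge integral just computed.\<close>
  have "integrable (lebesgue_on (I j)) (\<lambda>t. ?Lf j t \<bullet> ?\<phi> j t)"
    using sl_expr_L2[OF f(1)] W22_L2[OF end_bump_W22[OF \<delta>0 j]] j by (rule L2_inner_integrable)
  from has_integral_unique[OF has_integral_integral_lebesgue_on[OF this lebesgue_edge_interval] on_I]
  have "integral\<^sup>L (lebesgue_on (I j)) (\<lambda>t. ?Lf j t \<bullet> ?\<phi> j t)
      = end_sign \<Gamma> j e * (u e \<bullet> x) + integral ?J (\<lambda>t. energy j t (F t) (F' t) (?g t) (?g' t))" .
  moreover have "L2_inner \<Gamma> ?Lf ?\<phi> = integral\<^sup>L (lebesgue_on (I j)) (\<lambda>t. ?Lf j t \<bullet> ?\<phi> j t)"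
  proof -
    have "L2_inner \<Gamma> ?Lf ?\<phi> = (\<Sum>i\<in>edges \<Gamma>. if i = j then integral\<^sup>L (lebesgue_on (I j)) (\<lambda>t. ?Lf j t \<bullet> ?\<phi> j t) else 0)"
      unfolding L2_inner_def by (intro sum.cong) (auto simp: end_bump_def)
    then show ?thesis using finite_edges[OF graph] j by simp
  qed
  ultimately show ?thesis by (simp add: u_def)
qed

lemma bump_derivs:
  assumes "small \<Gamma> \<delta>"
  shows "(bump e \<delta> x y has_vector_derivative bump' e \<delta> x y t) (at t within S)"
    "(bump' e \<delta> x y has_vector_derivative bump'' e \<delta> x y t) (at t within S)"
  using assms bump_deriv bump'_deriv by (auto simp: small_def)

lemma end_bump_in_W22: "j \<in> edges \<Gamma> \<Longrightarrow> small \<Gamma> \<delta> \<Longrightarrow> end_bump \<Gamma> j e \<delta> x y \<in> W22 \<Gamma>"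
  by (simp add: end_bump_W22 small_def)

lemma end_bump_form_same:
  assumes "j \<in> edges \<Gamma>" "e \<in> finite_ends \<Gamma> j" "small \<Gamma> \<delta>"
  shows "L2_inner \<Gamma> (sl_expr \<Gamma> P Q R (end_bump \<Gamma> j e \<delta> x y)) (end_bump \<Gamma> j e \<delta> x' y') =
    end_sign \<Gamma> j e * ((P j e *v y + Q j e *v x) \<bullet> x')
    + integral (end_interval \<Gamma> j e \<delta>)
        (\<lambda>t. energy j t (bump e \<delta> x y t) (bump' e \<delta> x y t) (bump e \<delta> x' y' t) (bump' e \<delta> x' y' t))"
proof -
  have F: "end_bump \<Gamma> j e \<delta> x y j t = bump e \<delta> x y t" if "t \<in> I j" for t
    using that by (simp add: end_bump_def)
  show ?thesis
    using green[OF assms end_bump_in_W22[OF assms(1,3)] F bump_derivs(1)[OF assms(3)] bump_derivs(2)[OF assms(3)]]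
    by simp
qed

lemma end_bump_form_distinct:
  assumes j: "j \<in> edges \<Gamma>" "e \<in> finite_ends \<Gamma> j" and i: "i \<in> edges \<Gamma>" "e' \<in> finite_ends \<Gamma> i"
    and ne: "(i, e') \<noteq> (j, e)" and \<delta>: "small \<Gamma> \<delta>"
  shows "L2_inner \<Gamma> (sl_expr \<Gamma> P Q R (end_bump \<Gamma> i e' \<delta> x y)) (end_bump \<Gamma> j e \<delta> x' y') = 0"
proof -
  define F where "F = (if i = j then bump e' \<delta> x y else (\<lambda>_. 0))"
  define F' where "F' = (if i = j then bump' e' \<delta> x y else (\<lambda>_. 0))"
  define F'' where "F'' = (if i = j then bump'' e' \<delta> x y else (\<lambda>_. 0))"
  have F: "end_bump \<Gamma> i e' \<delta> x y j t = F t" if "t \<in> I j" for t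
    using that by (auto simp: end_bump_def F_def)
  have d: "(F has_vector_derivative F' t) (at t within S)" "(F' has_vector_derivative F'' t) (at t within S)" for t S
    using bump_derivs[OF \<delta>] by (auto simp: F_def F'_def F''_def)
  have \<delta>0: "0 < \<delta>" using \<delta> by (simp add: small_def)
  \<comment> \<open>Near \<open>e\<close> the other function vanishes with its derivative: either it
    lives on another edge or its end is at least \<open>2 * \<delta>\<close> away.\<close>
  have zero: "F t = 0 \<and> F' t = 0" if "\<bar>t - e\<bar> \<le> \<delta>" for t
  proof (cases "i = j")
    case True
    then have "2 * \<delta> \<le> \<bar>e - e'\<bar>" using finite_ends_apart[OF j(1,2) _ _ \<delta>, of e'] i ne by auto
    then have "\<delta> \<le> \<bar>t - e'\<bar>" using that by linarith
    from bump_eq_0(1,2)[OF \<delta>0 this, of x y] show ?thesis using True by (simp add: F_def F'_def)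
  qed (simp add: F_def F'_def)
  have "integral (end_interval \<Gamma> j e \<delta>) (\<lambda>t. energy j t (F t) (F' t) (bump e \<delta> x' y' t) (bump' e \<delta> x' y' t))
      = integral (end_interval \<Gamma> j e \<delta>) (\<lambda>t. 0)"
    using zero by (intro Henstock_Kurzweil_Integration.integral_cong)
      (auto simp: end_interval[OF graph j \<delta>] energy_def)
  then show ?thesis
    using green[OF j \<delta> end_bump_in_W22[OF i(1) \<delta>] F d] zero[of e] \<delta>0 by simp
qed

lemma norm_integral_end_interval:
  assumes "continuous_on (end_interval \<Gamma> j e \<delta>) f" "\<And>t. t \<in> end_interval \<Gamma> j e \<delta> \<Longrightarrow> \<bar>f t\<bar> \<le> C" "0 \<le> \<delta>"
  shows "\<bar>integral (end_interval \<Gamma> j e \<delta>) f\<bar> \<le> C * \<delta>"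
proof (cases "left_end \<Gamma> j = ereal e")
  case True
  then show ?thesis using assms integral_bound[of e "e + \<delta>" f C] by (simp add: end_interval_def)
next
  case False
  then show ?thesis using assms integral_bound[of "e - \<delta>" e f C] by (simp add: end_interval_def)
qed

lemma energy_bounded:
  assumes "j \<in> edges \<Gamma>" "compact K" "K \<subseteq> I j"
  shows "\<exists>C. \<forall>t\<in>K. \<forall>a\<in>cball 0 r. \<forall>b\<in>cball 0 r. \<bar>energy j t a b a b\<bar> \<le> C"
proof -
  let ?S = "K \<times> (cball 0 r \<times> cball 0 r) :: (real \<times> (real^'d) \<times> (real^'d)) set"
  have c: "continuous_on ?S (\<lambda>s. A (fst s))" if "continuous_on (I j) A" for A :: "real \<Rightarrow> real^'d^'d"
    by (rule continuous_on_compose2[OF that continuous_on_fst[OF continuous_on_id]]) (use assms(3) in auto)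
  have "continuous_on ?S (\<lambda>s. energy j (fst s) (fst (snd s)) (snd (snd s)) (fst (snd s)) (snd (snd s)))"
    unfolding energy_def
    by (intro continuous_intros matvec.continuous_on c continuous_coefficients[OF assms(1)])
  moreover have "compact ?S" using assms(2) by (intro compact_Times) auto
  ultimately have "compact ((\<lambda>s. energy j (fst s) (fst (snd s)) (snd (snd s)) (fst (snd s)) (snd (snd s))) ` ?S)"
    by (rule compact_continuous_image)
  then obtain C where "\<forall>z\<in>(\<lambda>s. energy j (fst s) (fst (snd s)) (snd (snd s)) (fst (snd s)) (snd (snd s))) ` ?S. \<bar>z\<bar> \<le> C"
    by (auto dest!: compact_imp_bounded simp: bounded_real)
  then have "\<bar>energy j t a b a b\<bar> \<le> C" if "t \<in> K" "a \<in> cball 0 r" "b \<in> cball 0 r" for t a b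
    using that by force
  then show ?thesis by blast
qed

lemma end_bump_form_decay:
  assumes j: "j \<in> edges \<Gamma>" "e \<in> finite_ends \<Gamma> j"
  shows "((\<lambda>\<delta>. L2_inner \<Gamma> (sl_expr \<Gamma> P Q R (end_bump \<Gamma> j e \<delta> 0 y)) (end_bump \<Gamma> j e \<delta> 0 y)) \<longlongrightarrow> 0) (at_right 0)"
proof -
  let ?h = "\<lambda>\<delta>. L2_inner \<Gamma> (sl_expr \<Gamma> P Q R (end_bump \<Gamma> j e \<delta> 0 y)) (end_bump \<Gamma> j e \<delta> 0 y)"
  \<comment> \<open>A fixed compact window containing all end intervals with
    \<open>\<delta> < 1\<close>, so that one bound of the energy serves for all of them.\<close>
  let ?K = "I j \<inter> {e - 1..e + 1}"
  have "compact ?K" using closed_edge_interval by (intro closed_Int_compact) auto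
  then obtain C where C: "\<And>t a b. t \<in> ?K \<Longrightarrow> a \<in> cball 0 (7 * norm y) \<Longrightarrow> b \<in> cball 0 (7 * norm y) \<Longrightarrow> \<bar>energy j t a b a b\<bar> \<le> C"
    using energy_bounded[OF j(1) _ Int_lower1, of "{e - 1..e + 1}" "7 * norm y"] by metis
  have "\<forall>\<^sub>F \<delta> in at_right 0. \<delta> \<in> {0<..<1::real}" by (rule eventually_at_right_real) simp
  then have "\<forall>\<^sub>F \<delta> in at_right 0. norm (?h \<delta>) \<le> C * \<delta>"
    using eventually_small[OF graph]
  proof eventually_elim
    case (elim \<delta>)
    note J = end_interval[OF graph j elim(2)]
    have "?h \<delta> = integral (end_interval \<Gamma> j e \<delta>)
        (\<lambda>t. energy j t (bump e \<delta> 0 y t) (bump' e \<delta> 0 y t) (bump e \<delta> 0 y t) (bump' e \<delta> 0 y t))"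
      using end_bump_form_same[OF j elim(2), of 0 y 0 y] by simp
    also have "norm \<dots> \<le> C * \<delta>"
      unfolding real_norm_def
    proof (rule norm_integral_end_interval)
      show "continuous_on (end_interval \<Gamma> j e \<delta>)
          (\<lambda>t. energy j t (bump e \<delta> 0 y t) (bump' e \<delta> 0 y t) (bump e \<delta> 0 y t) (bump' e \<delta> 0 y t))"
        unfolding energy_def
        by (intro continuous_intros matvec.continuous_on continuous_bump
            continuous_on_subset[OF continuous_coefficients(1)[OF j(1)]]
            continuous_on_subset[OF continuous_coefficients(2)[OF j(1)]]
            continuous_on_subset[OF continuous_coefficients(3)[OF j(1)]])
          (use elim(1) in \<open>auto simp: J\<close>)
      fix t assume t: "t \<in> end_interval \<Gamma> j e \<delta>"
      then have b: "norm (bump e \<delta> 0 y t) \<le> \<delta> * norm y" "norm (bump' e \<delta> 0 y t) \<le> 7 * norm y"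
        using elim(1) by (auto simp: J intro!: bump_bounds)
      have "\<delta> * norm y \<le> 7 * norm y" using elim(1) by (intro mult_right_mono) auto
      moreover have "t \<in> ?K" using t elim(1) by (auto simp: J abs_le_iff)
      ultimately show "\<bar>energy j t (bump e \<delta> 0 y t) (bump' e \<delta> 0 y t) (bump e \<delta> 0 y t) (bump' e \<delta> 0 y t)\<bar> \<le> C"
        using b by (intro C) auto
    qed (use elim(1) in simp)
    finally show ?case .
  qed
  moreover have "((\<lambda>\<delta>. C * \<delta>) \<longlongrightarrow> C * 0) (at_right 0)" by (intro tendsto_intros)
  ultimately show ?thesis using Lim_null_comparison[of ?h "\<lambda>\<delta>. C * \<delta>"] by simp
qed

lemma end_bump_norm_decay:
  assumes j: "j \<in> edges \<Gamma>" "e \<in> finite_ends \<Gamma> j"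
  shows "((\<lambda>\<delta>. L2_inner \<Gamma> (end_bump \<Gamma> j e \<delta> 0 y) (end_bump \<Gamma> j e \<delta> 0 y)) \<longlongrightarrow> 0) (at_right 0)"
proof -
  let ?h = "\<lambda>\<delta>. L2_inner \<Gamma> (end_bump \<Gamma> j e \<delta> 0 y) (end_bump \<Gamma> j e \<delta> 0 y)"
  have "\<forall>\<^sub>F \<delta> in at_right 0. \<delta> \<in> {0<..<1::real}" by (rule eventually_at_right_real) simp
  then have "\<forall>\<^sub>F \<delta> in at_right 0. norm (?h \<delta>) \<le> (norm y)\<^sup>2 * \<delta>"
    using eventually_small[OF graph]
  proof eventually_elim
    case (elim \<delta>)
    then have \<delta>0: "0 < \<delta>" "\<delta> < 1" by simp_all
    note J = end_interval[OF graph j elim(2)]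
    let ?b = "\<lambda>t. bump e \<delta> 0 y t \<bullet> bump e \<delta> 0 y t"
    have JI: "end_interval \<Gamma> j e \<delta> \<subseteq> I j" unfolding J by blast
    have cont: "continuous_on (end_interval \<Gamma> j e \<delta>) ?b"
      by (intro continuous_intros continuous_bump[OF \<delta>0(1)])
    have int: "integrable (lebesgue_on (I j)) (\<lambda>t. end_bump \<Gamma> j e \<delta> 0 y j t \<bullet> end_bump \<Gamma> j e \<delta> 0 y j t)"
      using W22_L2[OF end_bump_in_W22[OF j(1) elim(2)]] j(1) by (intro L2_inner_integrable)
    have "?h \<delta> = (\<Sum>i\<in>edges \<Gamma>. if i = j then integral\<^sup>L (lebesgue_on (I j)) (\<lambda>t. end_bump \<Gamma> j e \<delta> 0 y j t \<bullet> end_bump \<Gamma> j e \<delta> 0 y j t) else 0)"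
      unfolding L2_inner_def by (intro sum.cong) (auto simp: end_bump_def)
    also have "\<dots> = integral (I j) (\<lambda>t. end_bump \<Gamma> j e \<delta> 0 y j t \<bullet> end_bump \<Gamma> j e \<delta> 0 y j t)"
      using finite_edges[OF graph] j(1) lebesgue_integral_eq_integral[OF int lebesgue_edge_interval] by simp
    also have "\<dots> = integral (I j) (\<lambda>t. if t \<in> end_interval \<Gamma> j e \<delta> then ?b t else 0)"
    proof (rule Henstock_Kurzweil_Integration.integral_cong)
      fix t assume "t \<in> I j"
      then show "end_bump \<Gamma> j e \<delta> 0 y j t \<bullet> end_bump \<Gamma> j e \<delta> 0 y j t = (if t \<in> end_interval \<Gamma> j e \<delta> then ?b t else 0)"
        using bump_eq_0(1)[OF \<delta>0(1), of t e 0 y] by (simp add: J end_bump_def)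
    qed
    also have "\<dots> = integral (end_interval \<Gamma> j e \<delta>) ?b"
      using JI by (simp add: integral_restrict_Int Int_absorb2)
    also have "norm \<dots> \<le> (norm y)\<^sup>2 * \<delta>"
      unfolding real_norm_def
    proof (rule norm_integral_end_interval[OF cont])
      fix t assume "t \<in> end_interval \<Gamma> j e \<delta>"
      then have "norm (bump e \<delta> 0 y t) \<le> \<delta> * norm y" by (intro bump_bounds \<delta>0) (simp add: J)
      also have "\<delta> * norm y \<le> 1 * norm y" using \<delta>0 by (intro mult_right_mono) auto
      finally have "(norm (bump e \<delta> 0 y t))\<^sup>2 \<le> (norm y)\<^sup>2" by (intro power_mono) auto
      then show "\<bar>?b t\<bar> \<le> (norm y)\<^sup>2" by (simp add: power2_norm_eq_inner)
    qed (use \<delta>0 in simp)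
    finally show ?case .
  qed
  moreover have "((\<lambda>\<delta>. (norm y)\<^sup>2 * \<delta>) \<longlongrightarrow> (norm y)\<^sup>2 * 0) (at_right 0)" by (intro tendsto_intros)
  ultimately show ?thesis using Lim_null_comparison[of ?h "\<lambda>\<delta>. (norm y)\<^sup>2 * \<delta>"] by simp
qed

text \<open>The weak derivative is itself an indefinite integral, hence continuous, so
  \<open>f\<close> has a classical derivative at every point of the edge, ends included. This gives
  meaning to the boundary data \<open>edge_deriv\<close>.\<close>

lemma W22_has_deriv:
  assumes f: "f \<in> W22 \<Gamma>" and j: "j \<in> edges \<Gamma>" and t: "t \<in> I j"
  shows "(f j has_vector_derivative edge_deriv \<Gamma> f j t) (at t within I j)"
proof -
  obtain g g' where g: "has_weak_deriv_on (f j) g (I j)" "has_weak_deriv_on g g' (I j)"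
    using f j unfolding W22_def by blast
  have cont: "continuous_on {p..q} g" if pq: "{p..q} \<subseteq> I j" for p q
  proof (cases "p \<le> q")
    case True
    have "(g' has_integral g s - g p) {p..s}" if "s \<in> {p..q}" for s
      using g(2) pq that unfolding has_weak_deriv_on_def by (metis True atLeastAtMost_iff order_refl subsetD)
    note w = this
    have i: "g' integrable_on {p..q}" using w[of q] True by (auto intro: has_integral_integrable)
    have eq: "g s = integral {p..s} g' + g p" if "s \<in> {p..q}" for s
      using integral_unique[OF w[OF that]] by simp
    show ?thesis
      by (subst continuous_on_cong[OF refl eq])
         (auto intro!: continuous_intros indefinite_integral_continuous_1 i)
  qed simp
  \<comment> \<open>A compact piece of the edge around \<open>t\<close> for the fundamental theorem
    of calculus; near \<open>t\<close> it has the same neighbourhoods as the edge, also when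
    \<open>t\<close> is an end.\<close>
  obtain p q where pq: "{p..q} = I j \<inter> {t - 1..t + 1}" "p \<le> t" "t \<le> q"
  proof -
    have "compact (I j \<inter> {t - 1..t + 1})" "Topological_Spaces.connected (I j \<inter> {t - 1..t + 1})"
      by (rule closed_Int_compact[OF closed_edge_interval compact_Icc])
         (rule is_interval_connected[OF is_interval_Int[OF is_interval_edge_interval is_interval_cc]])
    then obtain p q where "I j \<inter> {t - 1..t + 1} = {p..q}"
      using connected_compact_interval_1[of "I j \<inter> {t - 1..t + 1}"] by blast
    moreover have "t \<in> I j \<inter> {t - 1..t + 1}" using t by simp
    ultimately show thesis using that[of p q] by (metis atLeastAtMost_iff)
  qed
  have pqI: "{p..q} \<subseteq> I j" using pq by blast
  have "((\<lambda>s. integral {p..s} g) has_vector_derivative g t) (at t within {p..q})"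
    using pq by (intro integral_has_vector_derivative cont[OF pqI]) auto
  then have "((\<lambda>s. integral {p..s} g + f j p) has_vector_derivative g t) (at t within {p..q})"
    by (auto intro!: derivative_eq_intros)
  moreover have "f j s = integral {p..s} g + f j p" if s: "s \<in> {p..q}" for s
  proof -
    have "p \<in> I j" "s \<in> I j" "p \<le> s" using pqI s by auto
    then have "(g has_integral f j s - f j p) {p..s}" using g(1) unfolding has_weak_deriv_on_def by blast
    then show ?thesis by (simp add: integral_unique)
  qed
  ultimately have "(f j has_vector_derivative g t) (at t within {p..q})"
    using pq by (intro has_vector_derivative_transform[of t "{p..q}" "f j"]) auto
  moreover have "at t within {p..q} = at t within I j"
    unfolding pq(1) by (rule at_within_nhd[of _ "{t - 1<..<t + 1}"]) auto
  ultimately have "(f j has_vector_derivative g t) (at t within I j)" by simp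
  then show ?thesis using edge_deriv_eq[OF graph j t] by metis
qed

end

section \<open>Boundary values\<close>

lemma neg_index_cong: "(\<And>v. v \<in> V \<Longrightarrow> q v = q' v) \<Longrightarrow> neg_index V q = neg_index V q'"
  unfolding neg_index_def pos_index_def
  by (intro arg_cong[where f = Sup] image_cong Collect_cong) (auto simp: subset_iff)

locale sturm_liouville_extension = sturm_liouville \<Gamma> P Q R
  for \<Gamma> :: "('v, 'e) metric_graph" and P Q R :: "'e \<Rightarrow> real \<Rightarrow> real^'d^'d" +
  fixes U :: "('e \<Rightarrow> real \<Rightarrow> real^'d) set"
  assumes operator: "L2_operator \<Gamma> (minimal_op \<Gamma> P Q R)"
    and dense: "densely_defined \<Gamma> (minimal_op \<Gamma> P Q R)"
    and fredholm: "fredholm_op \<Gamma> (minimal_op \<Gamma> P Q R)"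
    and U: "boundary_space \<Gamma> P Q R U"
begin

abbreviation L where "L \<equiv> sl_expr \<Gamma> P Q R"
abbreviation W :: "('e \<Rightarrow> real \<Rightarrow> real^'d) set" where "W \<equiv> W22 \<Gamma>"
abbreviation D :: "('e \<Rightarrow> real \<Rightarrow> real^'d) set" where "D \<equiv> W22_0 \<Gamma>"
abbreviation ip :: "('e \<Rightarrow> real \<Rightarrow> real^'d) \<Rightarrow> ('e \<Rightarrow> real \<Rightarrow> real^'d) \<Rightarrow> real" where "ip \<equiv> L2_inner \<Gamma>"

section \<open>Weak linearity and closed range of the operator\<close>

lemma subspace_D: "subspace D" and subspace_U: "subspace U" and W_eq: "W = subspace_sum D U"
  and D_Int_U: "D \<inter> U = {0}"
  using operator U by (auto simp: L2_operator_def minimal_op_def maximal_op_def boundary_space_def)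

lemma subspace_W: "subspace W"
  unfolding W_eq using subspace_D subspace_U by (rule subspace_subspace_sum)

lemma D_W: "D \<subseteq> W"
  by (auto simp: W22_0_def)

lemma U_W: "U \<subseteq> W"
proof
  fix u assume "u \<in> U"
  then show "u \<in> W" unfolding W_eq subspace_sum_def using subspace_0[OF subspace_D] by force
qed

lemma L2_W: "W \<subseteq> L2 \<Gamma>"
  using W22_L2 by blast

lemma L_L2: "f \<in> W \<Longrightarrow> L f \<in> L2 \<Gamma>"
  by (rule sl_expr_L2)

text \<open>Adjointness supplies this integration by parts for every \<open>f\<close> in W,
  including the behaviour at infinity.\<close>

lemma green_D: "d \<in> D \<Longrightarrow> f \<in> W \<Longrightarrow> ip (L d) f = ip d (L f)"
  using adjoint_graphI[of f] by (auto simp: adjoint_graph_def minimal_op_def)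

lemma orthogonal_dense:
  assumes z: "z \<in> L2 \<Gamma>" "\<And>d. d \<in> D \<Longrightarrow> ip d z = 0" and g: "g \<in> L2 \<Gamma>"
  shows "ip z g = 0"
proof -
  have "ip z z \<le> 0"
  proof (rule field_le_epsilon)
    fix e :: real assume e: "0 < e"
    then obtain d where d: "d \<in> D" "L2_norm \<Gamma> (z - d) < sqrt e"
      using dense z(1) unfolding densely_defined_def minimal_op_def by (metis real_sqrt_gt_0_iff unbounded_op.select_convs(1))
    have dL: "d \<in> L2 \<Gamma>" using d(1) D_W L2_W by blast
    have "0 \<le> L2_norm \<Gamma> (z - d)" by (simp add: L2_norm_def L2_inner_def sum_nonneg)
    then have "(L2_norm \<Gamma> (z - d))\<^sup>2 \<le> (sqrt e)\<^sup>2" using d(2) by (intro power_mono) auto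
    then have le: "ip (z - d) (z - d) \<le> e" using e by (simp add: L2_norm_square)
    \<comment> \<open>As \<open>d\<close> is orthogonal to \<open>z\<close>, the Cauchy-Schwarz
      inequality for \<open>z - d\<close> and \<open>z\<close> bounds the square of
      \<open>ip z z\<close> by \<open>e * ip z z\<close>.\<close>
    have "ip (z - d) z = ip z z" using z dL d(1) by (simp add: L2.ip_simps)
    then have "(ip z z)\<^sup>2 \<le> ip (z - d) (z - d) * ip z z"
      using L2.cauchy_schwarz[of "z - d" \<Gamma> z] z(1) dL L2.mem_diff by metis
    also have "\<dots> \<le> e * ip z z" using le L2.nonneg[OF z(1)] by (rule mult_right_mono)
    finally have "ip z z * ip z z \<le> e * ip z z" by (simp add: power2_eq_square)
    then show "ip z z \<le> 0 + e" using L2.nonneg[OF z(1)] e by (cases "ip z z = 0") (auto simp: mult_le_cancel_right)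
  qed
  then have "(ip z g)\<^sup>2 \<le> 0" using L2.cauchy_schwarz[OF z(1) g] L2.nonneg[OF z(1)] by simp
  then show ?thesis by simp
qed

text \<open>Where the outer derivative fails to exist \<open>sl_expr\<close> has an unspecified
  value, so additivity is asserted for pairings only. Tested against D, the operator moves to the
  test function and additivity becomes that of the inner product; density does the rest.\<close>

lemma L_add: "f \<in> W \<Longrightarrow> f' \<in> W \<Longrightarrow> g \<in> L2 \<Gamma> \<Longrightarrow> ip (L (f + f')) g = ip (L f) g + ip (L f') g"
proof -
  assume f: "f \<in> W" "f' \<in> W" and g: "g \<in> L2 \<Gamma>"
  then have W: "f + f' \<in> W" using subspace_add[OF subspace_W] by blast
  note fL = subsetD[OF L2_W f(1)] subsetD[OF L2_W f(2)]
  note LL = L_L2[OF W] L_L2[OF f(1)] L_L2[OF f(2)]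
  have "ip (L (f + f') - (L f + L f')) g = 0"
  proof (rule orthogonal_dense[OF _ _ g])
    show "L (f + f') - (L f + L f') \<in> L2 \<Gamma>" using LL by (intro L2.mem_diff L2.mem_add)
    fix d assume d: "d \<in> D"
    then have dL: "d \<in> L2 \<Gamma>" "L d \<in> L2 \<Gamma>" using D_W L2_W L_L2 by blast+
    have "ip d (L (f + f')) = ip d (L f) + ip d (L f')"
      using green_D[OF d W] green_D[OF d f(1)] green_D[OF d f(2)] L2.add_right[OF fL dL(2)] by simp
    then show "ip d (L (f + f') - (L f + L f')) = 0" using LL dL by (simp add: L2.ip_simps)
  qed
  then show ?thesis using LL g by (simp add: L2.ip_simps)
qed

lemma L_scale: "f \<in> W \<Longrightarrow> g \<in> L2 \<Gamma> \<Longrightarrow> ip (L (c *\<^sub>R f)) g = c * ip (L f) g"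
proof -
  assume f: "f \<in> W" and g: "g \<in> L2 \<Gamma>"
  then have W: "c *\<^sub>R f \<in> W" using subspace_scale[OF subspace_W] by blast
  note fL = subsetD[OF L2_W f]
  note LL = L_L2[OF W] L_L2[OF f]
  have "ip (L (c *\<^sub>R f) - c *\<^sub>R L f) g = 0"
  proof (rule orthogonal_dense[OF _ _ g])
    show "L (c *\<^sub>R f) - c *\<^sub>R L f \<in> L2 \<Gamma>" using LL by (intro L2.mem_diff L2.mem_scale)
    fix d assume d: "d \<in> D"
    then have dL: "d \<in> L2 \<Gamma>" "L d \<in> L2 \<Gamma>" using D_W L2_W L_L2 by blast+
    have "ip d (L (c *\<^sub>R f)) = c * ip d (L f)"
      using green_D[OF d W] green_D[OF d f] L2.scale_right[OF fL dL(2)] by simp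
    then show "ip d (L (c *\<^sub>R f) - c *\<^sub>R L f) = 0" using LL dL by (simp add: L2.ip_simps)
  qed
  then show ?thesis using LL g by (simp add: L2.ip_simps)
qed

lemma ae_equal_iff_ip:
  assumes "z \<in> L2 \<Gamma>" "w \<in> L2 \<Gamma>"
  shows "ae_equal \<Gamma> z w \<longleftrightarrow> (\<forall>g\<in>L2 \<Gamma>. ip z g = ip w g)"
proof
  assume "ae_equal \<Gamma> z w"
  then show "\<forall>g\<in>L2 \<Gamma>. ip z g = ip w g" using ae_equal_L2_inner[OF _ ae_equal_refl] assms by blast
next
  assume "\<forall>g\<in>L2 \<Gamma>. ip z g = ip w g"
  moreover have zw: "z - w \<in> L2 \<Gamma>" using assms by (rule L2.mem_diff)
  ultimately have "ip (z - w) (z - w) = 0" using assms by (simp add: L2.diff)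
  then have "ae_equal \<Gamma> (z - w) 0" using ae_equal_iff_norm[OF finite_edges[OF graph] zw] by simp
  then show "ae_equal \<Gamma> z w" by (simp add: ae_equal_def)
qed

definition K where "K = ker \<Gamma> (maximal_op \<Gamma> P Q R)"

lemma K_iff: "f \<in> K \<longleftrightarrow> f \<in> W \<and> (\<forall>g\<in>L2 \<Gamma>. ip (L f) g = 0)"
proof -
  have "ae_equal \<Gamma> (L f) 0 \<longleftrightarrow> (\<forall>g\<in>L2 \<Gamma>. ip (L f) g = 0)" if "f \<in> W"
    using ae_equal_iff_ip[OF L_L2[OF that] subspace_0[OF subspace_L2]] by (simp add: L2.ip_zero)
  then show ?thesis by (auto simp: K_def ker_def maximal_op_def)
qed

lemma subspace_K: "subspace K"
proof (rule subspaceI)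
  have "ip (L 0) g = 0" if "g \<in> L2 \<Gamma>" for g
    using L_scale[OF subspace_0[OF subspace_W] that, of 0] by simp
  then show "0 \<in> K" using subspace_0[OF subspace_W] by (simp add: K_iff)
qed (auto simp: K_iff L_add L_scale subspace_add[OF subspace_W] subspace_scale[OF subspace_W])

text \<open>The range of the minimal operator is closed, hence the orthogonal complement of \<open>K\<close>.\<close>
lemma range_orthogonal_kernel:
  assumes u: "u \<in> W" "\<And>k. k \<in> K \<Longrightarrow> ip (L u) k = 0"
  shows "\<exists>f\<in>D. u - f \<in> K"
proof -
  \<comment> \<open>The range of the minimal operator, closed under change of representatives;
    pairings describe it because the operator is linear only in that sense.\<close>
  define N where "N = {z \<in> L2 \<Gamma>. \<exists>f\<in>D. \<forall>g\<in>L2 \<Gamma>. ip z g = ip (L f) g}"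
  have DW: "f \<in> W" if "f \<in> D" for f using that D_W by blast
  have N: "subspace N"
  proof (rule subspaceI)
    have "ip 0 g = ip (L 0) g" if "g \<in> L2 \<Gamma>" for g
      using L_scale[OF subspace_0[OF subspace_W] that, of 0] L2.ip_zero(1)[OF that] by simp
    then show "0 \<in> N" using subspace_0[OF subspace_L2] subspace_0[OF subspace_D] by (auto simp: N_def)
  next
    fix z w assume "z \<in> N" "w \<in> N"
    then obtain f f' where "z \<in> L2 \<Gamma>" "w \<in> L2 \<Gamma>" "f \<in> D" "f' \<in> D"
      "\<forall>g\<in>L2 \<Gamma>. ip z g = ip (L f) g" "\<forall>g\<in>L2 \<Gamma>. ip w g = ip (L f') g" by (auto simp: N_def)
    then show "z + w \<in> N" unfolding N_def
      by (auto simp: L2.ip_simps L_add DW intro!: bexI[of _ "f + f'"] subspace_add[OF subspace_D])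
  next
    fix c z assume "z \<in> N"
    then obtain f where "z \<in> L2 \<Gamma>" "f \<in> D" "\<forall>g\<in>L2 \<Gamma>. ip z g = ip (L f) g" by (auto simp: N_def)
    then show "c *\<^sub>R z \<in> N" unfolding N_def
      by (auto simp: L2.ip_simps L_scale DW intro!: bexI[of _ "c *\<^sub>R f"] subspace_scale[OF subspace_D])
  qed
  have closed: "f \<in> N" if v: "\<And>n::nat. v n \<in> N" and f: "f \<in> L2 \<Gamma>" and lim: "(\<lambda>n. ip (v n - f) (v n - f)) \<longlonglongrightarrow> 0" for v f
  proof -
    obtain \<phi> where \<phi>: "\<And>n. \<phi> n \<in> D" "\<And>n g. g \<in> L2 \<Gamma> \<Longrightarrow> ip (v n) g = ip (L (\<phi> n)) g" and vL: "\<And>n. v n \<in> L2 \<Gamma>"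
      using v unfolding N_def by (simp, metis)
    have L\<phi>: "L (\<phi> n) \<in> L2 \<Gamma>" for n using \<phi>(1) DW L_L2 by blast
    have "ip (L (\<phi> n) - f) (L (\<phi> n) - f) = ip (v n - f) (v n - f)" for n
    proof -
      have "ip (v n - f) g = ip (L (\<phi> n) - f) g" if "g \<in> L2 \<Gamma>" for g
        using \<phi>(2)[OF that] vL[of n] L\<phi>[of n] f that by (simp add: L2.diff)
      then have *: "ip (v n - f) (v n - f) = ip (L (\<phi> n) - f) (v n - f)" "ip (v n - f) (L (\<phi> n) - f) = ip (L (\<phi> n) - f) (L (\<phi> n) - f)"
        using L2.mem_diff[OF vL[of n] f] L2.mem_diff[OF L\<phi>[of n] f] by blast+
      then show ?thesis using L2.sym[OF L2.mem_diff[OF vL[of n] f] L2.mem_diff[OF L\<phi>[of n] f]] by simp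
    qed
    then have "(\<lambda>n. L2_norm \<Gamma> (L (\<phi> n) - f)) \<longlonglongrightarrow> 0" using lim by (simp add: L2_norm_tendsto_0)
    \<comment> \<open>Closedness of the range is one of the clauses of the Fredholm
      property.\<close>
    moreover have "(\<forall>n. u n \<in> D) \<Longrightarrow> (\<lambda>n. L2_norm \<Gamma> (L (u n) - f)) \<longlonglongrightarrow> 0 \<Longrightarrow> \<exists>f'\<in>D. ae_equal \<Gamma> f (L f')" for u
      using fredholm f by (simp add: fredholm_op_def minimal_op_def)
    ultimately obtain f' where "f' \<in> D" "ae_equal \<Gamma> f (L f')" using \<phi>(1) by blast
    then show ?thesis using f ae_equal_iff_ip[OF f L_L2[OF DW]] by (auto simp: N_def)
  qed
  have "\<exists>n\<in>N. \<forall>m\<in>N. ip (L u - n) m = 0"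
  proof (rule L2.orthogonal_projection[OF _ N _ closed L_L2[OF u(1)]])
    show "N \<subseteq> L2 \<Gamma>" by (auto simp: N_def)
  qed (rule L2_complete[OF finite_edges[OF graph]])
  then obtain n where n: "n \<in> N" "\<And>m. m \<in> N \<Longrightarrow> ip (L u - n) m = 0" by blast
  obtain f where f: "n \<in> L2 \<Gamma>" "f \<in> D" "\<And>g. g \<in> L2 \<Gamma> \<Longrightarrow> ip n g = ip (L f) g" using n(1) by (auto simp: N_def)
  \<comment> \<open>The residual is orthogonal to the range of the minimal operator, so it belongs
    to the kernel of the adjoint up to a null set. It is then orthogonal to \<open>L u\<close> by
    hypothesis and to \<open>n\<close> by projection, hence null.\<close>
  let ?k = "L u - n"
  have kL: "?k \<in> L2 \<Gamma>" using L_L2[OF u(1)] f(1) by (rule L2.mem_diff)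
  have "ip (L d) ?k = ip d 0" if d: "d \<in> D" for d
  proof -
    have "L d \<in> N" using d L_L2[OF DW[OF d]] by (auto simp: N_def)
    then show ?thesis
      using n(2)[of "L d"] L2.sym[OF kL L_L2[OF DW[OF d]]] L2.ip_zero(2)[of d \<Gamma>] L2_W DW[OF d] by auto
  qed
  then have "(?k, 0) \<in> adjoint_graph \<Gamma> (minimal_op \<Gamma> P Q R)"
    using kL subspace_0[OF subspace_L2] by (simp add: adjoint_graph_def minimal_op_def)
  then have "(?k, 0) \<in> op_graph \<Gamma> (maximal_op \<Gamma> P Q R)" using adjoint by (simp add: is_adjoint_def)
  then obtain k where k: "k \<in> W" "ae_equal \<Gamma> ?k k" "ae_equal \<Gamma> 0 (L k)"
    by (auto simp: op_graph_def maximal_op_def)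
  have kK: "k \<in> K" using k ae_equal_sym by (auto simp: K_def ker_def maximal_op_def)
  have "k \<in> L2 \<Gamma>" using k L2_W by blast
  then have ip_k: "ip g ?k = ip g k" if "g \<in> L2 \<Gamma>" for g
    using ae_equal_L2_inner[OF ae_equal_refl k(2) that kL that] by blast
  have "ip ?k ?k = ip (L u) ?k - ip n ?k" by (rule L2.diff[OF L_L2[OF u(1)] f(1) kL])
  moreover have "ip (L u) ?k = 0" using ip_k[OF L_L2[OF u(1)]] u(2)[OF kK] by (simp only:)
  moreover have "ip n ?k = 0" using n(2)[OF n(1)] L2.sym[OF kL f(1)] by (simp only:)
  ultimately have "ip ?k ?k = 0" by linarith
  then have k0: "ip ?k g = 0" if "g \<in> L2 \<Gamma>" for g using L2.cauchy_schwarz[OF kL that] by simp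
  have fW: "f \<in> W" "(-1) *\<^sub>R f \<in> W" using DW[OF f(2)] subspace_scale[OF subspace_W] by blast+
  have "ip (L (u + (-1) *\<^sub>R f)) g = 0" if g: "g \<in> L2 \<Gamma>" for g
    using k0[OF g] f(3)[OF g] L_add[OF u(1) fW(2) g] L_scale[OF fW(1) g, of "-1"] L2.diff[OF L_L2[OF u(1)] f(1) g] by simp
  then have "u - f \<in> K" using subspace_diff[OF subspace_W u(1) fW(1)] by (simp add: K_iff)
  then show ?thesis using f(2) by blast
qed

section \<open>Boundary data carried by bumps\<close>

definition ends :: "('e \<times> real) set" where
  "ends = Sigma (edges \<Gamma>) (finite_ends \<Gamma>)"

lemma finite_ends_set: "finite ends"
  unfolding ends_def using finite_edges[OF graph] finite_finite_ends by (rule finite_SigmaI)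

text \<open>A finite sum of explicit C^2 functions with, for small \<delta>, the boundary data of
  \<open>f\<close>; it represents \<open>f\<close> modulo D.\<close>

definition end_bumps :: "real \<Rightarrow> ('e \<Rightarrow> real \<Rightarrow> real^'d) \<Rightarrow> 'e \<Rightarrow> real \<Rightarrow> real^'d" where
  "end_bumps \<delta> f = (\<Sum>(j, e)\<in>ends. end_bump \<Gamma> j e \<delta> (f j e) (edge_deriv \<Gamma> f j e))"

lemma end_bumps_W:
  assumes "small \<Gamma> \<delta>" shows "end_bumps \<delta> f \<in> W"
  unfolding end_bumps_def using end_bump_in_W22[OF _ assms]
  by (intro real_vector.subspace_sum[OF subspace_W]) (auto simp: ends_def)

lemma edge_deriv_add:
  assumes "f \<in> W" "g \<in> W" "j \<in> edges \<Gamma>" "t \<in> I j"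
  shows "edge_deriv \<Gamma> (f + g) j t = edge_deriv \<Gamma> f j t + edge_deriv \<Gamma> g j t"
proof (rule edge_deriv_eq[OF graph assms(3,4)])
  have "((\<lambda>t. f j t + g j t) has_vector_derivative edge_deriv \<Gamma> f j t + edge_deriv \<Gamma> g j t) (at t within I j)"
    by (intro has_vector_derivative_add W22_has_deriv assms)
  then show "((f + g) j has_vector_derivative edge_deriv \<Gamma> f j t + edge_deriv \<Gamma> g j t) (at t within I j)"
    by (simp add: plus_fun_def)
qed

lemma edge_deriv_scale:
  assumes "f \<in> W" "j \<in> edges \<Gamma>" "t \<in> I j"
  shows "edge_deriv \<Gamma> (c *\<^sub>R f) j t = c *\<^sub>R edge_deriv \<Gamma> f j t"
proof (rule edge_deriv_eq[OF graph assms(2,3)])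
  have "((\<lambda>t. c *\<^sub>R f j t) has_vector_derivative c *\<^sub>R edge_deriv \<Gamma> f j t) (at t within I j)"
    using bounded_linear.has_vector_derivative[OF bounded_linear_scaleR_right W22_has_deriv[OF assms]] .
  then show "((c *\<^sub>R f) j has_vector_derivative c *\<^sub>R edge_deriv \<Gamma> f j t) (at t within I j)"
    by (simp add: scaleR_fun_def)
qed

lemma edge_deriv_sum:
  assumes "finite A" "\<And>i. i \<in> A \<Longrightarrow> F i \<in> W" "j \<in> edges \<Gamma>" "t \<in> I j"
  shows "edge_deriv \<Gamma> (\<Sum>i\<in>A. F i) j t = (\<Sum>i\<in>A. edge_deriv \<Gamma> (F i) j t)"
  using assms(1,2)
proof (induction A rule: finite_induct)
  case empty
  show ?case using edge_deriv_scale[OF subspace_0[OF subspace_W] assms(3,4), of 0]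
    by (simp only: sum.empty scaleR_zero_left)
next
  case (insert i A)
  have F: "F i \<in> W" "sum F A \<in> W"
    using insert.prems real_vector.subspace_sum[OF subspace_W, of A F] by blast+
  have IH: "edge_deriv \<Gamma> (sum F A) j t = (\<Sum>i\<in>A. edge_deriv \<Gamma> (F i) j t)"
    by (rule insert.IH) (simp add: insert.prems)
  show ?case
    by (simp only: sum.insert[OF insert.hyps] edge_deriv_add[OF F assms(3,4)] IH)
qed

lemma end_bump_at_end:
  fixes x y :: "real^'d"
  assumes j: "j \<in> edges \<Gamma>" "e \<in> finite_ends \<Gamma> j" and i: "i \<in> edges \<Gamma>" "e' \<in> finite_ends \<Gamma> i" and \<delta>: "small \<Gamma> \<delta>"
  shows "end_bump \<Gamma> i e' \<delta> x y j e = (if (i, e') = (j, e) then x else 0)"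
    "edge_deriv \<Gamma> (end_bump \<Gamma> i e' \<delta> x y) j e = (if (i, e') = (j, e) then y else 0)"
proof -
  have eI: "e \<in> I j" using finite_ends_subset[OF graph j(1)] j(2) by blast
  have \<delta>0: "0 < \<delta>" using \<delta> by (simp add: small_def)
  have far: "\<delta> \<le> \<bar>e - e'\<bar>" if "i = j" "e' \<noteq> e"
    using finite_ends_apart[OF j _ _ \<delta>, of e'] that i \<delta>0 by auto
  show "end_bump \<Gamma> i e' \<delta> x y j e = (if (i, e') = (j, e) then x else 0)"
    using bump_eq_0(1)[OF \<delta>0 far, of x y] eI by (auto simp: end_bump_def)
  define F where "F = (if i = j then bump e' \<delta> x y else (\<lambda>_. 0))"
  define F' where "F' = (if i = j then bump' e' \<delta> x y else (\<lambda>_. 0))"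
  have F: "(F has_vector_derivative F' e) (at e within I j)"
    using bump_derivs(1)[OF \<delta>] by (auto simp: F_def F'_def)
  have "end_bump \<Gamma> i e' \<delta> x y j t = F t" if "t \<in> I j" for t using that by (auto simp: end_bump_def F_def)
  then have "(end_bump \<Gamma> i e' \<delta> x y j has_vector_derivative F' e) (at e within I j)"
    by (rule has_vector_derivative_transform[OF eI _ F])
  then have "edge_deriv \<Gamma> (end_bump \<Gamma> i e' \<delta> x y) j e = F' e"
    by (rule edge_deriv_eq[OF graph j(1) eI])
  then show "edge_deriv \<Gamma> (end_bump \<Gamma> i e' \<delta> x y) j e = (if (i, e') = (j, e) then y else 0)"
    using bump_eq_0(2)[OF \<delta>0 far, of x y] by (auto simp: F'_def)
qed

lemma sum_fun_apply: "(\<Sum>i\<in>A. F i) j t = (\<Sum>i\<in>A. F i j t :: real^'d)"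
  by (induction A rule: infinite_finite_induct) auto

lemma end_bumps_at_end:
  assumes j: "j \<in> edges \<Gamma>" "e \<in> finite_ends \<Gamma> j" and \<delta>: "small \<Gamma> \<delta>"
  shows "end_bumps \<delta> f j e = f j e" "edge_deriv \<Gamma> (end_bumps \<delta> f) j e = edge_deriv \<Gamma> f j e"
proof -
  have eI: "e \<in> I j" using finite_ends_subset[OF graph j(1)] j(2) by blast
  have "end_bumps \<delta> f j e = (\<Sum>i\<in>ends. if i = (j, e) then f j e else 0)"
    unfolding end_bumps_def sum_fun_apply
    using end_bump_at_end(1)[OF j _ _ \<delta>] by (intro sum.cong refl) (auto simp: ends_def split: if_splits)
  then show "end_bumps \<delta> f j e = f j e" using finite_ends_set j by (simp add: ends_def)
  have "edge_deriv \<Gamma> (end_bumps \<delta> f) j e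
      = (\<Sum>(i, e')\<in>ends. edge_deriv \<Gamma> (end_bump \<Gamma> i e' \<delta> (f i e') (edge_deriv \<Gamma> f i e')) j e)"
    unfolding end_bumps_def
    by (subst edge_deriv_sum[OF finite_ends_set _ j(1) eI])
       (auto simp: ends_def end_bump_in_W22 \<delta> intro!: sum.cong)
  also have "\<dots> = (\<Sum>i\<in>ends. if i = (j, e) then edge_deriv \<Gamma> f j e else 0)"
    using end_bump_at_end(2)[OF j _ _ \<delta>] by (intro sum.cong refl) (auto simp: ends_def split: if_splits)
  finally show "edge_deriv \<Gamma> (end_bumps \<delta> f) j e = edge_deriv \<Gamma> f j e"
    using finite_ends_set j by (simp add: ends_def)
qed

lemma diff_end_bumps:
  assumes f: "f \<in> W" and \<delta>: "small \<Gamma> \<delta>"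
  shows "f - end_bumps \<delta> f \<in> D"
proof -
  note b = end_bumps_W[OF \<delta>, of f]
  have b': "(-1) *\<^sub>R end_bumps \<delta> f \<in> W" using b subspace_scale[OF subspace_W] by blast
  have "f + (-1) *\<^sub>R end_bumps \<delta> f \<in> W" using subspace_add[OF subspace_W f b'] .
  moreover have "(f + (-1) *\<^sub>R end_bumps \<delta> f) j e = 0 \<and> edge_deriv \<Gamma> (f + (-1) *\<^sub>R end_bumps \<delta> f) j e = 0"
    if j: "j \<in> edges \<Gamma>" "e \<in> finite_ends \<Gamma> j" for j e
  proof -
    have eI: "e \<in> I j" using finite_ends_subset[OF graph j(1)] j(2) by blast
    show ?thesis
      using edge_deriv_add[OF f b' j(1) eI] edge_deriv_scale[OF b j(1) eI, of "-1"] end_bumps_at_end[OF j \<delta>, of f]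
      by (simp add: scaleR_fun_def)
  qed
  ultimately have "f + (-1) *\<^sub>R end_bumps \<delta> f \<in> D" unfolding W22_0_def by blast
  then show ?thesis by simp
qed

lemma ip_L_sum:
  assumes "finite A" "\<And>i. i \<in> A \<Longrightarrow> F i \<in> W" "g \<in> L2 \<Gamma>"
  shows "ip (L (\<Sum>i\<in>A. F i)) g = (\<Sum>i\<in>A. ip (L (F i)) g)"
  using assms(1,2)
proof (induction A rule: finite_induct)
  case empty
  show ?case using L_scale[OF subspace_0[OF subspace_W] assms(3), of 0]
    by (simp only: sum.empty scaleR_zero_left mult_zero_left)
next
  case (insert i A)
  have F: "F i \<in> W" "sum F A \<in> W"
    using insert.prems real_vector.subspace_sum[OF subspace_W, of A F] by blast+
  have IH: "ip (L (sum F A)) g = (\<Sum>i\<in>A. ip (L (F i)) g)"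
    by (rule insert.IH) (simp add: insert.prems)
  show ?case
    by (simp only: sum.insert[OF insert.hyps] L_add[OF F assms(3)] IH)
qed

lemma ip_sum_right:
  assumes "finite A" "\<And>i. i \<in> A \<Longrightarrow> F i \<in> L2 \<Gamma>" "g \<in> L2 \<Gamma>"
  shows "ip g (\<Sum>i\<in>A. F i) = (\<Sum>i\<in>A. ip g (F i))"
  using assms(1,2)
proof (induction A rule: finite_induct)
  case empty
  show ?case using L2.ip_zero(2)[OF assms(3)] by (simp only: sum.empty)
next
  case (insert i A)
  have F: "F i \<in> L2 \<Gamma>" "sum F A \<in> L2 \<Gamma>"
    using insert.prems real_vector.subspace_sum[OF subspace_L2, of A F \<Gamma>] by blast+
  have IH: "ip g (sum F A) = (\<Sum>i\<in>A. ip g (F i))"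
    by (rule insert.IH) (simp add: insert.prems)
  show ?case
    by (simp only: sum.insert[OF insert.hyps] L2.add_right[OF F assms(3)] IH)
qed

section \<open>The boundary form in terms of end values\<close>

definition om :: "('e \<Rightarrow> real \<Rightarrow> real^'d) \<Rightarrow> ('e \<Rightarrow> real \<Rightarrow> real^'d) \<Rightarrow> real" where
  "om f g = ip (L g) f - ip (L f) g"

lemma boundary_form_eq: "f \<in> W \<Longrightarrow> g \<in> W \<Longrightarrow> boundary_form \<Gamma> P Q R f g = om f g"
  using L2.sym[of f \<Gamma> "L g"] L2_W L_L2 by (auto simp: boundary_form_def maximal_op_def om_def)

lemma om_D: "d \<in> D \<Longrightarrow> f \<in> W \<Longrightarrow> om d f = 0"
  using green_D[of d f] L2.sym[of d \<Gamma> "L f"] D_W L2_W L_L2 by (auto simp: om_def)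

lemma om_antisym: "om f g = - om g f"
  by (simp add: om_def)

lemma om_add: "f \<in> W \<Longrightarrow> f' \<in> W \<Longrightarrow> g \<in> W \<Longrightarrow> om (f + f') g = om f g + om f' g"
  using L2_W by (simp add: om_def L_add L2.add_right L_L2 subset_iff)

lemma om_sum:
  assumes "finite A" "\<And>i. i \<in> A \<Longrightarrow> F i \<in> W" "g \<in> W"
  shows "om (\<Sum>i\<in>A. F i) g = (\<Sum>i\<in>A. om (F i) g)"
proof -
  have "g \<in> L2 \<Gamma>" "\<And>i. i \<in> A \<Longrightarrow> F i \<in> L2 \<Gamma>" using assms L2_W by blast+
  then show ?thesis
    using assms by (simp add: om_def ip_L_sum ip_sum_right L_L2 sum_subtractf)
qed

text \<open>Modulo D, \<open>f\<close> is a sum of bumps, and only the one at the same end interacts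
  with the given bump. The two energy integrals cancel by symmetry, which leaves the boundary
  terms.\<close>

lemma om_end_bump:
  assumes f: "f \<in> W" and j: "j \<in> edges \<Gamma>" "e \<in> finite_ends \<Gamma> j" and \<delta>: "small \<Gamma> \<delta>"
  shows "om f (end_bump \<Gamma> j e \<delta> x y) =
    end_sign \<Gamma> j e * ((P j e *v y + Q j e *v x) \<bullet> f j e - (P j e *v edge_deriv \<Gamma> f j e + Q j e *v f j e) \<bullet> x)"
proof -
  let ?g = "end_bump \<Gamma> j e \<delta> x y"
  let ?b = "\<lambda>(i, e'). end_bump \<Gamma> i e' \<delta> (f i e') (edge_deriv \<Gamma> f i e')"
  let ?v = "end_sign \<Gamma> j e * ((P j e *v y + Q j e *v x) \<bullet> f j e - (P j e *v edge_deriv \<Gamma> f j e + Q j e *v f j e) \<bullet> x)"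
  have g: "?g \<in> W" using end_bump_in_W22[OF j(1) \<delta>] .
  have "om f ?g = om ((f - end_bumps \<delta> f) + end_bumps \<delta> f) ?g" by simp
  also have "\<dots> = om (f - end_bumps \<delta> f) ?g + om (end_bumps \<delta> f) ?g"
    using diff_end_bumps[OF f \<delta>] D_W end_bumps_W[OF \<delta>] g by (intro om_add) auto
  also have "om (f - end_bumps \<delta> f) ?g = 0" using om_D[OF diff_end_bumps[OF f \<delta>] g] .
  also have "om (end_bumps \<delta> f) ?g = (\<Sum>i\<in>ends. om (?b i) ?g)"
    unfolding end_bumps_def using end_bump_in_W22[OF _ \<delta>] g
    by (intro om_sum[OF finite_ends_set]) (auto simp: ends_def)
  also have "\<dots> = (\<Sum>i\<in>ends. if i = (j, e) then ?v else 0)"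
  proof (intro sum.cong refl)
    fix i assume "i \<in> ends"
    then obtain k e' where i: "i = (k, e')" "k \<in> edges \<Gamma>" "e' \<in> finite_ends \<Gamma> k" by (auto simp: ends_def)
    show "om (?b i) ?g = (if i = (j, e) then ?v else 0)"
    proof (cases "i = (j, e)")
      case True
      let ?x = "f j e" and ?y = "edge_deriv \<Gamma> f j e"
      have "integral (end_interval \<Gamma> j e \<delta>) (\<lambda>t. energy j t (bump e \<delta> x y t) (bump' e \<delta> x y t) (bump e \<delta> ?x ?y t) (bump' e \<delta> ?x ?y t))
          = integral (end_interval \<Gamma> j e \<delta>) (\<lambda>t. energy j t (bump e \<delta> ?x ?y t) (bump' e \<delta> ?x ?y t) (bump e \<delta> x y t) (bump' e \<delta> x y t))"
        by (intro Henstock_Kurzweil_Integration.integral_cong energy_sym[OF j(1)]) (simp add: end_interval[OF graph j \<delta>])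
      then show ?thesis
        using True end_bump_form_same[OF j \<delta>, of ?x ?y x y] end_bump_form_same[OF j \<delta>, of x y ?x ?y]
        by (simp add: om_def algebra_simps)
    next
      case False
      then show ?thesis
        using i end_bump_form_distinct[OF j i(2,3) _ \<delta>] end_bump_form_distinct[OF i(2,3) j _ \<delta>]
        by (auto simp: om_def)
    qed
  qed
  also have "\<dots> = ?v" using finite_ends_set j by (simp add: ends_def)
  finally show ?thesis by simp
qed

lemma end_sign_nonzero: "end_sign \<Gamma> j e \<noteq> 0"
  by (simp add: end_sign_def)

lemma positive_definite_P:
  assumes "j \<in> edges \<Gamma>" "e \<in> finite_ends \<Gamma> j" "(P j e *v x) \<bullet> x = 0"
  shows "x = 0"
proof (rule ccontr)
  assume "x \<noteq> 0"
  moreover have "e \<in> I j" using finite_ends_subset[OF graph assms(1)] assms(2) by blast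
  then have "positive_definite_matrix (P j e)" using coefficients assms(1) by (simp add: sl_coefficients_def)
  ultimately show False using assms(3) by (auto simp: positive_definite_matrix_def inner_commute)
qed

lemma small_exists: "\<exists>\<delta>. small \<Gamma> \<delta>"
  using eventually_happens[OF eventually_small[OF graph]] by (simp add: trivial_limit_at_right_real)

lemma om_nondegenerate:
  assumes f: "f \<in> W" "\<And>g. g \<in> W \<Longrightarrow> om f g = 0"
  shows "f \<in> D"
proof -
  obtain \<delta> where \<delta>: "small \<Gamma> \<delta>" using small_exists by blast
  have "f j e = 0 \<and> edge_deriv \<Gamma> f j e = 0" if j: "j \<in> edges \<Gamma>" "e \<in> finite_ends \<Gamma> j" for j e
  proof -
    have 0: "(P j e *v y + Q j e *v x) \<bullet> f j e - (P j e *v edge_deriv \<Gamma> f j e + Q j e *v f j e) \<bullet> x = 0" for x y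
      using om_end_bump[OF f(1) j \<delta>, of x y] f(2)[OF end_bump_in_W22[OF j(1) \<delta>]] end_sign_nonzero by simp
    \<comment> \<open>A test bump with value 0 and slope \<open>f j e\<close> isolates
      \<open>P\<close>, whose definiteness forces \<open>f j e = 0\<close>; one with value
      \<open>edge_deriv \<Gamma> f j e\<close> and slope 0 then does the same for the
      derivative.\<close>
    have "f j e = 0" using 0[of "f j e" 0] by (intro positive_definite_P[OF j]) simp
    moreover from this have "edge_deriv \<Gamma> f j e = 0"
      using 0[of 0 "edge_deriv \<Gamma> f j e"] by (intro positive_definite_P[OF j]) simp
    ultimately show ?thesis by blast
  qed
  then show ?thesis using f(1) by (simp add: W22_0_def)
qed

definition G where "G = dirichlet_space \<Gamma> U"

lemma G_iff: "u \<in> G \<longleftrightarrow> u \<in> U \<and> (\<forall>j\<in>edges \<Gamma>. \<forall>e\<in>finite_ends \<Gamma> j. u j e = 0)"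
  using U_W by (auto simp: G_def dirichlet_space_def)

text \<open>Each boundary term of \<open>om_end_bump\<close> contains an end value of one of the two
  functions as a factor.\<close>

lemma om_Dirichlet:
  assumes "f \<in> W" "g \<in> W" "\<And>j e. j \<in> edges \<Gamma> \<Longrightarrow> e \<in> finite_ends \<Gamma> j \<Longrightarrow> f j e = 0"
    "\<And>j e. j \<in> edges \<Gamma> \<Longrightarrow> e \<in> finite_ends \<Gamma> j \<Longrightarrow> g j e = 0"
  shows "om f g = 0"
proof -
  obtain \<delta> where \<delta>: "small \<Gamma> \<delta>" using small_exists by blast
  have "om g f = om ((g - end_bumps \<delta> g) + end_bumps \<delta> g) f" by simp
  also have "\<dots> = om (g - end_bumps \<delta> g) f + om (end_bumps \<delta> g) f"
    using diff_end_bumps[OF assms(2) \<delta>] D_W end_bumps_W[OF \<delta>] assms(1) by (intro om_add) auto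
  also have "om (g - end_bumps \<delta> g) f = 0" using om_D[OF diff_end_bumps[OF assms(2) \<delta>] assms(1)] .
  also have "om (end_bumps \<delta> g) f
      = (\<Sum>i\<in>ends. om ((\<lambda>(i, e'). end_bump \<Gamma> i e' \<delta> (g i e') (edge_deriv \<Gamma> g i e')) i) f)"
    unfolding end_bumps_def using end_bump_in_W22[OF _ \<delta>] assms(1)
    by (intro om_sum[OF finite_ends_set]) (auto simp: ends_def)
  also have "\<dots> = (\<Sum>i\<in>ends. 0)"
  proof (intro sum.cong refl)
    fix i assume "i \<in> ends"
    then obtain k e where i: "i = (k, e)" "k \<in> edges \<Gamma>" "e \<in> finite_ends \<Gamma> k" by (auto simp: ends_def)
    then show "om ((\<lambda>(i, e'). end_bump \<Gamma> i e' \<delta> (g i e') (edge_deriv \<Gamma> g i e')) i) f = 0"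
      using om_end_bump[OF assms(1) i(2,3) \<delta>, of "g k e" "edge_deriv \<Gamma> g k e"] assms(3,4)[OF i(2,3)]
        om_antisym[of _ f] by simp
  qed
  finally show ?thesis using om_antisym[of f g] by simp
qed

lemma decompose_W: "f \<in> W \<Longrightarrow> \<exists>u\<in>U. f - u \<in> D"
  unfolding W_eq subspace_sum_def by force

lemma lagrangian_G: "lagrangian (boundary_form \<Gamma> P Q R) U G"
  unfolding lagrangian_def
proof (intro conjI equalityI subsetI CollectI ballI)
  show "subspace G"
    using subspace_0[OF subspace_U] subspace_add[OF subspace_U] subspace_scale[OF subspace_U]
    by (intro subspaceI) (auto simp: G_iff scaleR_fun_def)
  show "u \<in> U" if "u \<in> G" for u using that by (simp add: G_iff)
  show "u \<in> U" if "u \<in> G" for u using that by (simp add: G_iff)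
  show "boundary_form \<Gamma> P Q R u v = 0" if "u \<in> G" "v \<in> G" for u v
    using that U_W om_Dirichlet[of u v] by (auto simp: G_iff boundary_form_eq subset_iff)
next
  fix u assume u: "u \<in> {u \<in> U. \<forall>v\<in>G. boundary_form \<Gamma> P Q R u v = 0}"
  then have uW: "u \<in> U" "u \<in> W" using U_W by blast+
  obtain \<delta> where \<delta>: "small \<Gamma> \<delta>" using small_exists by blast
  have "u j e = 0" if j: "j \<in> edges \<Gamma>" "e \<in> finite_ends \<Gamma> j" for j e
  proof -
    \<comment> \<open>The bump need not lie in U, but its component \<open>v\<close> in U differs
      from it by an element of D and so has vanishing end values. The slope \<open>u j e\<close>
      turns the pairing into the definite form of \<open>P\<close>.\<close>
    let ?\<phi> = "end_bump \<Gamma> j e \<delta> 0 (u j e)"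
    have \<phi>: "?\<phi> \<in> W" using end_bump_in_W22[OF j(1) \<delta>] .
    then obtain v where v: "v \<in> U" "?\<phi> - v \<in> D" using decompose_W by blast
    have "v i e' = 0" if i: "i \<in> edges \<Gamma>" "e' \<in> finite_ends \<Gamma> i" for i e'
    proof -
      have "(?\<phi> - v) i e' = 0" using v(2) i by (simp add: W22_0_def)
      moreover have "?\<phi> i e' = 0" using end_bump_at_end(1)[OF i j \<delta>, of 0 "u j e"] by simp
      ultimately show ?thesis by simp
    qed
    then have vG: "v \<in> G" using v(1) by (simp add: G_iff)
    have vW: "v \<in> W" using v(1) U_W by blast
    have "om u v = 0" using u vG boundary_form_eq[OF uW(2) vW] by auto
    then have "om v u = 0" using om_antisym[of v u] by simp
    have "om ?\<phi> u = om ((?\<phi> - v) + v) u" by simp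
    also have "\<dots> = om (?\<phi> - v) u + om v u" using v(2) D_W vW uW(2) by (intro om_add) auto
    also have "\<dots> = 0" using om_D[OF v(2) uW(2)] \<open>om v u = 0\<close> by simp
    finally have "om u ?\<phi> = 0" using om_antisym[of u ?\<phi>] by simp
    then have "(P j e *v u j e) \<bullet> u j e = 0"
      using om_end_bump[OF uW(2) j \<delta>, of 0 "u j e"] end_sign_nonzero by simp
    then show ?thesis by (rule positive_definite_P[OF j])
  qed
  then show "u \<in> G" using uW(1) by (simp add: G_iff)
qed

text \<open>A function with Dirichlet boundary values is approximated in the form sense by functions in
  \<open>D\<close>: the corrections \<open>end_bumps \<delta> g\<close>, which only carry the boundary values of \<open>g'\<close>, have form
  \<open>O(\<delta>)\<close>.\<close>
lemma Dirichlet_approximation: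
  assumes g: "g \<in> subspace_sum D G"
  shows "\<exists>c. (\<forall>n::nat. g - c n \<in> D) \<and> (\<forall>n. c n \<in> W) \<and> (\<lambda>n. ip (L (c n)) (c n)) \<longlonglongrightarrow> 0 \<and>
           (\<forall>w\<in>W. (\<lambda>n. ip (L w) (c n)) \<longlonglongrightarrow> 0)"
proof -
  have gW: "g \<in> W" using g U_W subspace_add[OF subspace_W] D_W by (force simp: subspace_sum_def G_iff)
  have g0: "g j e = 0" if "j \<in> edges \<Gamma>" "e \<in> finite_ends \<Gamma> j" for j e
    using g that by (auto simp: subspace_sum_def G_iff W22_0_def)
  obtain r where r: "0 < r" "\<And>\<delta>. 0 < \<delta> \<Longrightarrow> \<delta> < r \<Longrightarrow> small \<Gamma> \<delta>"
    using eventually_small[OF graph] unfolding eventually_at_right_field by blast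
  \<comment> \<open>The shift by 2 makes every term, the first included, strictly smaller than
    \<open>r\<close>.\<close>
  define d where "d n = r / real (n + 2)" for n
  have d0: "0 < d n" for n using r(1) by (simp add: d_def)
  have small: "small \<Gamma> (d n)" for n
  proof (rule r(2)[OF d0])
    have "r * 1 < r * real (n + 2)" using r(1) by (intro mult_strict_left_mono) auto
    then show "d n < r" by (simp add: d_def divide_less_eq del: of_nat_add)
  qed
  have "d \<longlonglongrightarrow> 0" unfolding d_def by (rule LIMSEQ_ignore_initial_segment[OF lim_const_over_n])
  then have d: "filterlim d (at_right 0) sequentially"
    using d0 by (intro tendsto_imp_filterlim_at_right) auto
  let ?b = "\<lambda>n (j, e). end_bump \<Gamma> j e (d n) 0 (edge_deriv \<Gamma> g j e)"
  have c: "end_bumps (d n) g = (\<Sum>i\<in>ends. ?b n i)" for n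
    unfolding end_bumps_def using g0 by (intro sum.cong) (auto simp: ends_def)
  have bW: "?b n i \<in> W" if "i \<in> ends" for n i
    using that end_bump_in_W22[OF _ small] by (auto simp: ends_def)
  have bL: "?b n i \<in> L2 \<Gamma>" if "i \<in> ends" for n i
    using bW[OF that] L2_W by blast
  have cW: "end_bumps (d n) g \<in> W" for n using end_bumps_W[OF small] .
  have cL: "end_bumps (d n) g \<in> L2 \<Gamma>" for n using cW L2_W by blast
  have "ip (L (end_bumps (d n) g)) (end_bumps (d n) g) = (\<Sum>i\<in>ends. ip (L (?b n i)) (?b n i))" for n
  proof -
    have "ip (L (\<Sum>i\<in>ends. ?b n i)) (end_bumps (d n) g) = (\<Sum>i\<in>ends. ip (L (?b n i)) (end_bumps (d n) g))"
      by (rule ip_L_sum[OF finite_ends_set bW cL])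
    then have "ip (L (end_bumps (d n) g)) (end_bumps (d n) g) = (\<Sum>i\<in>ends. ip (L (?b n i)) (end_bumps (d n) g))"
      by (simp only: c)
    also have "\<dots> = (\<Sum>i\<in>ends. \<Sum>k\<in>ends. ip (L (?b n i)) (?b n k))"
      unfolding c by (rule sum.cong[OF refl], rule ip_sum_right[OF finite_ends_set bL L_L2[OF bW]])
    \<comment> \<open>Bumps at different ends do not interact, so only diagonal terms remain and
      each decays separately.\<close>
    also have "\<dots> = (\<Sum>i\<in>ends. \<Sum>k\<in>ends. if i = k then ip (L (?b n i)) (?b n i) else 0)"
    proof (intro sum.cong refl)
      fix i k assume "i \<in> ends" "k \<in> ends"
      then obtain j e j' e' where ik: "i = (j, e)" "j \<in> edges \<Gamma>" "e \<in> finite_ends \<Gamma> j"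
        "k = (j', e')" "j' \<in> edges \<Gamma>" "e' \<in> finite_ends \<Gamma> j'" by (auto simp: ends_def)
      show "ip (L (?b n i)) (?b n k) = (if i = k then ip (L (?b n i)) (?b n i) else 0)"
        using end_bump_form_distinct[OF ik(5,6,2,3) _ small, of n 0 "edge_deriv \<Gamma> g j e" 0 "edge_deriv \<Gamma> g j' e'"]
        by (cases "i = k") (auto simp: ik(1,4))
    qed
    finally show ?thesis using finite_ends_set by simp
  qed
  moreover have "(\<lambda>n. \<Sum>i\<in>ends. ip (L (?b n i)) (?b n i)) \<longlonglongrightarrow> (\<Sum>i\<in>ends. 0)"
  proof (rule tendsto_sum)
    fix i assume "i \<in> ends"
    then obtain j e where i: "i = (j, e)" "j \<in> edges \<Gamma>" "e \<in> finite_ends \<Gamma> j" by (auto simp: ends_def)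
    from filterlim_compose[OF end_bump_form_decay[OF i(2,3), of "edge_deriv \<Gamma> g j e"] d]
    show "(\<lambda>n. ip (L (?b n i)) (?b n i)) \<longlonglongrightarrow> 0" by (simp add: i(1))
  qed
  ultimately have 1: "(\<lambda>n. ip (L (end_bumps (d n) g)) (end_bumps (d n) g)) \<longlonglongrightarrow> 0" by simp
  have 2: "(\<lambda>n. ip (L w) (end_bumps (d n) g)) \<longlonglongrightarrow> 0" if w: "w \<in> W" for w
  proof -
    have "(\<lambda>n. \<Sum>i\<in>ends. ip (?b n i) (L w)) \<longlonglongrightarrow> (\<Sum>i\<in>ends. 0)"
    proof (rule tendsto_sum, rule L2.ip_tendsto[OF bL L_L2[OF w]])
      fix i assume "i \<in> ends"
      then obtain j e where i: "i = (j, e)" "j \<in> edges \<Gamma>" "e \<in> finite_ends \<Gamma> j" by (auto simp: ends_def)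
      from filterlim_compose[OF end_bump_norm_decay[OF i(2,3), of "edge_deriv \<Gamma> g j e"] d]
      show "(\<lambda>n. ip (?b n i) (?b n i)) \<longlonglongrightarrow> 0" by (simp add: i(1))
    qed
    moreover have "(\<Sum>i\<in>ends. ip (?b n i) (L w)) = ip (L w) (end_bumps (d n) g)" for n
    proof -
      have "ip (L w) (\<Sum>i\<in>ends. ?b n i) = (\<Sum>i\<in>ends. ip (L w) (?b n i))"
        by (rule ip_sum_right[OF finite_ends_set bL L_L2[OF w]])
      also have "\<dots> = (\<Sum>i\<in>ends. ip (?b n i) (L w))"
        by (rule sum.cong[OF refl], rule L2.sym[OF L_L2[OF w] bL])
      finally show ?thesis by (simp only: c)
    qed
    ultimately show ?thesis by simp
  qed
  show ?thesis using diff_end_bumps[OF gW small] cW 1 2 by (intro exI[of _ "\<lambda>n. end_bumps (d n) g"]) blast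
qed

end

section \<open>Application of the abstract index comparison\<close>

context sturm_liouville_extension
begin

lemma proj_along_D_U:
  assumes "f \<in> W"
  shows "proj_along D U f \<in> U" "f - proj_along D U f \<in> D"
    and proj_along_unique: "u \<in> U \<Longrightarrow> f - u \<in> D \<Longrightarrow> proj_along D U f = u"
proof -
  have unique: "u = v" if uv: "u \<in> U \<and> f - u \<in> D" "v \<in> U \<and> f - v \<in> D" for u v
  proof -
    have "(f - v) - (f - u) \<in> D" using uv subspace_diff[OF subspace_D] by blast
    moreover have "(f - v) - (f - u) = u - v" by simp
    ultimately have "u - v \<in> D \<inter> U" using uv subspace_diff[OF subspace_U] by (metis IntI)
    then show ?thesis using D_Int_U by simp
  qed
  have "\<exists>!u. u \<in> U \<and> f - u \<in> D" using decompose_W[OF assms] unique by blast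
  then have "proj_along D U f \<in> U \<and> f - proj_along D U f \<in> D"
    unfolding proj_along_def by (rule theI')
  then show "proj_along D U f \<in> U" "f - proj_along D U f \<in> D" by blast+
  then show "proj_along D U f = u" if "u \<in> U" "f - u \<in> D" for u using unique that by blast
qed

text \<open>An infinite basis has \<open>card\<close> 0, so the prescribed dimension proves
  finiteness only because it is positive: every edge has at least one finite end.\<close>

lemma finite_dimensional_U: "\<exists>B. finite B \<and> U \<subseteq> span B"
proof -
  obtain B where B: "B \<subseteq> U" "independent B" "U \<subseteq> span B" "card B = dim U" using basis_exists[of U] by blast
  have "edges \<Gamma> \<noteq> {}" using graph by (simp add: is_metric_graph_def)
  then obtain j where j: "j \<in> edges \<Gamma>" by blast
  have "left_end \<Gamma> j < right_end \<Gamma> j" "\<not> (left_end \<Gamma> j = -\<infinity> \<and> right_end \<Gamma> j = \<infinity>)"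
    using graph j by (auto simp: is_metric_graph_def)
  then have "j \<in> {j \<in> edges \<Gamma>. left_end \<Gamma> j \<noteq> -\<infinity>} \<or> j \<in> {j \<in> edges \<Gamma>. right_end \<Gamma> j \<noteq> \<infinity>}"
    using j by blast
  then have "num_left_ends \<Gamma> > 0 \<or> num_right_ends \<Gamma> > 0"
    using finite_edges[OF graph] unfolding num_left_ends_def num_right_ends_def
    by (auto simp: card_gt_0_iff)
  then have "dim U \<noteq> 0" using U by (auto simp: boundary_space_def)
  then have "finite B" using B(4) card.infinite by fastforce
  then show ?thesis using B(3) by blast
qed

theorem morse_index_difference:
  assumes \<Lambda>: "lagrangian (boundary_form \<Gamma> P Q R) U \<Lambda>"
    and fin: "morse_index \<Gamma> (extension_op \<Gamma> P Q R (dirichlet_space \<Gamma> U)) \<noteq> \<infinity>"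
  shows "\<exists>m n. morse_index \<Gamma> (extension_op \<Gamma> P Q R \<Lambda>) = enat m \<and>
     morse_index \<Gamma> (extension_op \<Gamma> P Q R (dirichlet_space \<Gamma> U)) = enat n \<and>
     int m - int n = triple_index (boundary_form \<Gamma> P Q R) (proj_along D U ` K) \<Lambda> (dirichlet_space \<Gamma> U)"
proof -
  \<comment> \<open>The abstract comparison wants \<open>h\<close> and \<open>p\<close> linear on
    the whole function space, whereas operator and projection behave linearly on W only; a linear
    projection \<open>\<pi>\<close> onto W extends them.\<close>
  obtain \<pi> :: "('e \<Rightarrow> real \<Rightarrow> real^'d) \<Rightarrow> 'e \<Rightarrow> real \<Rightarrow> real^'d"
    where \<pi>: "range \<pi> \<subseteq> W" "linear \<pi>" "\<forall>v\<in>id ` W. id (\<pi> v) = v"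
    using linear_exists_right_inverse_on[OF linear_id subspace_W] by blast
  then have \<pi>_W: "\<pi> f \<in> W" and \<pi>_id: "f \<in> W \<Longrightarrow> \<pi> f = f" for f by auto
  note \<pi>_L2 = subsetD[OF L2_W \<pi>_W]
  define h where "h f g = ip (L (\<pi> f)) (\<pi> g)" for f g
  define p where "p f = proj_along D U (\<pi> f)" for f
  have h_eq: "h f g = ip (L f) g" if "f \<in> W" "g \<in> W" for f g using that by (simp add: h_def \<pi>_id)
  have p_eq: "p f = proj_along D U f" if "f \<in> W" for f using that by (simp add: p_def \<pi>_id)
  have UW: "u \<in> W" if "u \<in> U" for u using that U_W by blast
  have DW: "u \<in> W" if "u \<in> D" for u using that D_W by blast
  have KW: "K \<subseteq> W" by (auto simp: K_iff)
  have h_bilinear: "bilinear h"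
    unfolding bilinear_def h_def
    by (intro conjI allI linearI)
       (simp_all only: linear_add[OF \<pi>(2)] linear_scale[OF \<pi>(2)] L_add[OF \<pi>_W \<pi>_W \<pi>_L2] L_scale[OF \<pi>_W \<pi>_L2]
          L2.add_right[OF \<pi>_L2 \<pi>_L2 L_L2[OF \<pi>_W]] L2.scale_right[OF \<pi>_L2 L_L2[OF \<pi>_W]] real_scaleR_def)
  have p_linear: "linear p"
  proof (rule linearI)
    fix f g
    have "(\<pi> f + \<pi> g) - (p f + p g) = (\<pi> f - p f) + (\<pi> g - p g)" by simp
    also have "\<dots> \<in> D" unfolding p_def by (intro subspace_add[OF subspace_D] proj_along_D_U(2) \<pi>_W)
    finally have "(\<pi> f + \<pi> g) - (p f + p g) \<in> D" .
    then have "proj_along D U (\<pi> f + \<pi> g) = p f + p g"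
      by (intro proj_along_unique subspace_add[OF subspace_W \<pi>_W \<pi>_W])
         (auto simp: p_def intro: subspace_add[OF subspace_U] proj_along_D_U(1) \<pi>_W)
    then show "p (f + g) = p f + p g" by (simp only: p_def linear_add[OF \<pi>(2)])
  next
    fix c f
    have "c *\<^sub>R \<pi> f - c *\<^sub>R p f = c *\<^sub>R (\<pi> f - p f)" by (simp only: scaleR_diff_right)
    also have "\<dots> \<in> D" unfolding p_def by (intro subspace_scale[OF subspace_D] proj_along_D_U(2) \<pi>_W)
    finally have "c *\<^sub>R \<pi> f - c *\<^sub>R p f \<in> D" .
    then have "proj_along D U (c *\<^sub>R \<pi> f) = c *\<^sub>R p f"
      by (intro proj_along_unique subspace_scale[OF subspace_W \<pi>_W])
         (auto simp: p_def intro: subspace_scale[OF subspace_U] proj_along_D_U(1) \<pi>_W)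
    then show "p (c *\<^sub>R f) = c *\<^sub>R p f" by (simp only: p_def linear_scale[OF \<pi>(2)])
  qed
  have extension: "form_extension h (boundary_form \<Gamma> P Q R) p W D U K G \<Lambda>"
  proof (rule form_extension.intro, goal_cases)
    case 1 show ?case by (rule h_bilinear)
  next
    case 2 show ?case by (rule p_linear)
  next
    case (3) show ?case by (rule subspace_W)
  next
    case (4) show ?case by (rule subspace_D)
  next
    case (5) show ?case by (rule D_W)
  next
    case (6) show ?case by (rule subspace_U)
  next
    case (7) show ?case by (rule U_W)
  next
    case (8) show ?case by (rule finite_dimensional_U)
  next
    case (9 f) then show ?case using proj_along_D_U(1) p_eq by simp
  next
    case (10 f) then show ?case using proj_along_D_U(2) by (simp only: p_eq)
  next
    case (11 u)
    then show ?case using proj_along_unique[OF UW[of u], of u] subspace_0[OF subspace_D] p_eq[OF UW[of u]] by simp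
  next
    case (12 f)
    then show ?case using proj_along_unique[OF DW[of f], of 0] subspace_0[OF subspace_U] p_eq[OF DW[of f]] by simp
  next
    case (13 f g)
    then show ?case using om_D[of f g] h_eq DW by (simp add: om_def)
  next
    case 14 show ?case by (rule subspace_K)
  next
    case 15 show ?case by (rule KW)
  next
    case (16 k g)
    then show ?case using h_eq[of k g] L2_W by (auto simp: K_iff)
  next
    case (17 f)
    have "ip d (L f) = 0" if "d \<in> D" for d
      using 17(2)[OF that] h_eq[OF 17(1) DW[OF that]] L2.sym[OF L_L2[OF 17(1)] subsetD[OF L2_W DW[OF that]]] by simp
    then show ?case using orthogonal_dense[OF L_L2[OF 17(1)]] 17(1) by (simp add: K_iff)
  next
    case (18 u)
    show ?case
    proof (rule range_orthogonal_kernel[OF UW[OF 18(1)]])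
      fix k assume k: "k \<in> K"
      then show "ip (L u) k = 0" using 18(2)[OF k] h_eq[OF UW[OF 18(1)] subsetD[OF KW k]] by simp
    qed
  next
    case (19 u)
    \<comment> \<open>D pairs to 0 with W, so a vector orthogonal to U is orthogonal to W; by
      \<open>om_nondegenerate\<close> it lies in \<open>D \<inter> U\<close>.\<close>
    have "om u g = 0" if g: "g \<in> W" for g
    proof -
      obtain v where v: "v \<in> U" "g - v \<in> D" using decompose_W[OF g] by blast
      have "om v u = 0" using 19(2)[OF v(1)] h_eq UW v(1) 19(1) by (simp add: om_def)
      moreover have "om g u = om ((g - v) + v) u" by simp
      moreover have "\<dots> = om (g - v) u + om v u" by (rule om_add[OF DW[OF v(2)] UW[OF v(1)] UW[OF 19(1)]])
      ultimately show ?thesis using om_D[OF v(2) UW[OF 19(1)]] om_antisym[of u g] by simp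
    qed
    then show ?case using om_nondegenerate[OF UW[OF 19(1)]] 19(1) D_Int_U by blast
  next
    case (20 f g)
    then show ?case using boundary_form_eq[OF UW UW] h_eq[OF UW UW] by (simp add: om_def)
  next
    case 21 show ?case by (rule lagrangian_G)
  next
    case 22 show ?case by (rule \<Lambda>)
  next
    case (23 g)
    obtain c where c: "\<forall>n. g - c n \<in> D" "\<forall>n. c n \<in> W" "(\<lambda>n. ip (L (c n)) (c n)) \<longlonglongrightarrow> 0"
      "\<forall>w\<in>W. (\<lambda>n. ip (L w) (c n)) \<longlonglongrightarrow> 0" using Dirichlet_approximation[OF 23] by blast
    then show ?case using h_eq by (intro exI[of _ c]) simp
  qed
  have X: "morse_index \<Gamma> (extension_op \<Gamma> P Q R X) = neg_index (subspace_sum D X) (\<lambda>f. h f f)"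
    if "X \<subseteq> U" for X
  proof -
    have "subspace_sum D X \<subseteq> W" using that unfolding W_eq subspace_sum_def by blast
    then show ?thesis
      unfolding morse_index_def extension_op_def minimal_op_def maximal_op_def
      using h_eq by (auto simp: op_form_def subset_iff intro!: neg_index_cong)
  qed
  have "G \<subseteq> U" "\<Lambda> \<subseteq> U" using lagrangian_G \<Lambda> by (auto simp: lagrangian_def)
  note index = X[OF \<open>\<Lambda> \<subseteq> U\<close>] X[OF \<open>G \<subseteq> U\<close>, unfolded G_def]
  have "p ` K = proj_along D U ` K" using p_eq KW by (intro image_cong) auto
  then show ?thesis using form_extension.index_difference[OF extension] fin unfolding index G_def by simp
qed

end

theorem theorem1:
  fixes \<Gamma> :: "('v, 'e) metric_graph"
    and P Q R :: "'e \<Rightarrow> real \<Rightarrow> real^'d^'d"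
    and U \<Lambda> :: "('e \<Rightarrow> real \<Rightarrow> real^'d) set"
  assumes "is_metric_graph \<Gamma>"
    and "sl_coefficients \<Gamma> P Q R"
    and "L2_operator \<Gamma> (minimal_op \<Gamma> P Q R)"
    and "closed_op \<Gamma> (minimal_op \<Gamma> P Q R)"
    and "densely_defined \<Gamma> (minimal_op \<Gamma> P Q R)"
    and "symmetric_op \<Gamma> (minimal_op \<Gamma> P Q R)"
    and "fredholm_op \<Gamma> (minimal_op \<Gamma> P Q R)"
    and "is_adjoint \<Gamma> (maximal_op \<Gamma> P Q R) (minimal_op \<Gamma> P Q R)"
    and "boundary_space \<Gamma> P Q R U"
    and "lagrangian (boundary_form \<Gamma> P Q R) U \<Lambda>"
    and "form_bounded_below \<Gamma> (minimal_op \<Gamma> P Q R)"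
    and "form_bounded_below \<Gamma> (extension_op \<Gamma> P Q R \<Lambda>)"
    and "morse_index \<Gamma> (extension_op \<Gamma> P Q R (dirichlet_space \<Gamma> U)) < \<infinity>"
  shows "ereal_of_enat (morse_index \<Gamma> (extension_op \<Gamma> P Q R \<Lambda>))
           - ereal_of_enat (morse_index \<Gamma> (extension_op \<Gamma> P Q R (dirichlet_space \<Gamma> U)))
         = ereal (of_int (triple_index (boundary_form \<Gamma> P Q R)
             (proj_along (dom (minimal_op \<Gamma> P Q R)) U ` ker \<Gamma> (maximal_op \<Gamma> P Q R))
             \<Lambda> (dirichlet_space \<Gamma> U)))"
proof -
  interpret sturm_liouville_extension \<Gamma> P Q R U
    by unfold_locales (fact assms)+
  \<comment> \<open>Both indices are finite, so the difference of extended reals is the difference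
    of integers.\<close>
  obtain m n where "morse_index \<Gamma> (extension_op \<Gamma> P Q R \<Lambda>) = enat m"
    "morse_index \<Gamma> (extension_op \<Gamma> P Q R (dirichlet_space \<Gamma> U)) = enat n"
    and mn: "int m - int n = triple_index (boundary_form \<Gamma> P Q R)
             (proj_along (dom (minimal_op \<Gamma> P Q R)) U ` ker \<Gamma> (maximal_op \<Gamma> P Q R)) \<Lambda> (dirichlet_space \<Gamma> U)"
    using morse_index_difference[OF assms(10)] assms(13) by (auto simp: K_def minimal_op_def)
  then show ?thesis by (simp flip: mn)
qed

end
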